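(* Let $b_0=\sqrt{\gamma^2\mu_X/(2\sigma_X^2)}$ and, for $\beta>0$, $$F(\beta)=\sum_{m=1}^{\infty}\frac1m\,\frac{1}{\sqrt{2\pi}}\int_{\beta\sqrt m}^{\infty}e^{-x^2/2}\,dx.$$ As $s\to\infty$: (i) If $\alpha\in(0,1/2)$, then for all constants $b\in(0,b_0)$ (if $\gamma$, hence $b_0$, depends on $s$: for all constants $b$ with $0<b<\liminf_{s\to\infty}b_0$), $$\ln[\mathbb{P}(Q=0)]=O\bigl(\exp(-b^2s^{1-2\alpha})\bigr).$$ (ii) If $\alpha=1/2$, then $\ln[\mathbb{P}(Q=0)]$ equals $-F(b_0\sqrt2)$ with a relative error $O(1/\sqrt s)$. (iii) If $\alpha\in(1/2,1)$ and $0<b_0<\sqrt{2\pi}$, then $$\ln[\mathbb{P}(Q=0)]=\Bigl(-(\alpha-\tfrac12)\ln s+\ln(2b_0)+O(s^{1/2-\alpha})\Bigr)\bigl(1+O(s^{\alpha-1})\bigr).$$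
   Context: Let $X$ be a non-negative integer-valued random variable with mean $\mu_X>0$, variance $\sigma_X^2$ and probability generating function $X(z)=\sum_{j\ge 0}\mathbb{P}(X=j)z^j$, whose radius of convergence is $r>1$, and such that $|X(z)|<X(r_1)$ for all $z$ with $|z|=r_1$, $z\ne r_1$, and any $r_1\in(0,r)$. For positive integers $n,s$ the demand per period $A(k)$, $k=1,2,\dots$, is a sequence of i.i.d. random variables, each distributed as $A=X_1+\dots+X_n$, the sum of $n$ i.i.d. copies of $X$. The congestion process is the Markov chain $Q_0=0$, $Q_{k+1}=\max\{Q_k+A(k)-s,0\}$. It is assumed that $0<n\mu_X<s$ and that $\mathbb{P}(A=j)>0$ for some $j>s$. Let $Q$ have the stationary distribution of this chain. The system is scaled so that, along a sequence $s\to\infty$ with $n=n(s)$, $X$ fixed and $\alpha>0$ fixed, $$\rho_s=\frac{n\mu_X}{s}=1-\frac{\gamma}{s^{\alpha}},$$ with $\gamma>0$ (possibly depending on $s$) bounded away from $0$ and $\infty$ as $s\to\infty$. *)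

theory Defs
  imports "HOL-Probability.Probability" "HOL-Library.Landau_Symbols"
begin

definition pmf_mean :: "nat pmf \<Rightarrow> real" where
  "pmf_mean X = measure_pmf.expectation X real"

definition pmf_variance :: "nat pmf \<Rightarrow> real" where
  "pmf_variance X = measure_pmf.variance X real"

text \<open>The generating function is used both at real and at complex arguments.\<close>

definition pgf :: "nat pmf \<Rightarrow> 'a \<Rightarrow> 'a :: {banach, real_normed_algebra_1}" where
  "pgf X z = (\<Sum>j. of_real (pmf X j) * z ^ j)"

definition demand :: "nat pmf \<Rightarrow> nat \<Rightarrow> nat pmf" where
  "demand X n = map_pmf (\<lambda>x. \<Sum>i<n. x i) (Pi_pmf {..<n} 0 (\<lambda>_. X))"

text \<open>Subtraction on \<^typ>\<open>nat\<close> truncates, so \<^term>\<open>q + a - s\<close> is the maximum of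
  the integer \<open>q + a - s\<close> and \<open>0\<close>. Independence of the demands of different periods
  is what makes the one-step law below a Markov kernel.\<close>

definition congestion_kernel :: "nat pmf \<Rightarrow> nat \<Rightarrow> nat \<Rightarrow> nat \<Rightarrow> nat pmf" where
  "congestion_kernel X n s q = map_pmf (\<lambda>a. q + a - s) (demand X n)"

definition stationary_congestion :: "nat pmf \<Rightarrow> nat \<Rightarrow> nat \<Rightarrow> nat pmf \<Rightarrow> bool" where
  "stationary_congestion X n s Q \<longleftrightarrow> bind_pmf Q (congestion_kernel X n s) = Q"

definition b0 :: "nat pmf \<Rightarrow> real \<Rightarrow> real" where
  "b0 X \<gamma> = sqrt (\<gamma>\<^sup>2 * pmf_mean X / (2 * pmf_variance X))"

text \<open>The series runs over \<open>m \<ge> 1\<close>, written here as \<^term>\<open>Suc m\<close>.\<close>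

definition F :: "real \<Rightarrow> real" where
  "F \<beta> = (\<Sum>m. 1 / real (Suc m) *
     (1 / sqrt (2 * pi) * (LBINT x:{\<beta> * sqrt (real (Suc m))..}. exp (- x\<^sup>2 / 2))))"

end

theory Submission
  imports Defs "HOL-Complex_Analysis.Complex_Analysis" "HOL-Real_Asymp.Real_Asymp"
begin

text \<open>
  Let \<open>Y_N\<close> be the sum of \<open>N\<close> copies of \<open>X\<close>, \<open>\<mu>\<close> and \<open>v\<close> the mean and the variance of \<open>X\<close>. Everything rests on
  Spitzer's identity (\<open>pmf_stationary_0_eq\<close>)

    \<open>ln P(Q = 0) = - (\<Sum>l \<ge> 1. P(Y_{n l} > l s) / l)\<close>,

  which is derived from the stationarity of \<open>Q\<close> by a Wiener--Hopf argument: the equation for the generating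
  function of \<open>Q\<close> identifies a function holomorphic inside a circle with one holomorphic and bounded outside of
  a smaller circle, so both are constant.

  In the regimes \<open>\<alpha> \<ge> 1/2\<close> the probabilities are replaced by Gaussian tails. The Berry--Esseen bound
  (\<open>berry_esseen\<close>) gives the \<open>l\<close>-th term an error of order \<open>1 / (l \<surd>(n l))\<close>, and these errors add up to
  \<open>O(1 / \<surd>n)\<close>. Hence \<open>ln P(Q = 0) = - F(\<beta>) + O(1 / \<surd>s)\<close> with \<open>\<beta> = (s - n \<mu>) / \<surd>(n v)\<close>, and
  \<open>\<beta>\<close> is \<open>b0 \<surd>2 s powr (1/2 - \<alpha>)\<close> up to a factor \<open>1 + O(s powr (- \<alpha>))\<close>. The summands are integer-valued, so both
  distributions can be written by Fourier inversion and compared under the integral sign; the hypothesis on the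
  circle of radius 1 makes the characteristic function small away from 0.

  The function \<open>F\<close> is analysed through the formula (\<open>normal_tail_mixture\<close>)

    \<open>P(Z > x) = 1/\<pi> \<integral>_0^\<infinity> exp (- x\<^sup>2 (1 + u\<^sup>2) / 2) / (1 + u\<^sup>2) du\<close>

  for a standard normal \<open>Z\<close>, which turns the series for \<open>F(\<beta>)\<close> into the integral of
  \<open>- ln (1 - exp (- \<beta>\<^sup>2 (1 + u\<^sup>2) / 2)) / (1 + u\<^sup>2)\<close>. It follows that \<open>F\<close> is Lipschitz as a function of \<open>ln \<beta>\<close>
  (\<open>F_lipschitz_ln\<close>), which absorbs the factor \<open>1 + O(s powr (- \<alpha>))\<close>, and that
  \<open>F(\<beta>) = - ln (\<beta> \<surd>2) + O(\<beta>)\<close> as \<open>\<beta> \<rightarrow> 0\<close> (\<open>F_near_0\<close>). For \<open>\<alpha> = 1/2\<close> the argument of \<open>F\<close> stays bounded,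
  so that \<open>F\<close> is bounded below and the absolute error is a relative one. For \<open>\<alpha> > 1/2\<close> it tends to 0, and
  \<open>- F(b0 \<surd>2 s powr (1/2 - \<alpha>)) = ln (2 b0) - (\<alpha> - 1/2) ln s + O(s powr (1/2 - \<alpha>))\<close>.

  For \<open>\<alpha> < 1/2\<close> the terms of Spitzer's series are beyond the reach of a Gaussian approximation with absolute error,
  and a Chernoff bound is used instead. Its exponent is \<open>l (s - n \<mu>)\<^sup>2 / (2 n v)\<close> up to smaller terms, that is, at least
  \<open>l b\<^sup>2 s powr (1 - 2 \<alpha>)\<close> for every \<open>b < liminf b0\<close>
  once \<open>s\<close> is large.
\<close>

section \<open>Generating functions of laws on the naturals\<close>

lemma integrable_pmf_nat_iff:
  fixes f :: "nat \<Rightarrow> 'a :: {banach, second_countable_topology}"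
  shows "integrable (measure_pmf p) f \<longleftrightarrow> summable (\<lambda>j. pmf p j * norm (f j))"
  unfolding measure_pmf_eq_density
  by (subst integrable_density) (auto simp: integrable_count_space_nat_iff)

lemma expectation_pmf_nat_sums:
  fixes f :: "nat \<Rightarrow> 'a :: {banach, second_countable_topology}"
  assumes "summable (\<lambda>j. pmf p j * norm (f j))"
  shows "(\<lambda>j. pmf p j *\<^sub>R f j) sums measure_pmf.expectation p f"
proof -
  have i: "integrable (count_space UNIV) (\<lambda>j. pmf p j *\<^sub>R f j)"
    using assms by (simp add: integrable_count_space_nat_iff)
  have "measure_pmf.expectation p f = (\<Sum>j. pmf p j *\<^sub>R f j)"
    unfolding measure_pmf_eq_density
    by (subst integral_density) (auto simp: integral_count_space_nat[OF i])
  moreover have "summable (\<lambda>j. pmf p j *\<^sub>R f j)"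
    using assms by (intro summable_norm_cancel[of "\<lambda>j. pmf p j *\<^sub>R f j"]) simp
  ultimately show ?thesis by (simp add: sums_iff)
qed

lemma sums_pmf_nat: "pmf (p :: nat pmf) sums 1"
proof -
  have "summable (\<lambda>j. pmf p j * norm (1::real))"
    using integrable_pmf_nat_iff[of p "\<lambda>_. 1::real"] by simp
  from expectation_pmf_nat_sums[OF this] show ?thesis by simp
qed

lemma prob_pmf_nat_sums:
  "(\<lambda>j. pmf p j * indicator A j) sums measure_pmf.prob p (A :: nat set)"
proof -
  have "summable (\<lambda>j. pmf p j * norm (indicator A j :: real))"
    by (rule summable_comparison_test'[OF sums_summable[OF sums_pmf_nat[of p]], of 0])
       (auto simp: indicator_def)
  from expectation_pmf_nat_sums[OF this] show ?thesis by simp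
qed

lemma summable_norm_pgf:
  fixes z :: "'a :: {banach, real_normed_div_algebra}"
  assumes "summable (\<lambda>j. pmf p j * norm z ^ j)"
  shows "summable (\<lambda>j. norm (of_real (pmf p j) * z ^ j))"
  using assms by (simp add: norm_mult norm_power)

lemma pgf_sums:
  fixes z :: "'a :: {banach, real_normed_div_algebra}"
  assumes "summable (\<lambda>j. pmf p j * norm z ^ j)"
  shows "(\<lambda>j. of_real (pmf p j) * z ^ j) sums pgf p z"
  unfolding pgf_def by (rule summable_sums[OF summable_norm_cancel[OF summable_norm_pgf[OF assms]]])

lemma norm_pgf_le:
  fixes z :: "'a :: {banach, real_normed_div_algebra}"
  assumes "summable (\<lambda>j. pmf p j * R ^ j)" "norm z \<le> R"
  shows "norm (pgf p z) \<le> pgf p R"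
proof -
  have le: "pmf p j * norm z ^ j \<le> pmf p j * R ^ j" for j
    using assms(2) by (simp add: mult_left_mono power_mono)
  have s: "summable (\<lambda>j. pmf p j * norm z ^ j)"
    by (rule summable_comparison_test'[OF assms(1), of 0]) (simp add: le)
  have "norm (pgf p z) \<le> (\<Sum>j. norm (of_real (pmf p j) * z ^ j))"
    unfolding pgf_def by (rule summable_norm[OF summable_norm_pgf[OF s]])
  also have "\<dots> \<le> (\<Sum>j. pmf p j * R ^ j)"
    using le by (intro suminf_le summable_norm_pgf[OF s] assms(1)) (simp add: norm_mult norm_power)
  finally show ?thesis by (simp add: pgf_def)
qed

lemma pgf_0: "pgf p (0 :: 'a :: {banach, real_normed_div_algebra}) = of_real (pmf p 0)"
proof -
  have "pgf p (0 :: 'a) = (\<Sum>j. of_real (pmf p j) * 0 ^ j)" by (simp add: pgf_def)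
  also have "\<dots> = (\<Sum>j\<in>{0}. of_real (pmf p j) * 0 ^ j)" by (rule suminf_finite) auto
  finally show ?thesis by simp
qed

lemma pgf_1: "pgf p (1 :: 'a :: {banach, real_normed_div_algebra}) = 1"
  using sums_of_real[OF sums_pmf_nat[of p], where ?'a = 'a] by (simp add: pgf_def sums_iff)

definition conv_pmf :: "nat pmf \<Rightarrow> nat pmf \<Rightarrow> nat pmf" where
  "conv_pmf p q = map_pmf (\<lambda>(x, y). x + y) (pair_pmf p q)"

lemma pmf_conv_pmf: "pmf (conv_pmf p q) k = (\<Sum>i\<le>k. pmf p i * pmf q (k - i))"
proof -
  have eq: "(\<lambda>(x, y). x + y) -` {k} = (\<lambda>i. (i, k - i)) ` {..k}" by (auto simp: image_iff)
  have "pmf (conv_pmf p q) k = measure_pmf.prob (pair_pmf p q) ((\<lambda>i. (i, k - i)) ` {..k})"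
    unfolding conv_pmf_def pmf_map eq ..
  also have "\<dots> = (\<Sum>i\<le>k. pmf p i * pmf q (k - i))"
    by (subst measure_measure_pmf_finite) (auto simp: sum.reindex inj_on_def pmf_pair)
  finally show ?thesis .
qed

lemma pgf_conv_pmf:
  fixes z :: "'a :: {banach, real_normed_field}"
  assumes p: "summable (\<lambda>j. pmf p j * norm z ^ j)" and q: "summable (\<lambda>j. pmf q j * norm z ^ j)"
  shows "summable (\<lambda>j. pmf (conv_pmf p q) j * norm z ^ j)"
    and "pgf (conv_pmf p q) z = pgf p z * pgf q z"
proof -
  have *: "(\<Sum>i\<le>k. (of_real (pmf p i) * w ^ i) * (of_real (pmf q (k - i)) * w ^ (k - i)))
     = of_real (pmf (conv_pmf p q) k) * w ^ k" for k and w :: "'b :: {banach, real_normed_field}"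
    unfolding pmf_conv_pmf of_real_sum of_real_mult sum_distrib_right
    by (intro sum.cong refl) (auto simp: power_add[symmetric] mult_ac)
  show "summable (\<lambda>j. pmf (conv_pmf p q) j * norm z ^ j)"
    using Cauchy_product_sums[of "\<lambda>j. of_real (pmf p j) * norm z ^ j" "\<lambda>j. of_real (pmf q j) * norm z ^ j"]
      summable_norm_pgf[of p "norm z"] summable_norm_pgf[of q "norm z"] p q
    unfolding * by (auto simp: sums_iff)
  show "pgf (conv_pmf p q) z = pgf p z * pgf q z"
    using Cauchy_product_sums[OF summable_norm_pgf[OF p] summable_norm_pgf[OF q]]
    unfolding * by (auto simp: pgf_def sums_iff)
qed

lemma demand_0: "demand X 0 = return_pmf 0"
  by (simp add: demand_def)

lemma demand_Suc: "demand X (Suc N) = conv_pmf X (demand X N)"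
proof -
  have "demand X (Suc N) = map_pmf (\<lambda>x. \<Sum>i<Suc N. x i)
      (map_pmf (\<lambda>(y, f). f(N := y)) (pair_pmf X (Pi_pmf {..<N} 0 (\<lambda>_. X))))"
    unfolding demand_def lessThan_Suc by (subst Pi_pmf_insert) auto
  also have "\<dots> = conv_pmf X (demand X N)"
    unfolding demand_def conv_pmf_def pmf.map_comp pair_map_pmf2
    by (intro map_pmf_cong) (auto simp: sum.If_cases intro!: sum.cong)
  finally show ?thesis .
qed

lemma pgf_demand:
  fixes z :: "'a :: {banach, real_normed_field}"
  assumes "summable (\<lambda>j. pmf X j * norm z ^ j)"
  shows "summable (\<lambda>j. pmf (demand X N) j * norm z ^ j) \<and> pgf (demand X N) z = pgf X z ^ N"
proof (induction N)
  case 0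
  have "(\<lambda>j. of_real (pmf (demand X 0) j) * w ^ j) sums 1" for w :: "'b :: {banach, real_normed_field}"
    using sums_finite[of "{0}" "\<lambda>j. of_real (pmf (demand X 0) j) * w ^ j"]
    by (auto simp: demand_0)
  from this[of "norm z"] this[of z] show ?case by (auto simp: sums_iff pgf_def)
next
  case (Suc N)
  then show ?case using pgf_conv_pmf[OF assms, of "demand X N"] by (simp add: demand_Suc)
qed

lemma summable_pgf:
  assumes "ereal R < conv_radius (pmf X)" "0 \<le> R"
  shows "summable (\<lambda>j. pmf X j * R ^ j)"
  using summable_in_conv_radius[of R "pmf X"] assms by simp

lemma holomorphic_suminf:
  fixes f :: "nat \<Rightarrow> complex \<Rightarrow> complex"
  assumes "open S" "\<And>m. f m holomorphic_on S" "summable M"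
    and "\<And>m z. z \<in> S \<Longrightarrow> norm (f m z) \<le> M m"
  shows "(\<lambda>z. \<Sum>m. f m z) holomorphic_on S"
proof (rule holomorphic_uniform_sequence[OF assms(1)])
  show "(\<lambda>z. \<Sum>m<k. f m z) holomorphic_on S" for k by (intro holomorphic_intros assms)
  fix x assume "x \<in> S"
  then obtain d where d: "d > 0" "cball x d \<subseteq> S"
    using assms(1) open_contains_cball by blast
  have "uniform_limit (cball x d) (\<lambda>k z. \<Sum>m<k. f m z) (\<lambda>z. \<Sum>m. f m z) sequentially"
    by (rule Weierstrass_m_test[OF _ assms(3)]) (use assms(4) d in auto)
  with d show "\<exists>d>0. cball x d \<subseteq> S \<and>
     uniform_limit (cball x d) (\<lambda>k z. \<Sum>m<k. f m z) (\<lambda>z. \<Sum>m. f m z) sequentially"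
    by blast
qed

section \<open>Stationarity and exponential moments\<close>

lemma pmf_mean_sums:
  assumes "conv_radius (pmf X) > 1"
  shows "(\<lambda>j. diffs (pmf X) j * 1 ^ j) sums pmf_mean X"
proof -
  obtain R where R: "1 < R" "ereal R < conv_radius (pmf X)"
    using assms ereal_dense2[of 1 "conv_radius (pmf X)"] by auto
  have "summable (\<lambda>j. diffs (pmf X) j * 1 ^ j)"
    by (rule termdiff_converges[of 1 R]) (use R in \<open>auto intro!: summable_in_conv_radius less_trans[OF _ R(2)]\<close>)
  then have s: "summable (\<lambda>j. real (Suc j) * pmf X (Suc j))"
    by (simp add: diffs_def)
  then have s2: "summable (\<lambda>j. pmf X j * norm (real j))"
    by (subst summable_Suc_iff[symmetric]) (simp add: mult.commute)
  have "(\<lambda>j. pmf X j * real j) sums pmf_mean X"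
    using expectation_pmf_nat_sums[OF s2] by (simp add: pmf_mean_def)
  then have "(\<lambda>j. pmf X (Suc j) * real (Suc j)) sums pmf_mean X"
    using sums_Suc_iff[of "\<lambda>j. pmf X j * real j" "pmf_mean X"] by simp
  then show ?thesis by (simp add: diffs_def mult.commute)
qed

lemma DERIV_pgf_1:
  assumes "conv_radius (pmf X) > 1"
  shows "DERIV (pgf X) (1 :: real) :> pmf_mean X"
proof -
  obtain R where R: "1 < R" "ereal R < conv_radius (pmf X)"
    using assms ereal_dense2[of 1 "conv_radius (pmf X)"] by auto
  have "DERIV (\<lambda>x. \<Sum>j. pmf X j * x ^ j) (1::real) :> (\<Sum>j. diffs (pmf X) j * 1 ^ j)"
    by (rule termdiffs_strong[of _ R]) (use R in \<open>auto intro!: summable_in_conv_radius\<close>)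
  moreover have "(\<Sum>j. diffs (pmf X) j * 1 ^ j) = pmf_mean X"
    using pmf_mean_sums[OF assms] by (simp add: sums_iff)
  ultimately show ?thesis by (simp add: pgf_def[abs_def])
qed

text \<open>Because \<open>pgf X x ^ n - x ^ s\<close> vanishes at 1 and has derivative \<open>n \<mu> - s < 0\<close> there.\<close>

lemma pgf_power_less:
  assumes "conv_radius (pmf X) > 1" "real n * pmf_mean X < real s"
  obtains R where "1 < R" "ereal R < conv_radius (pmf X)"
    "\<And>x. 1 < x \<Longrightarrow> x \<le> R \<Longrightarrow> pgf X x ^ n < (x :: real) ^ s"
proof -
  obtain R where R: "1 < R" "ereal R < conv_radius (pmf X)"
    using assms ereal_dense2[of 1 "conv_radius (pmf X)"] by auto
  have "DERIV (\<lambda>x. pgf X x ^ n - x ^ s) (1 :: real) :> real n * pmf_mean X - real s"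
    by (rule derivative_eq_intros DERIV_pgf_1[OF assms(1)] refl)+ (simp add: pgf_1)
  from DERIV_neg_dec_right[OF this] assms(2) obtain d
    where d: "d > 0" "\<And>h. 0 < h \<Longrightarrow> h < d \<Longrightarrow> pgf X (1 + h) ^ n - (1 + h) ^ s < (0::real)"
    by (auto simp: pgf_1)
  define R' where "R' = min R (1 + d / 2)"
  show ?thesis
  proof
    show "1 < R'" using R d by (simp add: R'_def)
    have "ereal R' \<le> ereal R" by (simp add: R'_def)
    then show "ereal R' < conv_radius (pmf X)" using R(2) by (rule le_less_trans)
    fix x :: real assume x: "1 < x" "x \<le> R'"
    then have "x - 1 < d" using d(1) by (auto simp: R'_def min_def split: if_splits)
    with d(2)[of "x - 1"] x show "pgf X x ^ n < x ^ s" by simp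
  qed
qed

lemma stationary_congestion_eq:
  assumes "stationary_congestion X n s Q"
  shows "Q = map_pmf (\<lambda>c. c - s) (conv_pmf Q (demand X n))"
proof -
  have "Q = bind_pmf Q (congestion_kernel X n s)"
    using assms by (simp add: stationary_congestion_def)
  also have "\<dots> = map_pmf (\<lambda>c. c - s) (conv_pmf Q (demand X n))"
    by (simp add: conv_pmf_def pair_pmf_def map_pmf_def congestion_kernel_def[abs_def]
        bind_assoc_pmf bind_return_pmf)
  finally show ?thesis .
qed

lemma expectation_conv_pmf:
  fixes g :: "nat \<Rightarrow> real"
  assumes g: "\<And>k. 0 \<le> g k" "\<And>k. g k \<le> B"
  shows "measure_pmf.expectation (conv_pmf p q) g
    = measure_pmf.expectation p (\<lambda>x. measure_pmf.expectation q (\<lambda>y. g (x + y)))"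
proof -
  let ?E = "measure_pmf.expectation"
  have i: "integrable (measure_pmf p) (\<lambda>x. h x)" if "\<And>x. 0 \<le> h x" "\<And>x. h x \<le> B"
    for h :: "nat \<Rightarrow> real" and p
    by (rule measure_pmf.integrable_const_bound[where B = B]) (use that in auto)
  have E: "0 \<le> ?E q (\<lambda>y. g (x + y))" "?E q (\<lambda>y. g (x + y)) \<le> B" for x
    using g i[of "\<lambda>y. g (x + y)"] by (auto intro!: measure_pmf.integral_le_const)
  have "ennreal (?E (conv_pmf p q) g) = (\<integral>\<^sup>+ k. g k \<partial>measure_pmf (conv_pmf p q))"
    by (rule nn_integral_eq_integral[symmetric]) (use g i in auto)
  also have "\<dots> = (\<integral>\<^sup>+ x. (\<integral>\<^sup>+ y. g (x + y) \<partial>measure_pmf q) \<partial>measure_pmf p)"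
    by (simp add: conv_pmf_def pair_pmf_def)
  also have "\<dots> = (\<integral>\<^sup>+ x. ennreal (?E q (\<lambda>y. g (x + y))) \<partial>measure_pmf p)"
    by (intro nn_integral_cong nn_integral_eq_integral) (use g i in auto)
  also have "\<dots> = ennreal (?E p (\<lambda>x. ?E q (\<lambda>y. g (x + y))))"
    by (rule nn_integral_eq_integral) (use E i in auto)
  finally show ?thesis
    using g(1) E(1) by (subst (asm) ennreal_inj) (auto intro!: integral_nonneg_AE)
qed

text \<open>Stationarity of the bounded function \<open>min (R ^ q) (R ^ J)\<close> gives a bound on
  \<open>\<Sum>j\<le>J. P(Q = j) R ^ j\<close> that does not depend on \<open>J\<close>, because one step of the
  chain multiplies \<open>R ^ q\<close> by a factor below 1, up to an additive constant.\<close>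

lemma summable_pgf_stationary:
  assumes st: "stationary_congestion X n s Q"
    and R: "1 < R" "summable (\<lambda>j. pmf X j * R ^ j)" "pgf X R ^ n < R ^ s"
  shows "summable (\<lambda>j. pmf Q j * R ^ j)"
proof -
  define \<theta> where "\<theta> = pgf X R ^ n / R ^ s"
  have \<theta>: "\<theta> < 1" using R by (simp add: \<theta>_def)
  have "pgf X R \<ge> 0"
    unfolding pgf_def using R by (intro suminf_nonneg) auto
  then have \<theta>0: "0 \<le> \<theta>" using R by (simp add: \<theta>_def)
  have D: "summable (\<lambda>j. pmf (demand X n) j * R ^ j)" "pgf (demand X n) R = \<theta> * R ^ s"
    using pgf_demand[of X R n] R by (auto simp: \<theta>_def)
  let ?E = "measure_pmf.expectation"
  have iD: "integrable (measure_pmf (demand X n)) (\<lambda>a. R ^ a)"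
    using D(1) R(1) by (simp add: integrable_pmf_nat_iff)
  have ED: "?E (demand X n) (\<lambda>a. R ^ a) = \<theta> * R ^ s"
    using expectation_pmf_nat_sums[of "demand X n" "\<lambda>a. R ^ a"] D R(1)
    by (auto simp: pgf_def sums_iff)
  have bound: "(\<Sum>j\<le>J. pmf Q j * R ^ j) \<le> 1 / (1 - \<theta>)" for J
  proof -
    define V where "V q = min (R ^ q) (R ^ J)" for q :: nat
    define W where "W q = min (1 + \<theta> * R ^ q) (R ^ J)" for q :: nat
    have V0: "0 \<le> V q" "0 \<le> W q" for q using R(1) \<theta>0 by (auto simp: V_def W_def)
    have VB: "norm (V q) \<le> R ^ J" "norm (W q) \<le> R ^ J" for q
      using V0[of q] by (auto simp: V_def W_def)
    have int: "integrable (measure_pmf p) V" "integrable (measure_pmf p) W" for p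
      by (rule measure_pmf.integrable_const_bound[where B = "R ^ J"]; use VB in auto)+
    have step: "?E (demand X n) (\<lambda>a. V (q + a - s)) \<le> W q" for q
    proof -
      have le: "R ^ (q + a - s) \<le> 1 + R ^ q * R ^ a / R ^ s" for a
      proof (cases "q + a \<ge> s")
        case True
        then show ?thesis using R(1) by (simp add: power_diff power_add)
      next
        case False
        then show ?thesis using R(1) by simp
      qed
      have i1: "integrable (measure_pmf (demand X n)) (\<lambda>a. V (q + a - s))"
        by (rule measure_pmf.integrable_const_bound[where B = "R ^ J"]; use VB in auto)
      have "?E (demand X n) (\<lambda>a. V (q + a - s)) \<le> ?E (demand X n) (\<lambda>a. 1 + R ^ q * R ^ a / R ^ s)"
        by (intro integral_mono i1) (use iD le in \<open>auto simp: V_def intro: min.coboundedI1\<close>)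
      also have "\<dots> = 1 + \<theta> * R ^ q"
        using iD R(1) by (simp add: ED)
      finally have "?E (demand X n) (\<lambda>a. V (q + a - s)) \<le> 1 + \<theta> * R ^ q" .
      moreover have "?E (demand X n) (\<lambda>a. V (q + a - s)) \<le> ?E (demand X n) (\<lambda>a. R ^ J)"
        by (intro integral_mono i1) (auto simp: V_def)
      ultimately show ?thesis by (simp add: W_def)
    qed
    have "?E Q V = ?E (conv_pmf Q (demand X n)) (\<lambda>c. V (c - s))"
      by (subst stationary_congestion_eq[OF st]) simp
    also have "\<dots> = ?E Q (\<lambda>q. ?E (demand X n) (\<lambda>a. V (q + a - s)))"
      by (rule expectation_conv_pmf[where B = "R ^ J"]) (use V0 in \<open>auto simp: V_def\<close>)
    also have "\<dots> \<le> ?E Q W"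
    proof (intro integral_mono int step)
      show "integrable (measure_pmf Q) (\<lambda>q. ?E (demand X n) (\<lambda>a. V (q + a - s)))"
      proof (rule measure_pmf.integrable_const_bound[where B = "R ^ J"])
        have "norm (?E (demand X n) (\<lambda>a. V (q + a - s))) \<le> R ^ J" for q
          by (rule order_trans[OF integral_norm_bound], rule measure_pmf.integral_le_const)
            (auto intro!: measure_pmf.integrable_const_bound[where B = "R ^ J"] simp: VB[simplified])
        then show "AE q in measure_pmf Q. norm (?E (demand X n) (\<lambda>a. V (q + a - s))) \<le> R ^ J"
          by simp
      qed simp
    qed
    finally have EVW: "?E Q V \<le> ?E Q W" .
    have "(1 - \<theta>) * (\<Sum>j\<le>J. pmf Q j * R ^ j) - (\<Sum>j\<le>J. pmf Q j)
        = (\<Sum>j\<le>J. ((1 - \<theta>) * R ^ j - 1) * pmf Q j)"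
      by (simp add: sum_distrib_left sum_subtractf sum.distrib algebra_simps)
    also have "\<dots> = (\<Sum>j\<le>J. (((1 - \<theta>) * R ^ j - 1) * indicator {..J} j) * pmf Q j)"
      by (intro sum.cong) auto
    also have "\<dots> = ?E Q (\<lambda>j. ((1 - \<theta>) * R ^ j - 1) * indicator {..J} j)"
      by (subst integral_measure_pmf_real[of "{..J}"]) (auto simp: indicator_def split: if_splits)
    also have "\<dots> \<le> ?E Q (\<lambda>q. V q - W q)"
    proof (rule integral_mono)
      show "integrable (measure_pmf Q) (\<lambda>j. ((1 - \<theta>) * R ^ j - 1) * indicator {..J} j)"
        unfolding integrable_pmf_nat_iff by (rule summable_finite[of "{..J}"]) auto
      show "integrable (measure_pmf Q) (\<lambda>q. V q - W q)" using int by simp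
      fix q
      show "((1 - \<theta>) * R ^ q - 1) * indicator {..J} q \<le> V q - W q"
      proof (cases "q \<le> J")
        case True
        then have "R ^ q \<le> R ^ J" using R(1) by (intro power_increasing) auto
        with True show ?thesis by (auto simp: V_def W_def algebra_simps min_def)
      next
        case False
        then have "R ^ J \<le> R ^ q" using R(1) by (intro power_increasing) auto
        with False show ?thesis by (auto simp: V_def W_def)
      qed
    qed
    also have "\<dots> \<le> 0" using EVW int by simp
    finally have "(1 - \<theta>) * (\<Sum>j\<le>J. pmf Q j * R ^ j) \<le> (\<Sum>j\<le>J. pmf Q j)" by simp
    also have "\<dots> \<le> 1"
      using measure_measure_pmf_finite[of "{..J}" Q] measure_pmf.prob_le_1[of Q "{..J}"] by simp
    finally show ?thesis using \<theta> by (simp add: field_simps)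
  qed
  show ?thesis
  proof (rule bounded_imp_summable)
    show "0 \<le> pmf Q j * R ^ j" for j using R(1) by simp
  qed (rule bound)
qed

section \<open>Spitzer's identity\<close>

lemma pgf_tail_sums:
  fixes z :: "'a :: {banach, real_normed_field}"
  assumes z: "z \<noteq> 0" and s: "summable (\<lambda>j. pmf p j * norm z ^ j)"
  shows "(\<lambda>i. of_real (pmf p (m + Suc i)) * z ^ Suc i) sums
    (pgf p z / z ^ m - (\<Sum>j\<le>m. of_real (pmf p j) * (1 / z) ^ (m - j)))"
proof -
  have "(\<lambda>i. of_real (pmf p (i + Suc m)) * z ^ (i + Suc m)) sums
      (pgf p z - (\<Sum>j<Suc m. of_real (pmf p j) * z ^ j))"
    using pgf_sums[OF s] by (subst sums_iff_shift) simp
  then have "(\<lambda>i. of_real (pmf p (i + Suc m)) * z ^ (i + Suc m) / z ^ m) sums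
      ((pgf p z - (\<Sum>j<Suc m. of_real (pmf p j) * z ^ j)) / z ^ m)"
    by (rule sums_divide)
  also have "(\<lambda>i. of_real (pmf p (i + Suc m)) * z ^ (i + Suc m) / z ^ m)
      = (\<lambda>i. of_real (pmf p (m + Suc i)) * z ^ Suc i)"
    using z by (auto simp: power_add add_ac)
  also have "(pgf p z - (\<Sum>j<Suc m. of_real (pmf p j) * z ^ j)) / z ^ m
      = pgf p z / z ^ m - (\<Sum>j\<le>m. of_real (pmf p j) * (1 / z) ^ (m - j))"
    unfolding diff_divide_distrib sum_divide_distrib lessThan_Suc_atMost
    using z by (intro arg_cong2[of _ _ _ _ minus] sum.cong refl)
      (auto simp: power_divide power_diff)
  finally show ?thesis .
qed

text \<open>The truncation at 0 only affects the values \<open>Q + A \<le> s\<close>, so up to it stationarity says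
  \<open>Q(z) = Q(z) A(z) z\<^sup>-\<^sup>s\<close>. The correction is a polynomial in \<open>1 / z\<close>; this is the
  Wiener--Hopf equation of the chain.\<close>

lemma stationary_pgf_equation:
  fixes z :: complex
  assumes st: "stationary_congestion X n s Q" and z: "z \<noteq> 0"
    and X: "summable (\<lambda>j. pmf X j * norm z ^ j)" and Q: "summable (\<lambda>j. pmf Q j * norm z ^ j)"
  shows "pgf Q z * (1 - pgf X z ^ n / z ^ s)
    = of_real (pmf Q 0) - (\<Sum>j\<le>s. of_real (pmf (conv_pmf Q (demand X n)) j) * (1 / z) ^ (s - j))"
proof -
  let ?C = "conv_pmf Q (demand X n)"
  have C: "summable (\<lambda>j. pmf ?C j * norm z ^ j)" "pgf ?C z = pgf Q z * pgf X z ^ n"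
    using pgf_conv_pmf[OF Q, of "demand X n"] pgf_demand[OF X, of n] by auto
  have "pmf Q (Suc i) = pmf ?C (s + Suc i)" for i
  proof -
    have "(\<lambda>c. c - s) -` {Suc i} = {s + Suc i}" by auto
    then show ?thesis
      by (subst stationary_congestion_eq[OF st]) (simp add: pmf_map measure_pmf_single)
  qed
  then have "(\<lambda>i. of_real (pmf Q (Suc i)) * z ^ Suc i) sums
      (pgf ?C z / z ^ s - (\<Sum>j\<le>s. of_real (pmf ?C j) * (1 / z) ^ (s - j)))"
    using pgf_tail_sums[OF z C(1), of s] by simp
  moreover have "(\<lambda>i. of_real (pmf Q (Suc i)) * z ^ Suc i) sums (pgf Q z - of_real (pmf Q 0))"
    using pgf_sums[OF Q] by (subst sums_Suc_iff) simp
  ultimately have "pgf ?C z / z ^ s - (\<Sum>j\<le>s. of_real (pmf ?C j) * (1 / z) ^ (s - j))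
      = pgf Q z - of_real (pmf Q 0)"
    by (rule sums_unique2)
  then show ?thesis by (simp add: C(2) algebra_simps)
qed

text \<open>Spitzer's identity for the stationary idle probability. Put \<open>f(z) = pgf X z ^ n / z ^ s\<close>, the transform of
  one increment, and let \<open>U(z) + L(1/z) = - ln (1 - f(z))\<close> be the splitting of the logarithmic series into the
  positive and the nonpositive powers of \<open>z\<close>. It converges on an annulus just outside the unit circle, where
  \<open>\<bar>f\<bar> < 1\<close>. There the Wiener--Hopf equation reads \<open>Q(z) exp (- U(z)) = \<nu>(1/z) exp (L(1/z))\<close>. The left side is
  holomorphic inside the outer circle, the right side is holomorphic and bounded outside the inner one, so both are
  pieces of one constant function by Liouville's theorem. Its value at 0 is \<open>P(Q = 0)\<close>, and its value
  at 1 is \<open>exp (- U(1))\<close>, where \<open>U(1)\<close> is the sum on the right of the claim.\<close>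

lemma pmf_stationary_0_eq:
  assumes rad: "conv_radius (pmf X) > 1" and load: "real n * pmf_mean X < real s"
    and st: "stationary_congestion X n s Q"
  defines "t \<equiv> \<lambda>l. measure_pmf.prob (demand X (n * l)) {s * l<..} / real l"
  shows "summable (\<lambda>m. t (Suc m))" and "pmf Q 0 = exp (- (\<Sum>m. t (Suc m)))"
proof -
  obtain R where R: "1 < R" "ereal R < conv_radius (pmf X)"
    and less: "\<And>x. 1 < x \<Longrightarrow> x \<le> R \<Longrightarrow> pgf X x ^ n < (x :: real) ^ s"
    using pgf_power_less[OF rad load] by blast
  have sX: "summable (\<lambda>j. pmf X j * x ^ j)" if "0 \<le> x" "x \<le> R" for x
    by (rule summable_pgf) (use that R in \<open>auto intro: le_less_trans[of _ "ereal R"]\<close>)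
  define \<theta> where "\<theta> x = pgf X x ^ n / x ^ s" for x :: real
  have \<theta>1: "\<theta> x < 1" if "1 < x" "x \<le> R" for x
    using less[OF that] that by (simp add: \<theta>_def)
  define Y where "Y l = demand X (n * l)" for l
  have sY: "summable (\<lambda>j. pmf (Y l) j * x ^ j)" if "0 \<le> x" "x \<le> R" for x l
    using pgf_demand[of X x "n * l"] sX[OF that] that by (simp add: Y_def)
  have pY: "pgf (Y l) z = pgf X z ^ (n * l)" if "norm z \<le> R"
    for l and z :: "'a :: {banach, real_normed_field}"
    using pgf_demand[of X z "n * l"] sX[of "norm z"] that by (simp add: Y_def)
  \<comment> \<open>\<open>P l\<close> and \<open>N l\<close> are the parts of the transform of the \<open>l\<close>-th partial sum carried by its positive and
    its nonpositive values; \<open>N l\<close> takes the argument \<open>1 / z\<close> and is then a polynomial.\<close>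
  define P where "P l z = (\<Sum>i. complex_of_real (pmf (Y l) (s * l + Suc i)) * z ^ Suc i)" for l z
  define N where "N l \<zeta> = (\<Sum>j\<le>s * l. complex_of_real (pmf (Y l) j) * \<zeta> ^ (s * l - j))" for l \<zeta>
  define P' where "P' l x = (\<Sum>i. pmf (Y l) (s * l + Suc i) * x ^ Suc i)" for l and x :: real
  define N' where "N' l \<zeta> = (\<Sum>j\<le>s * l. pmf (Y l) j * \<zeta> ^ (s * l - j))" for l and \<zeta> :: real
  have P'sums: "(\<lambda>i. pmf (Y l) (s * l + Suc i) * x ^ Suc i) sums (\<theta> x ^ l - N' l (1 / x))"
    if "0 < x" "x \<le> R" for x l
    using pgf_tail_sums[of x "Y l" "s * l"] sY[of x l] that
    by (simp add: pY \<theta>_def N'_def power_divide power_mult)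
  have PN: "P l z + N l (1 / z) = (pgf X z ^ n / z ^ s) ^ l" if "z \<noteq> 0" "norm z \<le> R" for z l
    using pgf_tail_sums[of z "Y l" "s * l"] sY[of "norm z" l] that
    by (simp add: pY P_def N_def power_divide power_mult sums_iff)
  have PN': "P' l x + N' l (1 / x) = \<theta> x ^ l" if "0 < x" "x \<le> R" for x l
    using P'sums[OF that, of l] by (simp add: P'_def sums_iff)
  have N'0: "0 \<le> N' l \<zeta>" if "0 \<le> \<zeta>" for l \<zeta>
    unfolding N'_def using that by (intro sum_nonneg) auto
  have P'0: "0 \<le> P' l x" if "0 < x" "x \<le> R" for l x
    unfolding P'_def using that sums_summable[OF P'sums[OF that]] by (intro suminf_nonneg) auto
  have Pterm: "norm (complex_of_real (pmf (Y l) (s * l + Suc i)) * z ^ Suc i)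
      \<le> pmf (Y l) (s * l + Suc i) * x ^ Suc i" if "norm z \<le> x" for l i z x
    using power_mono[OF that, of "Suc i"]
    by (simp add: norm_mult norm_power mult_left_mono del: power_Suc)
  have Pb: "norm (P l z) \<le> \<theta> R ^ l" if "norm z \<le> R" for l z
  proof -
    have "norm (P l z) \<le> P' l R"
      unfolding P_def P'_def
      by (rule norm_suminf_le) (use Pterm[OF that] R sums_summable[OF P'sums[of R l]] in auto)
    also have "\<dots> \<le> \<theta> R ^ l" using PN'[of R l] N'0[of "1 / R" l] R by simp
    finally show ?thesis .
  qed
  \<comment> \<open>The inner circle of the annulus. It must lie outside the unit circle, where \<open>\<theta> = 1\<close>.\<close>
  define r where "r = (1 + R) / 2"
  have r: "1 < r" "r < R" using R by (auto simp: r_def)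
  have Nb: "norm (N l \<zeta>) \<le> \<theta> r ^ l" if "norm \<zeta> \<le> 1 / r" for l \<zeta>
  proof -
    have "norm (N l \<zeta>) \<le> N' l (1 / r)"
      unfolding N_def N'_def
      by (rule sum_norm_le) (use that in \<open>auto simp: norm_mult norm_power intro!: mult_left_mono power_mono\<close>)
    also have "\<dots> \<le> \<theta> r ^ l" using PN'[of r l] P'0[of r l] r by simp
    finally show ?thesis .
  qed
  have \<theta>0: "0 \<le> \<theta> x" if "0 < x" "x \<le> R" for x
    using PN'[of x 1] P'0[of x 1] N'0[of "1 / x" 1] that by simp
  have geo: "summable (\<lambda>m. \<theta> x ^ Suc m)" if "1 < x" "x \<le> R" for x
    using \<theta>0[of x] \<theta>1[of x] that by (subst summable_Suc_iff) (auto intro!: summable_geometric)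
  have div_le: "norm (w / of_nat (Suc m)) \<le> B" if "norm w \<le> B" for w :: complex and B m
  proof -
    have "norm (w / of_nat (Suc m)) = norm w / real (Suc m)"
      by (simp only: norm_divide norm_of_nat)
    also have "\<dots> \<le> norm w" by (simp add: field_simps)
    finally show ?thesis using that by linarith
  qed
  define U where "U z = (\<Sum>m. P (Suc m) z / of_nat (Suc m))" for z
  define L where "L \<zeta> = (\<Sum>m. N (Suc m) \<zeta> / of_nat (Suc m))" for \<zeta>
  have Pholo: "P l holomorphic_on ball 0 R" for l
    unfolding P_def[abs_def]
    by (rule holomorphic_suminf[OF _ _ sums_summable[OF P'sums[of R l]]])
       (use R Pterm in \<open>auto intro!: holomorphic_intros simp del: power_Suc\<close>)
  have Uholo: "U holomorphic_on ball 0 R"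
    unfolding U_def[abs_def]
    by (rule holomorphic_suminf[OF _ _ geo[of R]])
       (use R div_le Pb in \<open>auto intro!: holomorphic_intros Pholo simp del: power_Suc of_nat_Suc\<close>)
  have Nholo: "N l holomorphic_on ball 0 (1 / r)" for l
    unfolding N_def[abs_def] by (intro holomorphic_intros)
  have Lholo: "L holomorphic_on ball 0 (1 / r)"
    unfolding L_def[abs_def]
    by (rule holomorphic_suminf[OF _ _ geo[of r]])
       (use r div_le Nb in \<open>auto intro!: holomorphic_intros Nholo simp del: power_Suc of_nat_Suc\<close>)
  have Usum: "summable (\<lambda>m. P (Suc m) z / of_nat (Suc m))" if "norm z \<le> R" for z
    by (rule summable_comparison_test'[OF geo[of R], of 0])
       (use R div_le Pb that in \<open>auto simp del: power_Suc of_nat_Suc\<close>)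
  have Lsum: "summable (\<lambda>m. N (Suc m) z / of_nat (Suc m))" if "norm z \<le> 1 / r" for z
    by (rule summable_comparison_test'[OF geo[of r], of 0])
       (use r div_le Nb that in \<open>auto simp del: power_Suc of_nat_Suc\<close>)
  have Ub: "norm (U z) \<le> (\<Sum>m. \<theta> R ^ Suc m)" if "norm z \<le> R" for z
    unfolding U_def by (rule norm_suminf_le[OF _ geo]) (use R div_le Pb that in \<open>auto simp del: power_Suc of_nat_Suc\<close>)
  have Lb: "norm (L z) \<le> (\<Sum>m. \<theta> r ^ Suc m)" if "norm z \<le> 1 / r" for z
    unfolding L_def by (rule norm_suminf_le[OF _ geo]) (use r div_le Nb that in \<open>auto simp del: power_Suc of_nat_Suc\<close>)
  have inv_le: "norm (1 / z) \<le> 1 / r" if "r \<le> norm z" for z :: complex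
    using that r by (simp add: norm_divide frac_le)
  have expUL: "exp (- U z) = (1 - pgf X z ^ n / z ^ s) * exp (L (1 / z))"
    if z: "r \<le> norm z" "norm z \<le> R" for z
  proof -
    let ?f = "pgf X z ^ n / z ^ s"
    have z0: "z \<noteq> 0" using z r by auto
    have "norm ?f \<le> \<theta> (norm z)"
      unfolding \<theta>_def norm_divide norm_power
      by (intro divide_right_mono power_mono norm_pgf_le sX) (use z in auto)
    with \<theta>1[of "norm z"] z r have f1: "norm ?f < 1" by simp
    have nz: "norm (1 / z) \<le> 1 / r" by (rule inv_le[OF z(1)])
    have "(\<lambda>m. ?f ^ Suc m / of_nat (Suc m)) sums (U z + L (1 / z))"
      using sums_add[OF summable_sums[OF Usum] summable_sums[OF Lsum[OF nz]]] z
      by (auto simp: U_def L_def PN[OF z0 z(2), symmetric] add_divide_distrib simp del: power_Suc of_nat_Suc)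
    moreover have "(\<lambda>m. ?f ^ Suc m / of_nat (Suc m)) sums (- ln (1 - ?f))"
    proof -
      have "(\<lambda>m. ?f ^ m / of_nat m) sums (- ln (1 - ?f))"
        using sums_minus[OF Ln_series'[of "- ?f"]] f1 by simp
      then show ?thesis
        using sums_Suc_iff[of "\<lambda>m. ?f ^ m / of_nat m" "- ln (1 - ?f)"] by simp
    qed
    ultimately have "U z + L (1 / z) = - ln (1 - ?f)" by (rule sums_unique2)
    then have "- U z = ln (1 - ?f) + L (1 / z)" by (metis add.commute add_diff_cancel_left' diff_minus_eq_add minus_diff_eq minus_minus)
    then have "exp (- U z) = exp (ln (1 - ?f)) * exp (L (1 / z))" by (simp only: exp_add)
    also have "exp (ln (1 - ?f)) = 1 - ?f" 
    proof (rule exp_Ln)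
      have "?f \<noteq> 1"
      proof
        assume "?f = 1"
        then have "norm ?f = 1" by (simp only: norm_one)
        with f1 show False by simp
      qed
      then show "1 - ?f \<noteq> 0" by (simp only: right_minus_eq)
    qed
    finally show ?thesis .
  qed
  have sQ: "summable (\<lambda>j. pmf Q j * R ^ j)"
    by (rule summable_pgf_stationary[OF st]) (use R sX[of R] less in auto)
  have sQ': "summable (\<lambda>j. pmf Q j * x ^ j)" if "0 \<le> x" "x \<le> R" for x
    by (rule summable_comparison_test'[OF sQ, of 0]) (use that in \<open>auto intro!: mult_left_mono power_mono\<close>)
  define c where "c j = complex_of_real (pmf (conv_pmf Q (demand X n)) j)" for j
  define \<nu> where "\<nu> \<zeta> = of_real (pmf Q 0) - (\<Sum>j\<le>s. c j * \<zeta> ^ (s - j))" for \<zeta>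
  define G where "G z = (if z \<in> ball 0 R then pgf Q z * exp (- U z) else \<nu> (1 / z) * exp (L (1 / z)))" for z
  have agree: "pgf Q z * exp (- U z) = \<nu> (1 / z) * exp (L (1 / z))"
    if z: "r \<le> norm z" "norm z \<le> R" for z
  proof -
    have "\<nu> (1 / z) = pgf Q z * (1 - pgf X z ^ n / z ^ s)"
      unfolding \<nu>_def c_def
      by (rule stationary_pgf_equation[OF st, symmetric]) (use z r sX sQ' in auto)
    then show ?thesis using expUL[OF z] by simp
  qed
  have Qholo: "pgf Q holomorphic_on ball 0 R"
    unfolding pgf_def[abs_def]
    by (rule holomorphic_suminf[OF _ _ sQ])
       (auto intro!: holomorphic_intros mult_left_mono power_mono simp: norm_mult norm_power)
  have "G holomorphic_on (ball 0 R \<union> - cball 0 r)"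
    unfolding G_def[abs_def]
  proof (rule holomorphic_on_If_Un)
    show "(\<lambda>z. pgf Q z * exp (- U z)) holomorphic_on ball 0 R"
      by (intro holomorphic_intros Qholo Uholo)
    have "(L \<circ> (\<lambda>z. 1 / z)) holomorphic_on - cball 0 r"
      by (rule holomorphic_on_compose_gen[OF _ Lholo])
         (use r in \<open>auto intro!: holomorphic_intros divide_strict_left_mono mult_pos_pos simp: norm_divide\<close>)
    then have "(\<lambda>z. L (1 / z)) holomorphic_on - cball 0 r" by (simp add: o_def)
    then show "(\<lambda>z. \<nu> (1 / z) * exp (L (1 / z))) holomorphic_on - cball 0 r"
      unfolding \<nu>_def using r by (auto intro!: holomorphic_intros)
  qed (use agree in auto)
  moreover have "ball 0 R \<union> - cball 0 r = (UNIV :: complex set)" using r by auto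
  ultimately have holo: "G holomorphic_on UNIV" by simp
  have bounded: "bounded (range G)"
  proof -
    let ?B1 = "pgf Q R * exp (\<Sum>m. \<theta> R ^ Suc m)"
    let ?B2 = "(pmf Q 0 + (\<Sum>j\<le>s. norm (c j))) * exp (\<Sum>m. \<theta> r ^ Suc m)"
    have "norm (G z) \<le> max ?B1 ?B2" for z
    proof (cases "z \<in> ball 0 R")
      case True
      then have z: "norm z \<le> R" by simp
      have "norm (exp (- U z)) \<le> exp (\<Sum>m. \<theta> R ^ Suc m)"
        by (rule order_trans[OF norm_exp]) (use Ub[OF z] in simp)
      moreover have "norm (pgf Q z) \<le> pgf Q R" by (rule norm_pgf_le[OF sQ z])
      ultimately have "norm (G z) \<le> ?B1"
        using True by (auto simp: G_def norm_mult intro!: mult_mono simp del: norm_exp_eq_Re intro: order_trans[OF norm_ge_zero])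
      then show ?thesis by simp
    next
      case False
      then have z: "norm (1 / z) \<le> 1 / r" using r by (intro inv_le) auto
      have "norm (exp (L (1 / z))) \<le> exp (\<Sum>m. \<theta> r ^ Suc m)"
        by (rule order_trans[OF norm_exp]) (use Lb[OF z] in simp)
      moreover have "norm (\<nu> (1 / z)) \<le> pmf Q 0 + (\<Sum>j\<le>s. norm (c j))"
      proof -
        have "norm (c j * (1 / z) ^ (s - j)) \<le> norm (c j)" for j
        proof -
          have "norm (1 / z) \<le> 1" using z r by (auto intro: order_trans)
          then have "norm (1 / z) ^ (s - j) \<le> 1" by (intro power_le_one) auto
          then show ?thesis by (simp only: norm_mult norm_power mult_left_le norm_ge_zero)
        qed
        then have "norm (\<Sum>j\<le>s. c j * (1 / z) ^ (s - j)) \<le> (\<Sum>j\<le>s. norm (c j))"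
          by (intro sum_norm_le) auto
        then show ?thesis unfolding \<nu>_def
          by (intro order_trans[OF norm_triangle_ineq4]) simp
      qed
      ultimately have "norm (G z) \<le> ?B2"
        using False unfolding G_def by (auto simp only: norm_mult if_False intro!: mult_mono intro: order_trans[OF norm_ge_zero])
      then show ?thesis by simp
    qed
    then show ?thesis by (auto simp: bounded_iff)
  qed
  from Liouville_theorem[OF holo bounded] have "G 0 = G 1"
    by (auto simp: constant_on_def)
  moreover have "G 0 = of_real (pmf Q 0)"
    using R by (simp add: G_def U_def P_def pgf_0)
  moreover have "G 1 = exp (- U 1)" using R by (simp add: G_def pgf_1)
  ultimately have main: "of_real (pmf Q 0) = exp (- U 1)" by simp
  have P1: "P l 1 = complex_of_real (measure_pmf.prob (Y l) {s * l<..})" for l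
  proof -
    have "(\<lambda>i. pmf (Y l) (i + Suc (s * l)) * indicator {s * l<..} (i + Suc (s * l)))
        sums (measure_pmf.prob (Y l) {s * l<..} - (\<Sum>j<Suc (s * l). pmf (Y l) j * indicator {s * l<..} j))"
      using prob_pmf_nat_sums[of "Y l" "{s * l<..}"] by (subst sums_iff_shift) simp
    then have "(\<lambda>i. pmf (Y l) (s * l + Suc i)) sums measure_pmf.prob (Y l) {s * l<..}"
      by (simp add: add_ac)
    from sums_of_real[OF this, where ?'a = complex] show ?thesis by (simp add: P_def sums_iff)
  qed
  have "(\<lambda>m. complex_of_real (t (Suc m))) sums U 1"
    using summable_sums[OF Usum[of 1]] R by (simp add: U_def P1 t_def Y_def)
  then have *: "summable (\<lambda>m. t (Suc m))" "U 1 = of_real (\<Sum>m. t (Suc m))"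
    by (auto simp: sums_iff summable_of_real_iff suminf_of_real)
  show "summable (\<lambda>m. t (Suc m))" by fact
  have "complex_of_real (pmf Q 0) = of_real (exp (- (\<Sum>m. t (Suc m))))"
    by (simp only: main * of_real_minus[symmetric] exp_of_real)
  then show "pmf Q 0 = exp (- (\<Sum>m. t (Suc m)))" by (simp only: of_real_eq_iff)
qed

section \<open>The Gaussian tail as a mixture of exponentials\<close>

definition normal_tail :: "real \<Rightarrow> real" where
  "normal_tail x = 1 / sqrt (2 * pi) * (LBINT t:{x..}. exp (- t\<^sup>2 / 2))"

text \<open>One plus the square of a variable with this law is, up to the factor \<open>x\<^sup>2 / 2\<close>, the random exponent
  in the mixture that yields the Gaussian tail at \<open>x\<close>.\<close>

definition half_cauchy :: "real measure" where
  "half_cauchy = density lborel (\<lambda>u. ennreal (2 / pi / (1 + u\<^sup>2)) * indicator {0..} u)"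

lemma one_plus_sq_pos: "0 < 1 + (u :: real)\<^sup>2"
  by (simp add: add_pos_nonneg)

lemma nn_integral_half_cauchy:
  assumes [measurable]: "g \<in> borel_measurable borel" and "\<And>u. 0 \<le> g u"
  shows "(\<integral>\<^sup>+u. ennreal (g u) \<partial>half_cauchy)
    = ennreal (2 / pi) * (\<integral>\<^sup>+u. ennreal (g u / (1 + u\<^sup>2)) * indicator {0..} u \<partial>lborel)"
proof -
  have "ennreal (2 / pi / (1 + u\<^sup>2)) * indicator {0..} u * ennreal (g u)
    = ennreal (2 / pi) * (ennreal (g u / (1 + u\<^sup>2)) * indicator {0..} u)" for u
    using assms(2)[of u] one_plus_sq_pos[of u]
    by (auto simp: indicator_def ennreal_mult[symmetric] less_imp_le)
  then show ?thesis
    unfolding half_cauchy_def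
    by (subst nn_integral_density) (auto simp: nn_integral_cmult)
qed

lemma sets_half_cauchy [measurable_cong]: "sets half_cauchy = sets borel"
  by (simp add: half_cauchy_def)

lemma prob_space_half_cauchy: "prob_space half_cauchy"
proof
  have "(\<integral>\<^sup>+u. ennreal (1 / (1 + u\<^sup>2)) * indicator {0..} u \<partial>lborel) = pi / 2 - arctan 0"
    by (rule nn_integral_FTC_atLeast[OF _ _ _ tendsto_arctan_at_top])
       (auto intro!: derivative_eq_intros simp: inverse_eq_divide)
  then have "(\<integral>\<^sup>+u. ennreal 1 \<partial>half_cauchy) = 1"
    by (subst nn_integral_half_cauchy) (auto simp: ennreal_mult[symmetric] simp del: ennreal_1)
  then show "emeasure half_cauchy (space half_cauchy) = 1" by simp
qed

lemma half_gauss_nn_integral: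
  assumes "0 < (y :: real)"
  shows "(\<integral>\<^sup>+u. ennreal (exp (- (y\<^sup>2 * u\<^sup>2 / 2))) * indicator {0..} u \<partial>lborel) = sqrt (pi / 2) / y"
proof -
  have "has_bochner_integral lborel (\<lambda>x. indicator {0..} (0 + y / sqrt 2 * x) *\<^sub>R exp (- (0 + y / sqrt 2 * x)\<^sup>2))
      ((sqrt pi / 2) /\<^sub>R \<bar>y / sqrt 2\<bar>)"
    by (rule lborel_has_bochner_integral_real_affine_iff[THEN iffD1, OF _ gaussian_moment_0])
       (use assms in simp)
  also have "(\<lambda>x. indicator {0..} (0 + y / sqrt 2 * x) *\<^sub>R exp (- (0 + y / sqrt 2 * x)\<^sup>2))
    = (\<lambda>u. exp (- (y\<^sup>2 * u\<^sup>2 / 2)) * indicator {0..} u)"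
    using assms by (auto simp: indicator_def power_mult_distrib power_divide zero_le_divide_iff zero_le_mult_iff fun_eq_iff)
  also have "(sqrt pi / 2) /\<^sub>R \<bar>y / sqrt 2\<bar> = sqrt (pi / 2) / y"
    using assms by (simp add: real_sqrt_divide field_simps)
  finally have *: "has_bochner_integral lborel (\<lambda>u. exp (- (y\<^sup>2 * u\<^sup>2 / 2)) * indicator {0..} u) (sqrt (pi / 2) / y)" .
  have "(\<integral>\<^sup>+u. ennreal (exp (- (y\<^sup>2 * u\<^sup>2 / 2)) * indicator {0..} u) \<partial>lborel) = sqrt (pi / 2) / y"
    using nn_integral_eq_integral[of lborel "\<lambda>u. exp (- (y\<^sup>2 * u\<^sup>2 / 2)) * indicator {0..} u"] *
    by (auto simp: has_bochner_integral_iff)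
  then show ?thesis
    by (simp add: ennreal_mult' ennreal_indicator)
qed

lemma set_integrable_gauss: "set_integrable lborel A (\<lambda>t. exp (- t\<^sup>2 / 2 :: real))" if "A \<in> sets borel"
proof -
  have "integrable lborel (\<lambda>t. sqrt (2 * pi) * std_normal_density t)"
    using integrable_normal_density[of 1 0] by auto
  then have "integrable lborel (\<lambda>t. exp (- t\<^sup>2 / 2 :: real))"
    by (simp add: normal_density_def)
  then show ?thesis
    using that unfolding set_integrable_def by (intro integrable_mult_indicator) auto
qed

text \<open>A form of Craig's formula: the Gaussian tail is a mixture of exponentials \<open>exp (- c x\<^sup>2)\<close>. Both sides
  integrate \<open>y exp (- y\<^sup>2 (1 + u\<^sup>2) / 2)\<close> over \<open>u \<ge> 0\<close>, \<open>y \<ge> x\<close>.\<close>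

lemma normal_tail_mixture:
  assumes "0 < x"
  shows "integrable half_cauchy (\<lambda>u. exp (- (x\<^sup>2 * (1 + u\<^sup>2) / 2)))"
    and "(\<integral>u. exp (- (x\<^sup>2 * (1 + u\<^sup>2) / 2)) \<partial>half_cauchy) = 2 * normal_tail x"
proof -
  interpret prob_space half_cauchy by (rule prob_space_half_cauchy)
  have inner: "(\<integral>\<^sup>+y. ennreal (y * exp (- (y\<^sup>2 * (1 + u\<^sup>2) / 2))) * indicator {x..} y \<partial>lborel)
      = ennreal (exp (- (x\<^sup>2 * (1 + u\<^sup>2) / 2)) / (1 + u\<^sup>2))" for u :: real
  proof -
    have c: "0 < 1 + u\<^sup>2" by (rule one_plus_sq_pos)
    have lim: "((\<lambda>y. - exp (- (y\<^sup>2 * (1 + u\<^sup>2) / 2)) / (1 + u\<^sup>2)) \<longlongrightarrow> - 0 / (1 + u\<^sup>2)) at_top"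
    proof (intro tendsto_intros)
      have "filterlim (\<lambda>y::real. y\<^sup>2 * ((1 + u\<^sup>2) / 2)) at_top at_top"
        by (rule filterlim_at_top_mult_tendsto_pos[OF tendsto_const]
              filterlim_tendsto_pos_mult_at_top[OF tendsto_const] filterlim_pow_at_top
            | (subst mult.commute, rule filterlim_tendsto_pos_mult_at_top[OF tendsto_const]))+
           (use c in \<open>auto intro: filterlim_ident filterlim_pow_at_top\<close>)
      then have "((\<lambda>y::real. exp (- (y\<^sup>2 * ((1 + u\<^sup>2) / 2)))) \<longlongrightarrow> 0) at_top"
        by (intro filterlim_compose[OF exp_at_bot]) (simp add: filterlim_uminus_at_bot)
      then show "((\<lambda>y::real. exp (- (y\<^sup>2 * (1 + u\<^sup>2) / 2))) \<longlongrightarrow> 0) at_top" by simp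
    qed (use c in auto)
    have "(\<integral>\<^sup>+y. ennreal (y * exp (- (y\<^sup>2 * (1 + u\<^sup>2) / 2))) * indicator {x..} y \<partial>lborel)
        = ennreal (- 0 / (1 + u\<^sup>2) - - exp (- (x\<^sup>2 * (1 + u\<^sup>2) / 2)) / (1 + u\<^sup>2))"
    proof (rule nn_integral_FTC_atLeast[OF _ _ _ lim])
      fix y assume "x \<le> y"
      then show "0 \<le> y * exp (- (y\<^sup>2 * (1 + u\<^sup>2) / 2))" using assms by simp
      have "((\<lambda>y. - exp (- (y\<^sup>2 * c / 2)) / c) has_real_derivative y * exp (- (y\<^sup>2 * c / 2))) (at y)"
        if "0 < c" for c :: real
        using that by (auto intro!: derivative_eq_intros)
      from this[OF c] show "((\<lambda>y. - exp (- (y\<^sup>2 * (1 + u\<^sup>2) / 2)) / (1 + u\<^sup>2)) has_real_derivative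
          y * exp (- (y\<^sup>2 * (1 + u\<^sup>2) / 2))) (at y)" .
    qed simp
    then show ?thesis by simp
  qed
  have "(\<integral>\<^sup>+u. ennreal (exp (- (x\<^sup>2 * (1 + u\<^sup>2) / 2)) / (1 + u\<^sup>2)) * indicator {0..} u \<partial>lborel)
     = (\<integral>\<^sup>+u. (\<integral>\<^sup>+y. ennreal (y * exp (- (y\<^sup>2 * (1 + u\<^sup>2) / 2))) * indicator {x..} y * indicator {0..} u \<partial>lborel) \<partial>lborel)"
    by (simp add: nn_integral_multc inner)
  also have "\<dots> = (\<integral>\<^sup>+y. (\<integral>\<^sup>+u. ennreal (y * exp (- (y\<^sup>2 * (1 + u\<^sup>2) / 2))) * indicator {x..} y * indicator {0..} u \<partial>lborel) \<partial>lborel)"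
    by (rule lborel_pair.Fubini') simp
  also have "\<dots> = (\<integral>\<^sup>+y. ennreal (sqrt (pi / 2) * (indicator {x..} y * exp (- y\<^sup>2 / 2))) \<partial>lborel)"
  proof (rule nn_integral_cong)
    fix y :: real
    have eq: "ennreal (y * exp (- (y\<^sup>2 * (1 + u\<^sup>2) / 2))) * indicator {x..} y * indicator {0..} u
      = ennreal (indicator {x..} y * (y * exp (- y\<^sup>2 / 2))) * (ennreal (exp (- (y\<^sup>2 * u\<^sup>2 / 2))) * indicator {0..} u)" for u
      using assms by (auto simp: indicator_def ennreal_mult[symmetric] exp_add[symmetric] field_simps)
    show "(\<integral>\<^sup>+u. ennreal (y * exp (- (y\<^sup>2 * (1 + u\<^sup>2) / 2))) * indicator {x..} y * indicator {0..} u \<partial>lborel)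
      = ennreal (sqrt (pi / 2) * (indicator {x..} y * exp (- y\<^sup>2 / 2)))"
    proof (cases "x \<le> y")
      case True
      with assms have y: "0 < y" by simp
      show ?thesis
        unfolding eq using y True
        by (subst nn_integral_cmult) (auto simp: half_gauss_nn_integral[OF y] ennreal_mult[symmetric])
    qed (simp add: indicator_def)
  qed
  also have "\<dots> = ennreal (\<integral>y. sqrt (pi / 2) * (indicator {x..} y * exp (- y\<^sup>2 / 2)) \<partial>lborel)"
    using set_integrable_gauss[of "{x..}"]
    by (intro nn_integral_eq_integral) (auto simp: set_integrable_def)
  also have "(\<integral>y. sqrt (pi / 2) * (indicator {x..} y * exp (- y\<^sup>2 / 2)) \<partial>lborel) = pi * normal_tail x"
  proof -
    have "sqrt (pi / 2) = pi / sqrt (2 * pi)"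
      by (simp add: real_sqrt_divide real_sqrt_mult field_simps) 
    then show ?thesis
      by (simp add: normal_tail_def set_lebesgue_integral_def)
  qed
  finally have *: "(\<integral>\<^sup>+u. ennreal (exp (- (x\<^sup>2 * (1 + u\<^sup>2) / 2))) \<partial>half_cauchy) = ennreal (2 * normal_tail x)"
    by (subst nn_integral_half_cauchy) (auto simp: ennreal_mult'[symmetric] mult.assoc)
  show i: "integrable half_cauchy (\<lambda>u. exp (- (x\<^sup>2 * (1 + u\<^sup>2) / 2)))"
    by (rule integrable_const_bound[where B = 1]) (auto simp: one_plus_sq_pos less_imp_le mult_nonneg_nonneg)
  have "0 \<le> normal_tail x"
    unfolding normal_tail_def set_lebesgue_integral_def by (intro mult_nonneg_nonneg integral_nonneg_AE) auto
  with * show "(\<integral>u. exp (- (x\<^sup>2 * (1 + u\<^sup>2) / 2)) \<partial>half_cauchy) = 2 * normal_tail x"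
    by (subst (asm) nn_integral_eq_integral[OF i]) (auto intro!: integral_nonneg_AE)
qed

lemma normal_tail_pos:
  assumes "0 < x"
  shows "0 < normal_tail x"
proof -
  interpret prob_space half_cauchy by (rule prob_space_half_cauchy)
  have "0 < (\<integral>u. exp (- (x\<^sup>2 * (1 + u\<^sup>2) / 2)) \<partial>half_cauchy)"
    by (rule expectation_greater[OF normal_tail_mixture(1)[OF assms]]) auto
  then show ?thesis by (simp add: normal_tail_mixture(2)[OF assms])
qed

lemma normal_tail_le:
  assumes "0 < x"
  shows "2 * normal_tail x \<le> exp (- (x\<^sup>2 / 2))"
proof -
  interpret prob_space half_cauchy by (rule prob_space_half_cauchy)
  have "(\<integral>u. exp (- (x\<^sup>2 * (1 + u\<^sup>2) / 2)) \<partial>half_cauchy) \<le> exp (- (x\<^sup>2 / 2))"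
    by (intro integral_le_const normal_tail_mixture(1) assms) (auto simp: field_simps)
  then show ?thesis by (simp add: normal_tail_mixture(2)[OF assms])
qed

section \<open>The function F\<close>

lemma F_eq: "F \<beta> = (\<Sum>m. normal_tail (\<beta> * sqrt (real (Suc m))) / real (Suc m))"
  by (simp add: F_def normal_tail_def mult.commute)

text \<open>The logarithmic series at \<open>exp (- y)\<close>: the weights \<open>1 / m\<close> of \<^const>\<open>F\<close> turn a mixture of
  exponentials into a mixture of values of this function.\<close>

definition log_geom :: "real \<Rightarrow> real" where
  "log_geom y = - ln (1 - exp (- y))"

lemma log_geom_sums:
  assumes "0 < y"
  shows "(\<lambda>m. exp (- (real (Suc m) * y)) / real (Suc m)) sums log_geom y"
proof -
  let ?w = "exp (- y)"
  have w: "norm (complex_of_real (- ?w)) < 1" using assms by simp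
  have "(\<lambda>n. - ((- complex_of_real (- ?w)) ^ n) / of_nat n) sums ln (1 + complex_of_real (- ?w))"
    by (rule Ln_series') (rule w)
  also have "ln (1 + complex_of_real (- ?w)) = of_real (ln (1 - ?w))"
    using Ln_of_real[of "1 - ?w"] assms by simp
  finally have "(\<lambda>n. complex_of_real (- (?w ^ n / real n))) sums complex_of_real (ln (1 - ?w))"
    by simp
  then have "(\<lambda>n. - (?w ^ n / real n)) sums ln (1 - ?w)"
    by (simp only: sums_of_real_iff)
  then have "(\<lambda>n. ?w ^ n / real n) sums log_geom y"
    unfolding log_geom_def using sums_minus by fastforce
  then have "(\<lambda>m. ?w ^ Suc m / real (Suc m)) sums log_geom y"
    using sums_Suc_iff[of "\<lambda>m. ?w ^ m / real m" "log_geom y"] by simp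
  moreover have "?w ^ Suc m = exp (- (real (Suc m) * y))" for m
    by (simp only: exp_of_nat_mult[symmetric] mult_minus_right)
  ultimately show ?thesis by simp
qed

lemma log_geom_antimono:
  assumes "0 < y" "y \<le> y'" shows "log_geom y' \<le> log_geom y"
  using assms by (simp add: log_geom_def)

lemma log_geom_bounds:
  assumes "0 < y"
  shows "- ln y \<le> log_geom y" and "log_geom y \<le> - ln y + ln (1 + y)"
proof -
  have "1 - exp (- y) \<le> y" using exp_ge_add_one_self[of "- y"] by simp
  then show "- ln y \<le> log_geom y" using assms by (simp add: log_geom_def)
  have "y / (1 + y) \<le> 1 - exp (- y)"
    using exp_ge_add_one_self[of y] assms by (simp add: exp_minus field_simps)
  then have "ln (y / (1 + y)) \<le> ln (1 - exp (- y))" using assms by simp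
  then show "log_geom y \<le> - ln y + ln (1 + y)" using assms by (simp add: log_geom_def ln_div)
qed

text \<open>By concavity of \<open>1 - exp (- y)\<close>, which vanishes at 0.\<close>

lemma log_geom_scale:
  assumes "0 < y" "1 \<le> c"
  shows "log_geom y - ln c \<le> log_geom (c * y)"
proof -
  have "exp ((1 - 1 / c) *\<^sub>R 0 + (1 / c) *\<^sub>R (- (c * y))) \<le> (1 - 1 / c) * exp 0 + 1 / c * exp (- (c * y))"
    by (rule convex_onD[OF exp_convex]) (use assms in auto)
  then have "exp (- y) \<le> 1 - 1 / c + exp (- (c * y)) / c" using assms by simp
  then have "c * exp (- y) \<le> c * (1 - 1 / c + exp (- (c * y)) / c)"
    using assms by (intro mult_left_mono) auto
  also have "\<dots> = c - 1 + exp (- (c * y))" using assms by (simp add: distrib_left right_diff_distrib)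
  finally have "1 - exp (- (c * y)) \<le> c * (1 - exp (- y))" by (simp add: algebra_simps)
  then have "ln (1 - exp (- (c * y))) \<le> ln (c * (1 - exp (- y)))"
    using assms by (subst ln_le_cancel_iff) auto
  also have "\<dots> = ln c + ln (1 - exp (- y))" using assms by (subst ln_mult) auto
  finally show ?thesis by (simp add: log_geom_def)
qed

lemma mixture_rate_pos: "0 < \<beta> \<Longrightarrow> 0 < \<beta>\<^sup>2 * (1 + u\<^sup>2) / 2" for \<beta> u :: real
  using one_plus_sq_pos[of u] by simp

text \<open>Sum the mixture formula for the Gaussian tail at the points \<open>\<beta> \<surd>m\<close> against the weights \<open>1 / m\<close>. All
  later information on \<^const>\<open>F\<close> is read off from the elementary integrand.\<close>

lemma F_mixture:
  assumes "0 < \<beta>"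
  shows "summable (\<lambda>m. normal_tail (\<beta> * sqrt (real (Suc m))) / real (Suc m))"
    and "integrable half_cauchy (\<lambda>u. log_geom (\<beta>\<^sup>2 * (1 + u\<^sup>2) / 2))"
    and "2 * F \<beta> = (\<integral>u. log_geom (\<beta>\<^sup>2 * (1 + u\<^sup>2) / 2) \<partial>half_cauchy)"
proof -
  interpret prob_space half_cauchy by (rule prob_space_half_cauchy)
  define f where "f m u = exp (- (real (Suc m) * (\<beta>\<^sup>2 * (1 + u\<^sup>2) / 2))) / real (Suc m)" for m u
  define x where "x m = \<beta> * sqrt (real (Suc m))" for m
  have x: "0 < x m" "(x m)\<^sup>2 = \<beta>\<^sup>2 * real (Suc m)" for m
    using assms by (auto simp: x_def power_mult_distrib)
  have f_eq: "f m = (\<lambda>u. exp (- ((x m)\<^sup>2 * (1 + u\<^sup>2) / 2)) / real (Suc m))" for m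
    unfolding f_def x(2) by (simp add: mult_ac)
  have int: "integrable half_cauchy (f m)" "(\<integral>u. f m u \<partial>half_cauchy) = 2 * (normal_tail (x m) / real (Suc m))" for m
    unfolding f_eq using normal_tail_mixture[OF x(1)[of m]] by auto
  have f0: "0 \<le> f m u" for m u by (simp add: f_def)
  show s: "summable (\<lambda>m. normal_tail (\<beta> * sqrt (real (Suc m))) / real (Suc m))"
    unfolding x_def[symmetric]
  proof (rule summable_comparison_test'[of _ 0])
    show "summable (\<lambda>m. exp (- (\<beta>\<^sup>2 / 2)) ^ Suc m)"
      by (subst summable_Suc_iff, rule summable_geometric) (use assms in simp)
    fix m :: nat
    have "normal_tail (x m) / real (Suc m) \<le> normal_tail (x m)"
      using normal_tail_pos[OF x(1)[of m]] by (simp add: field_simps)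
    also have "\<dots> \<le> exp (- ((x m)\<^sup>2 / 2))"
      using normal_tail_le[OF x(1)[of m]] normal_tail_pos[OF x(1)[of m]] by linarith
    also have "\<dots> = exp (- (\<beta>\<^sup>2 / 2)) ^ Suc m"
      by (simp only: x(2) exp_of_nat_mult[symmetric]) (simp add: mult_ac)
    finally show "norm (normal_tail (x m) / real (Suc m)) \<le> exp (- (\<beta>\<^sup>2 / 2)) ^ Suc m"
      using normal_tail_pos[OF x(1)[of m]] by simp
  qed
  have sums: "(\<lambda>m. f m u) sums log_geom (\<beta>\<^sup>2 * (1 + u\<^sup>2) / 2)" for u
    unfolding f_def by (rule log_geom_sums) (rule mixture_rate_pos[OF assms])
  have eq: "(\<Sum>m. f m u) = log_geom (\<beta>\<^sup>2 * (1 + u\<^sup>2) / 2)" for u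
    using sums[of u] by (simp add: sums_iff)
  have ae: "AE u in half_cauchy. summable (\<lambda>m. norm (f m u))"
    using sums f0 by (auto simp: sums_iff)
  have si: "summable (\<lambda>m. \<integral>u. norm (f m u) \<partial>half_cauchy)"
    using summable_mult[OF s, of 2] by (simp add: f0 int(2) x_def)
  show "integrable half_cauchy (\<lambda>u. log_geom (\<beta>\<^sup>2 * (1 + u\<^sup>2) / 2))"
    using integrable_suminf[OF int(1) ae si] by (simp add: eq)
  have "(\<lambda>m. 2 * (normal_tail (x m) / real (Suc m))) sums (\<integral>u. log_geom (\<beta>\<^sup>2 * (1 + u\<^sup>2) / 2) \<partial>half_cauchy)"
    using sums_integral[OF int(1) ae si] by (simp add: eq int(2))
  moreover have "(\<lambda>m. 2 * (normal_tail (x m) / real (Suc m))) sums (2 * F \<beta>)"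
    unfolding F_eq x_def by (intro sums_mult summable_sums s)
  ultimately show "2 * F \<beta> = (\<integral>u. log_geom (\<beta>\<^sup>2 * (1 + u\<^sup>2) / 2) \<partial>half_cauchy)"
    by (rule sums_unique2[symmetric])
qed

lemma F_pos:
  assumes "0 < \<beta>" shows "0 < F \<beta>"
  unfolding F_eq
  by (rule suminf_pos[OF F_mixture(1)[OF assms]]) (use assms in \<open>auto intro!: divide_pos_pos normal_tail_pos\<close>)

text \<open>As \<open>log_geom y\<close> decreases and \<open>log_geom y + ln y\<close> increases with \<open>y\<close>, so do \<open>F \<beta>\<close> and
  \<open>F \<beta> + ln \<beta>\<close> with \<open>\<beta>\<close>.\<close>

lemma F_scale:
  assumes "0 < \<beta>" "\<beta> \<le> \<beta>'"
  shows "F \<beta>' \<le> F \<beta>" and "F \<beta> - F \<beta>' \<le> ln \<beta>' - ln \<beta>"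
proof -
  interpret prob_space half_cauchy by (rule prob_space_half_cauchy)
  have b': "0 < \<beta>'" using assms by simp
  define c where "c = (\<beta>' / \<beta>)\<^sup>2"
  have c: "1 \<le> c" "\<beta>'\<^sup>2 * (1 + u\<^sup>2) / 2 = c * (\<beta>\<^sup>2 * (1 + u\<^sup>2) / 2)" for u
    using assms by (auto simp: c_def power_divide intro!: power_mono)
  note i = F_mixture(2)[OF assms(1)] F_mixture(2)[OF b']
  have ic: "integrable half_cauchy (\<lambda>u. log_geom (c * (\<beta>\<^sup>2 * (1 + u\<^sup>2) / 2)))"
    using i(2) unfolding c(2) .
  have "2 * F \<beta>' \<le> 2 * F \<beta>"
    unfolding F_mixture(3)[OF assms(1)] F_mixture(3)[OF b']
    by (intro integral_mono i log_geom_antimono mixture_rate_pos assms)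
      (use assms in \<open>auto intro!: divide_right_mono mult_right_mono power_mono simp: one_plus_sq_pos less_imp_le\<close>)
  then show "F \<beta>' \<le> F \<beta>" by simp
  have "2 * F \<beta> - ln c = (\<integral>u. log_geom (\<beta>\<^sup>2 * (1 + u\<^sup>2) / 2) - ln c \<partial>half_cauchy)"
    using i unfolding F_mixture(3)[OF assms(1)] by (simp add: prob_space)
  also have "\<dots> \<le> 2 * F \<beta>'"
    unfolding F_mixture(3)[OF b'] c(2)
    by (intro integral_mono log_geom_scale mixture_rate_pos assms c(1) ic) (use i in simp)
  finally show "F \<beta> - F \<beta>' \<le> ln \<beta>' - ln \<beta>"
    using assms b' by (simp add: c_def ln_realpow ln_div)
qed

lemma F_lipschitz_ln:
  assumes "0 < \<beta>" "0 < \<beta>'"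
  shows "\<bar>F \<beta> - F \<beta>'\<bar> \<le> \<bar>ln \<beta> - ln \<beta>'\<bar>"
  using F_scale[of \<beta> \<beta>'] F_scale[of \<beta>' \<beta>] assms by (cases "\<beta> \<le> \<beta>'") (auto simp: abs_if)

text \<open>Write the logarithm as an integral over \<open>b \<in> [0, a]\<close> and swap; the inner integral is rational.\<close>

lemma half_cauchy_ln:
  assumes a: "0 < a" "a \<le> 1"
  shows "integrable half_cauchy (\<lambda>u. ln (1 + a\<^sup>2 * u\<^sup>2))"
    and "(\<integral>u. ln (1 + a\<^sup>2 * u\<^sup>2) \<partial>half_cauchy) = 2 * ln (1 + a)"
proof -
  let ?k = "\<lambda>b u. 2 * b * u\<^sup>2 / ((1 + b\<^sup>2 * u\<^sup>2) * (1 + u\<^sup>2)) :: real"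
  have p: "0 < 1 + b\<^sup>2 * u\<^sup>2" for b u :: real by (simp add: add_pos_nonneg)
  have ln_nn: "0 \<le> ln (1 + a\<^sup>2 * u\<^sup>2)" for u by simp
  have outer: "(\<integral>\<^sup>+b. ennreal (?k b u) * indicator {0..a} b \<partial>lborel)
      = ennreal (ln (1 + a\<^sup>2 * u\<^sup>2) / (1 + u\<^sup>2))" for u
  proof -
    have "(\<integral>\<^sup>+b. ennreal (?k b u) * indicator {0..a} b \<partial>lborel)
      = ennreal (ln (1 + a\<^sup>2 * u\<^sup>2) / (1 + u\<^sup>2) - ln (1 + 0\<^sup>2 * u\<^sup>2) / (1 + u\<^sup>2))"
    proof (rule nn_integral_FTC_Icc)
      fix b assume b: "b \<in> {0..a}"
      then show "0 \<le> ?k b u" by simp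
      show "((\<lambda>b. ln (1 + b\<^sup>2 * u\<^sup>2) / (1 + u\<^sup>2)) has_real_derivative ?k b u) (at b)"
        using p[of b u] one_plus_sq_pos[of u]
        by (auto intro!: derivative_eq_intros simp: mult_ac)
    qed (use a in auto)
    then show ?thesis by simp
  qed
  have inner: "(\<integral>\<^sup>+u. ennreal (?k b u) * indicator {0..} u \<partial>lborel) = ennreal (pi / (1 + b))"
    if b: "0 < b" "b < 1" for b
  proof -
    let ?G = "\<lambda>u. 2 * b / (1 - b\<^sup>2) * (arctan (b * u) / b - arctan u)"
    have b2: "b\<^sup>2 < 1" using b by (simp add: power_less_one_iff)
    have "(\<integral>\<^sup>+u. ennreal (?k b u) * indicator {0..} u \<partial>lborel)
      = ennreal (2 * b / (1 - b\<^sup>2) * ((pi / 2) / b - pi / 2) - ?G 0)"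
    proof (rule nn_integral_FTC_atLeast)
      fix u :: real
      show "0 \<le> ?k b u" using b by simp
      have "2 * b / (1 - b\<^sup>2) * (1 / (1 + b\<^sup>2 * u\<^sup>2) - 1 / (1 + u\<^sup>2)) = ?k b u"
        using b2 p[of b u] one_plus_sq_pos[of u]
        by (simp add: divide_simps) (simp add: algebra_simps)
      moreover have "(?G has_real_derivative 2 * b / (1 - b\<^sup>2) * (1 / (1 + b\<^sup>2 * u\<^sup>2) - 1 / (1 + u\<^sup>2))) (at u)"
        using b b2 by (auto intro!: derivative_eq_intros simp: inverse_eq_divide power_mult_distrib)
      ultimately show "(?G has_real_derivative ?k b u) (at u)" by simp
    next
      have "filterlim (\<lambda>u. b * u) at_top at_top"
        using b by (intro filterlim_tendsto_pos_mult_at_top[OF tendsto_const] filterlim_ident)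
      then have "((\<lambda>u. arctan (b * u)) \<longlongrightarrow> pi / 2) at_top"
        by (rule filterlim_compose[OF tendsto_arctan_at_top])
      then show "(?G \<longlongrightarrow> 2 * b / (1 - b\<^sup>2) * ((pi / 2) / b - pi / 2)) at_top"
        using b by (intro tendsto_intros tendsto_arctan_at_top) auto
    qed simp
    also have "2 * b / (1 - b\<^sup>2) * ((pi / 2) / b - pi / 2) - ?G 0 = pi / (1 + b)"
    proof -
      have "1 - b\<^sup>2 = (1 - b) * (1 + b)" by (simp add: power2_eq_square algebra_simps)
      then show ?thesis using b by (simp add: divide_simps) (simp add: algebra_simps)
    qed
    finally show ?thesis .
  qed
  have "(\<integral>\<^sup>+u. ennreal (ln (1 + a\<^sup>2 * u\<^sup>2) / (1 + u\<^sup>2)) * indicator {0..} u \<partial>lborel)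
     = (\<integral>\<^sup>+u. (\<integral>\<^sup>+b. ennreal (?k b u) * indicator {0..a} b * indicator {0..} u \<partial>lborel) \<partial>lborel)"
    by (simp add: nn_integral_multc outer)
  also have "\<dots> = (\<integral>\<^sup>+b. (\<integral>\<^sup>+u. ennreal (?k b u) * indicator {0..a} b * indicator {0..} u \<partial>lborel) \<partial>lborel)"
    by (rule lborel_pair.Fubini') simp
  also have "\<dots> = (\<integral>\<^sup>+b. ennreal (pi / (1 + b)) * indicator {0..a} b \<partial>lborel)"
    \<comment> \<open>At \<open>b = 0\<close> and, if \<open>a = 1\<close>, at \<open>b = a\<close> the computation of the inner integral breaks down.\<close>
  proof (rule nn_integral_cong_AE)
    have "AE b in lborel. b \<noteq> (0::real)" "AE b in lborel. b \<noteq> (1::real)"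
      by (rule AE_lborel_singleton)+
    then show "AE b in lborel. (\<integral>\<^sup>+u. ennreal (?k b u) * indicator {0..a} b * indicator {0..} u \<partial>lborel)
        = ennreal (pi / (1 + b)) * indicator {0..a} b"
    proof eventually_elim
      case (elim b)
      show ?case
      proof (cases "b \<in> {0..a}")
        case True
        with elim a have "0 < b" "b < 1" by auto
        with True show ?thesis by (simp add: inner)
      qed simp
    qed
  qed
  also have "\<dots> = ennreal (pi * ln (1 + a) - pi * ln (1 + 0))"
  proof (rule nn_integral_FTC_Icc)
    fix b assume b: "b \<in> {0..a}"
    then show "0 \<le> pi / (1 + b)" by simp
    show "((\<lambda>b. pi * ln (1 + b)) has_real_derivative pi / (1 + b)) (at b)"
      using b by (auto intro!: derivative_eq_intros)
  qed (use a in auto)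
  finally have *: "(\<integral>\<^sup>+u. ennreal (ln (1 + a\<^sup>2 * u\<^sup>2)) \<partial>half_cauchy) = ennreal (2 * ln (1 + a))"
    using a by (subst nn_integral_half_cauchy) (auto simp: ennreal_mult'[symmetric])
  show i: "integrable half_cauchy (\<lambda>u. ln (1 + a\<^sup>2 * u\<^sup>2))"
    by (rule integrableI_nonneg) (use * ln_nn in auto)
  show "(\<integral>u. ln (1 + a\<^sup>2 * u\<^sup>2) \<partial>half_cauchy) = 2 * ln (1 + a)"
    using * a by (subst (asm) nn_integral_eq_integral[OF i]) (auto intro!: integral_nonneg_AE)
qed

text \<open>Replace \<open>log_geom y\<close> by \<open>- ln y\<close>. With \<open>y = \<beta>\<^sup>2 (1 + u\<^sup>2) / 2\<close> and the mean \<open>2 ln 2\<close> of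
  \<open>ln (1 + u\<^sup>2)\<close> this gives the main terms. The error is at most \<open>ln (1 + y)\<close>, whose mean is of order \<open>\<beta>\<close>
  and not \<open>\<beta>\<^sup>2\<close> because the mixing law has a heavy tail.\<close>

lemma F_near_0:
  assumes "0 < \<beta>" "\<beta> \<le> 1"
  shows "\<bar>F \<beta> + ln \<beta> + ln 2 / 2\<bar> \<le> \<beta>"
proof -
  interpret prob_space half_cauchy by (rule prob_space_half_cauchy)
  define a where "a = \<beta> / sqrt 2"
  have a: "0 < a" "a \<le> 1" "a\<^sup>2 = \<beta>\<^sup>2 / 2"
    using assms by (auto simp: a_def power_divide intro: order_trans[OF _ less_imp_le])
  let ?y = "\<lambda>u. \<beta>\<^sup>2 * (1 + u\<^sup>2) / 2"
  have lny: "ln (?y u) = 2 * ln \<beta> - ln 2 + ln (1 + 1\<^sup>2 * u\<^sup>2)" for u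
    using assms one_plus_sq_pos[of u] by (simp add: ln_div ln_mult ln_realpow)
  have iy: "integrable half_cauchy (\<lambda>u. ln (?y u))" and
    Ey: "(\<integral>u. ln (?y u) \<partial>half_cauchy) = 2 * ln \<beta> + ln 2"
    using half_cauchy_ln[of 1] unfolding lny by (auto simp: prob_space)
  note i = F_mixture(2)[OF assms(1)]
  have "- (2 * ln \<beta> + ln 2) = (\<integral>u. - ln (?y u) \<partial>half_cauchy)" using Ey by simp
  also have "\<dots> \<le> 2 * F \<beta>"
    unfolding F_mixture(3)[OF assms(1)]
    by (intro integral_mono log_geom_bounds mixture_rate_pos assms i integrable_minus iy)
  finally have lower: "0 \<le> F \<beta> + ln \<beta> + ln 2 / 2" by simp
  have ln1: "ln (1 + ?y u) \<le> \<beta>\<^sup>2 / 2 + ln (1 + a\<^sup>2 * u\<^sup>2)" for u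
  proof -
    have "1 + ?y u \<le> (1 + \<beta>\<^sup>2 / 2) * (1 + a\<^sup>2 * u\<^sup>2)"
      by (simp add: a(3) field_simps)
    then have "ln (1 + ?y u) \<le> ln ((1 + \<beta>\<^sup>2 / 2) * (1 + a\<^sup>2 * u\<^sup>2))"
      using mixture_rate_pos[OF assms(1), of u] by (subst ln_le_cancel_iff) (auto intro!: mult_pos_pos add_pos_nonneg)
    also have "\<dots> = ln (1 + \<beta>\<^sup>2 / 2) + ln (1 + a\<^sup>2 * u\<^sup>2)"
      by (rule ln_mult_pos) (auto intro!: add_pos_nonneg)
    also have "ln (1 + \<beta>\<^sup>2 / 2) \<le> \<beta>\<^sup>2 / 2" by (rule ln_add_one_self_le_self) simp
    finally show ?thesis by simp
  qed
  have "2 * F \<beta> \<le> (\<integral>u. - ln (?y u) + (\<beta>\<^sup>2 / 2 + ln (1 + a\<^sup>2 * u\<^sup>2)) \<partial>half_cauchy)"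
    unfolding F_mixture(3)[OF assms(1)]
    using i iy half_cauchy_ln(1)[OF a(1,2)] ln1
    by (intro integral_mono) (auto intro: order_trans[OF log_geom_bounds(2)[OF mixture_rate_pos[OF assms(1)]]])
  also have "\<dots> = - (2 * ln \<beta> + ln 2) + (\<beta>\<^sup>2 / 2 + 2 * ln (1 + a))"
    using iy half_cauchy_ln[OF a(1,2)] Ey by (simp add: prob_space)
  also have "\<dots> \<le> - (2 * ln \<beta> + ln 2) + 2 * \<beta>"
  proof -
    have "ln (1 + a) \<le> a" using a by (intro ln_add_one_self_le_self) auto
    also have "a \<le> 3 / 4 * \<beta>"
    proof -
      have "4 / 3 \<le> sqrt 2" by (rule real_le_rsqrt) (simp add: power2_eq_square)
      then show ?thesis using assms by (simp add: a_def field_simps)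
    qed
    finally have "ln (1 + a) \<le> 3 / 4 * \<beta>" .
    moreover have "\<beta>\<^sup>2 \<le> \<beta>" using assms by (simp add: power2_eq_square)
    ultimately show ?thesis by simp
  qed
  finally show ?thesis using lower by simp
qed

section \<open>The centered characteristic function\<close>

lemma integrable_exp_abs_centered:
  assumes "1 < R" "ereal R < conv_radius (pmf X)"
  shows "integrable (measure_pmf X) (\<lambda>x. exp (ln R * \<bar>real x - \<mu>\<bar>))"
proof -
  have "integrable (measure_pmf X) (\<lambda>x. exp (ln R * \<bar>\<mu>\<bar>) * R ^ x)"
    using summable_pgf[of R X] assms by (auto simp: integrable_pmf_nat_iff)
  then show ?thesis
  proof (rule Bochner_Integration.integrable_bound)
    have "exp (ln R * \<bar>real x - \<mu>\<bar>) \<le> exp (ln R * \<bar>\<mu>\<bar>) * R ^ x" for x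
    proof -
      have "ln R * \<bar>real x - \<mu>\<bar> \<le> ln R * (\<bar>\<mu>\<bar> + real x)"
        using assms by (intro mult_left_mono) auto
      then have "exp (ln R * \<bar>real x - \<mu>\<bar>) \<le> exp (ln R * \<bar>\<mu>\<bar> + real x * ln R)"
        by (simp add: algebra_simps)
      also have "\<dots> = exp (ln R * \<bar>\<mu>\<bar>) * R ^ x"
        using assms by (simp add: exp_add exp_of_nat_mult)
      finally show ?thesis .
    qed
    then show "AE x in measure_pmf X. norm (exp (ln R * \<bar>real x - \<mu>\<bar>)) \<le> norm (exp (ln R * \<bar>\<mu>\<bar>) * R ^ x)"
      using assms by simp
  qed simp
qed

lemma cube_le_exp:
  fixes a y :: real
  assumes "0 < a" "0 \<le> y"
  shows "y ^ 3 \<le> 27 / a ^ 3 * exp (a * y)"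
proof -
  have "a * y / 3 \<le> exp (a * y / 3)" using exp_ge_add_one_self[of "a * y / 3"] by linarith
  then have "(a * y / 3) ^ 3 \<le> exp (a * y / 3) ^ 3" using assms by (intro power_mono) auto
  also have "exp (a * y / 3) ^ 3 = exp (a * y)" by (simp add: exp_of_nat_mult[symmetric])
  finally show ?thesis using assms by (simp add: field_simps)
qed

lemma integrable_cube_exp:
  assumes "conv_radius (pmf X) > 1"
  obtains a where "0 < a" "integrable (measure_pmf X) (\<lambda>x. \<bar>real x - \<mu>\<bar> ^ 3 * exp (a * \<bar>real x - \<mu>\<bar>))"
proof -
  obtain R where R: "1 < R" "ereal R < conv_radius (pmf X)"
    using assms ereal_dense2[of 1 "conv_radius (pmf X)"] by auto
  define a where "a = ln R / 2"
  have a: "0 < a" "ln R = a + a" using R by (auto simp: a_def)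
  show ?thesis
  proof (rule that[OF a(1)])
    have "integrable (measure_pmf X) (\<lambda>x. 27 / a ^ 3 * exp (ln R * \<bar>real x - \<mu>\<bar>))"
      using integrable_exp_abs_centered[OF R] by simp
    then show "integrable (measure_pmf X) (\<lambda>x. \<bar>real x - \<mu>\<bar> ^ 3 * exp (a * \<bar>real x - \<mu>\<bar>))"
    proof (rule Bochner_Integration.integrable_bound)
      have "\<bar>y\<bar> ^ 3 * exp (a * \<bar>y\<bar>) \<le> 27 / a ^ 3 * exp (ln R * \<bar>y\<bar>)" for y
      proof -
        have "exp (ln R * \<bar>y\<bar>) = exp (a * \<bar>y\<bar>) * exp (a * \<bar>y\<bar>)"
          by (simp only: a(2) distrib_right exp_add)
        then show ?thesis
          using mult_right_mono[OF cube_le_exp[OF a(1), of "\<bar>y\<bar>"], of "exp (a * \<bar>y\<bar>)"]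
          by (simp only: mult.assoc) simp
      qed
      then show "AE x in measure_pmf X. norm (\<bar>real x - \<mu>\<bar> ^ 3 * exp (a * \<bar>real x - \<mu>\<bar>))
          \<le> norm (27 / a ^ 3 * exp (ln R * \<bar>real x - \<mu>\<bar>))"
        using a by simp
    qed simp
  qed
qed

lemma integrable_abs_central_power:
  assumes "conv_radius (pmf X) > 1" "k \<le> 3"
  shows "integrable (measure_pmf X) (\<lambda>x. \<bar>real x - \<mu>\<bar> ^ k)"
proof -
  obtain a where a: "0 < a" "integrable (measure_pmf X) (\<lambda>x. \<bar>real x - \<mu>\<bar> ^ 3 * exp (a * \<bar>real x - \<mu>\<bar>))"
    using integrable_cube_exp[OF assms(1)] by blast
  have "integrable (measure_pmf X) (\<lambda>x. 1 + \<bar>real x - \<mu>\<bar> ^ 3 * exp (a * \<bar>real x - \<mu>\<bar>))"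
    using a by simp
  then show ?thesis
  proof (rule Bochner_Integration.integrable_bound)
    have "\<bar>y\<bar> ^ k \<le> 1 + \<bar>y\<bar> ^ 3 * exp (a * \<bar>y\<bar>)" for y
    proof -
      have "\<bar>y\<bar> ^ k \<le> 1 + \<bar>y\<bar> ^ 3"
      proof (cases "\<bar>y\<bar> \<le> 1")
        case True
        then have "\<bar>y\<bar> ^ k \<le> 1" by (intro power_le_one) auto
        then show ?thesis by (simp add: add_increasing2)
      next
        case False
        then have "\<bar>y\<bar> ^ k \<le> \<bar>y\<bar> ^ 3" using assms(2) by (intro power_increasing) auto
        then show ?thesis by simp
      qed
      moreover have "\<bar>y\<bar> ^ 3 * 1 \<le> \<bar>y\<bar> ^ 3 * exp (a * \<bar>y\<bar>)"
        using a by (intro mult_left_mono) auto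
      ultimately show ?thesis by simp
    qed
    then show "AE x in measure_pmf X. norm (\<bar>real x - \<mu>\<bar> ^ k)
        \<le> norm (1 + \<bar>real x - \<mu>\<bar> ^ 3 * exp (a * \<bar>real x - \<mu>\<bar>))"
      by (simp add: add_nonneg_nonneg)
  qed simp
qed

lemma centered_moments:
  assumes "conv_radius (pmf X) > 1"
  defines "\<mu> \<equiv> pmf_mean X"
  shows "integrable (measure_pmf X) (\<lambda>x. real x - \<mu>)" "integrable (measure_pmf X) (\<lambda>x. (real x - \<mu>)\<^sup>2)"
    "measure_pmf.expectation X (\<lambda>x. real x - \<mu>) = 0"
    "measure_pmf.expectation X (\<lambda>x. (real x - \<mu>)\<^sup>2) = pmf_variance X"
proof -
  have "integrable (measure_pmf X) (\<lambda>x. \<bar>real x - \<mu>\<bar> ^ 1)"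
    by (rule integrable_abs_central_power) (use assms in auto)
  then show 1: "integrable (measure_pmf X) (\<lambda>x. real x - \<mu>)"
    by (simp add: integrable_abs_iff)
  show "integrable (measure_pmf X) (\<lambda>x. (real x - \<mu>)\<^sup>2)"
    using integrable_abs_central_power[OF assms(1), of 2 \<mu>] by simp
  have "integrable (measure_pmf X) (\<lambda>x. (real x - \<mu>) + \<mu>)" using 1 by (intro Bochner_Integration.integrable_add) auto
  then have i: "integrable (measure_pmf X) real" by simp
  then show "measure_pmf.expectation X (\<lambda>x. real x - \<mu>) = 0"
    by (simp add: \<mu>_def pmf_mean_def)
  show "measure_pmf.expectation X (\<lambda>x. (real x - \<mu>)\<^sup>2) = pmf_variance X"
    by (simp add: \<mu>_def pmf_mean_def pmf_variance_def)
qed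

text \<open>The characteristic function of \<open>X - E X\<close>.\<close>

definition ccf :: "nat pmf \<Rightarrow> real \<Rightarrow> complex" where
  "ccf X t = iexp (- (pmf_mean X * t)) * pgf X (iexp t)"

lemma norm_pgf_iexp: "norm (pgf X (iexp t)) = norm (ccf X t)"
  by (simp add: ccf_def norm_mult)

lemma ccf_eq_expectation:
  "ccf X t = measure_pmf.expectation X (\<lambda>x. iexp (t * (real x - pmf_mean X)))"
proof -
  have "summable (\<lambda>j. pmf X j * norm (iexp (t * real j)))"
    using sums_summable[OF sums_pmf_nat] by simp
  from expectation_pmf_nat_sums[OF this]
  have "measure_pmf.expectation X (\<lambda>j. iexp (t * real j)) = (\<Sum>j. pmf X j *\<^sub>R iexp (t * real j))"
    by (simp add: sums_iff)
  also have "\<dots> = pgf X (iexp t)"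
    unfolding pgf_def by (simp add: exp_of_nat_mult[symmetric] mult_ac scaleR_conv_of_real)
  finally have "ccf X t = iexp (- (pmf_mean X * t)) * measure_pmf.expectation X (\<lambda>j. iexp (t * real j))"
    by (simp add: ccf_def)
  also have "\<dots> = measure_pmf.expectation X (\<lambda>j. iexp (- (pmf_mean X * t)) * iexp (t * real j))"
    by (rule integral_mult_right_zero[symmetric])
  also have "(\<lambda>j. iexp (- (pmf_mean X * t)) * iexp (t * real j)) = (\<lambda>x. iexp (t * (real x - pmf_mean X)))"
    by (simp add: exp_add[symmetric] algebra_simps)
  finally show ?thesis .
qed

lemma ccf_approx:
  assumes rad: "conv_radius (pmf X) > 1"
  obtains K where "0 \<le> K"
    "\<And>t. norm (ccf X t - of_real (1 - pmf_variance X * t\<^sup>2 / 2)) \<le> K * \<bar>t\<bar> ^ 3"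
proof -
  define \<mu> where "\<mu> = pmf_mean X"
  let ?E = "measure_pmf.expectation X"
  define K where "K = ?E (\<lambda>x. \<bar>real x - \<mu>\<bar> ^ 3) / 6"
  note m = centered_moments[OF rad, folded \<mu>_def]
  show ?thesis
  proof (rule that[of K])
    show "0 \<le> K" unfolding K_def by (intro divide_nonneg_nonneg integral_nonneg_AE) auto
    fix t
    have i1: "integrable (measure_pmf X) (\<lambda>x. complex_of_real (real x - \<mu>))"
      "?E (\<lambda>x. complex_of_real (real x - \<mu>)) = 0"
      using m(1,3) integral_complex_of_real[of "measure_pmf X" "\<lambda>x. real x - \<mu>"] by (auto simp del: of_real_diff)
    have i2: "integrable (measure_pmf X) (\<lambda>x. complex_of_real ((real x - \<mu>)\<^sup>2))"
      "?E (\<lambda>x. complex_of_real ((real x - \<mu>)\<^sup>2)) = of_real (pmf_variance X)"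
      using m(2,4) integral_complex_of_real[of "measure_pmf X" "\<lambda>x. (real x - \<mu>)\<^sup>2"]
      by (auto simp del: of_real_diff of_real_power)
    have i3: "integrable (measure_pmf X) (\<lambda>x. iexp (t * (real x - \<mu>)))"
      by (rule measure_pmf.integrable_const_bound[where B = 1]) auto
    define T where "T x = 1 + \<i> * t * complex_of_real (real x - \<mu>) - t\<^sup>2 / 2 * complex_of_real ((real x - \<mu>)\<^sup>2)" for x
    have iT: "integrable (measure_pmf X) T" "?E T = of_real (1 - pmf_variance X * t\<^sup>2 / 2)"
    proof -
      show "integrable (measure_pmf X) T"
        unfolding T_def[abs_def] using i1 i2 by (auto simp del: of_real_diff of_real_power)
      have "?E T = 1 - t\<^sup>2 / 2 * of_real (pmf_variance X)"
        unfolding T_def[abs_def] using i1 i2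
        by (subst Bochner_Integration.integral_diff Bochner_Integration.integral_add,
            (simp del: of_real_diff of_real_power; fail)+)+
           (simp del: of_real_diff of_real_power, simp)
      then show "?E T = of_real (1 - pmf_variance X * t\<^sup>2 / 2)" by (simp add: mult.commute)
    qed
    have bound: "norm (iexp (t * (real x - \<mu>)) - T x) \<le> \<bar>t\<bar> ^ 3 * (\<bar>real x - \<mu>\<bar> ^ 3 / 6)" for x
    proof -
      have "(\<Sum>k\<le>2. (\<i> * (t * (real x - \<mu>))) ^ k / fact k) = T x"
      proof -
        have "(\<Sum>k\<le>2. (\<i> * complex_of_real y) ^ k / fact k) = 1 + \<i> * y - y\<^sup>2 / 2" for y
          by (simp add: numeral_2_eq_2 algebra_simps)
        from this[of "t * (real x - \<mu>)"] show ?thesis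
          by (simp add: T_def power_mult_distrib del: of_real_diff)
      qed
      then show ?thesis
        using iexp_approx1[of "t * (real x - \<mu>)" 2]
        by (simp add: abs_mult power_mult_distrib fact_numeral)
    qed
    have "ccf X t - of_real (1 - pmf_variance X * t\<^sup>2 / 2) = ?E (\<lambda>x. iexp (t * (real x - \<mu>)) - T x)"
      unfolding ccf_eq_expectation \<mu>_def[symmetric] iT(2)[symmetric]
      by (rule Bochner_Integration.integral_diff[symmetric]) (intro i3 iT)+
    also have "norm \<dots> \<le> ?E (\<lambda>x. norm (iexp (t * (real x - \<mu>)) - T x))"
      by (rule integral_norm_bound)
    also have "\<dots> \<le> ?E (\<lambda>x. \<bar>t\<bar> ^ 3 * (\<bar>real x - \<mu>\<bar> ^ 3 / 6))"
      using integrable_abs_central_power[OF rad, of 3 \<mu>] i3 iT(1) by (intro integral_mono bound) auto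
    also have "\<dots> = K * \<bar>t\<bar> ^ 3" by (simp add: K_def)
    finally show "norm (ccf X t - of_real (1 - pmf_variance X * t\<^sup>2 / 2)) \<le> K * \<bar>t\<bar> ^ 3" .
  qed
qed

lemma pgf_holomorphic:
  assumes "ereal R < conv_radius (pmf X)" "0 \<le> R"
  shows "pgf X holomorphic_on ball 0 R"
  unfolding pgf_def[abs_def]
  by (rule holomorphic_suminf[OF _ _ summable_pgf[OF assms]])
     (auto intro!: holomorphic_intros mult_left_mono power_mono simp: norm_mult norm_power)

lemma continuous_pgf_iexp:
  assumes "conv_radius (pmf X) > 1"
  shows "continuous_on A (\<lambda>t. pgf X (iexp t))"
proof -
  obtain R where R: "1 < R" "ereal R < conv_radius (pmf X)"
    using assms ereal_dense2[of 1 "conv_radius (pmf X)"] by auto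
  have "continuous_on (ball 0 R) (pgf X :: complex \<Rightarrow> complex)"
    using R by (intro holomorphic_on_imp_continuous_on pgf_holomorphic) auto
  then show ?thesis
    by (rule continuous_on_compose2) (use R in \<open>auto intro!: continuous_intros\<close>)
qed

lemma pmf_variance_pos:
  assumes rad: "conv_radius (pmf X) > 1"
    and circ: "\<And>z :: complex. norm z = 1 \<Longrightarrow> z \<noteq> 1 \<Longrightarrow> norm (pgf X z) < 1"
  shows "0 < pmf_variance X"
proof (rule ccontr)
  let ?\<mu> = "pmf_mean X"
  note m = centered_moments[OF rad]
  have "0 \<le> pmf_variance X" unfolding m(4)[symmetric] by simp
  moreover assume "\<not> 0 < pmf_variance X"
  ultimately have "measure_pmf.expectation X (\<lambda>x. (real x - ?\<mu>)\<^sup>2) = 0" using m(4) by simp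
  then have "AE x in measure_pmf X. (real x - ?\<mu>)\<^sup>2 = 0"
    using m(2) by (subst (asm) integral_nonneg_eq_0_iff_AE) auto
  then have "ccf X pi = measure_pmf.expectation X (\<lambda>x. 1)"
    unfolding ccf_eq_expectation
  proof (intro integral_cong_AE)
    show "AE x in measure_pmf X. iexp (pi * (real x - ?\<mu>)) = 1"
      using \<open>AE x in measure_pmf X. (real x - ?\<mu>)\<^sup>2 = 0\<close>
    proof eventually_elim
      case (elim x)
      then have "real x - ?\<mu> = 0" by simp
      then show ?case by (simp only:) simp
    qed
  qed auto
  then have "norm (pgf X (iexp pi)) = 1" unfolding norm_pgf_iexp by simp
  moreover have "norm (pgf X (iexp pi)) < 1" by (rule circ) auto
  ultimately show False by simp
qed

text \<open>Near 0 the decay comes from the variance, away from 0 from the hypothesis on the unit circle,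
  which excludes lattices coarser than the integers.\<close>

lemma ccf_decay:
  assumes rad: "conv_radius (pmf X) > 1"
    and circ: "\<And>z :: complex. norm z = 1 \<Longrightarrow> z \<noteq> 1 \<Longrightarrow> norm (pgf X z) < 1"
  obtains c where "0 < c" "c \<le> pmf_variance X / 2"
    "\<And>t. \<bar>t\<bar> \<le> pi \<Longrightarrow> norm (ccf X t) \<le> exp (- (c * t\<^sup>2))"
proof -
  define v where "v = pmf_variance X"
  have v: "0 < v" unfolding v_def by (rule pmf_variance_pos[OF rad circ])
  obtain K where K: "0 \<le> K" "\<And>t. norm (ccf X t - of_real (1 - v * t\<^sup>2 / 2)) \<le> K * \<bar>t\<bar> ^ 3"
    using ccf_approx[OF rad] unfolding v_def by blast
  define \<delta> where "\<delta> = min pi (min (v / (4 * (K + 1))) (1 / (v + 1)))"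
  have \<delta>: "0 < \<delta>" "\<delta> \<le> pi" "\<delta> \<le> v / (4 * (K + 1))" "\<delta> \<le> 1 / (v + 1)" using v K by (auto simp: \<delta>_def)
  have near: "norm (ccf X t) \<le> exp (- (v / 4 * t\<^sup>2))" if t: "\<bar>t\<bar> \<le> \<delta>" for t
  proof -
    have "K * \<bar>t\<bar> \<le> (K + 1) * (v / (4 * (K + 1)))"
      using K t \<delta> by (intro mult_mono) auto
    also have "\<dots> = v / 4" using K(1) by (simp add: divide_simps)
    finally have "K * \<bar>t\<bar> * t\<^sup>2 \<le> v / 4 * t\<^sup>2" by (intro mult_right_mono) auto
    then have 1: "K * \<bar>t\<bar> ^ 3 \<le> v / 4 * t\<^sup>2" by (simp add: power3_eq_cube power2_eq_square)
    have t1: "\<bar>t\<bar> \<le> 1 / (v + 1)" using t \<delta> by simp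
    have "t\<^sup>2 \<le> (1 / (v + 1))\<^sup>2" using power_mono[OF t1, of 2] by simp
    then have "v * t\<^sup>2 \<le> v * (1 / (v + 1))\<^sup>2" using v by (intro mult_left_mono) auto
    also have "\<dots> \<le> 1"
    proof -
      have "v \<le> (v + 1)\<^sup>2" using v by (simp add: power2_eq_square algebra_simps)
      then show ?thesis using v by (simp add: power_divide)
    qed
    finally have 2: "0 \<le> 1 - v * t\<^sup>2 / 2" by simp
    have "norm (ccf X t) \<le> norm (ccf X t - of_real (1 - v * t\<^sup>2 / 2)) + norm (complex_of_real (1 - v * t\<^sup>2 / 2))"
      using norm_triangle_ineq[of "ccf X t - of_real (1 - v * t\<^sup>2 / 2)" "of_real (1 - v * t\<^sup>2 / 2)"] by simp
    also have "\<dots> \<le> v / 4 * t\<^sup>2 + (1 - v * t\<^sup>2 / 2)"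
      using K(2)[of t] 1 2 by (intro add_mono) (auto simp del: of_real_diff)
    also have "\<dots> = 1 + - (v / 4 * t\<^sup>2)" by simp
    also have "\<dots> \<le> exp (- (v / 4 * t\<^sup>2))" by (rule exp_ge_add_one_self)
    finally show ?thesis .
  qed
  define S where "S = {-pi..-\<delta>} \<union> {\<delta>..pi}"
  have "compact S" "S \<noteq> {}" using \<delta> by (auto simp: S_def)
  moreover have "continuous_on S (\<lambda>t. norm (pgf X (iexp t)))"
    by (intro continuous_intros continuous_pgf_iexp rad)
  ultimately obtain t0 where t0: "t0 \<in> S" "\<And>t. t \<in> S \<Longrightarrow> norm (pgf X (iexp t)) \<le> norm (pgf X (iexp t0))"
    using continuous_attains_sup by metis
  define q where "q = max (1 / 2) (norm (pgf X (iexp t0)))"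
  have "iexp t0 \<noteq> 1"
  proof
    assume "iexp t0 = 1"
    then have "cos t0 = 1" by (simp add: cis_conv_exp[symmetric] complex_eq_iff)
    then obtain k :: int where k: "t0 = of_int k * (2 * pi)" by (auto simp: cos_one_2pi_int mult_ac)
    have "0 < \<bar>t0\<bar>" "\<bar>t0\<bar> \<le> pi" using t0(1) \<delta> by (auto simp: S_def)
    moreover from this have "k \<noteq> 0" using k by auto
    then have "1 \<le> \<bar>real_of_int k\<bar>" by linarith
    then have "1 * (2 * pi) \<le> \<bar>t0\<bar>" unfolding k abs_mult by (intro mult_mono) auto
    ultimately show False using pi_gt_zero by linarith
  qed
  then have q: "q < 1" "1 / 2 \<le> q" using circ[of "iexp t0"] by (auto simp: q_def)
  define c where "c = min (v / 4) (- ln q / pi\<^sup>2)"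
  show ?thesis
  proof (rule that)
    have "ln q < 0" using q by simp
    then show "0 < c" using v q by (simp add: c_def divide_neg_pos)
    show "c \<le> pmf_variance X / 2" using v by (simp add: c_def v_def[symmetric] min_le_iff_disj)
    fix t :: real assume t: "\<bar>t\<bar> \<le> pi"
    show "norm (ccf X t) \<le> exp (- (c * t\<^sup>2))"
    proof (cases "\<bar>t\<bar> \<le> \<delta>")
      case True
      note near[OF True]
      also have "exp (- (v / 4 * t\<^sup>2)) \<le> exp (- (c * t\<^sup>2))"
      proof -
        have "c \<le> v / 4" unfolding c_def by (rule min.cobounded1)
        then have "c * t\<^sup>2 \<le> v / 4 * t\<^sup>2" by (rule mult_right_mono) simp
        then show ?thesis by simp
      qed
      finally show ?thesis .
    next
      case False
      then have "t \<in> S" using t by (auto simp: S_def abs_if split: if_splits)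
      then have "norm (ccf X t) \<le> q" using t0(2)[of t] by (simp add: norm_pgf_iexp q_def)
      also have "q = exp (ln q)" using q by simp
      also have "\<dots> \<le> exp (- (c * t\<^sup>2))"
      proof -
        have "c * t\<^sup>2 \<le> (- ln q / pi\<^sup>2) * pi\<^sup>2"
          using t \<open>0 < c\<close> power_mono[OF t, of 2] by (intro mult_mono) (auto simp: c_def)
        then show ?thesis by simp
      qed
      finally show ?thesis .
    qed
  qed
qed

section \<open>Inversion formulas\<close>

lemma iexp_mult: "iexp x * iexp y = iexp (x + y)"
  by (simp add: exp_add[symmetric] algebra_simps)

lemma iexp_orthogonal:
  "has_bochner_integral lborel (\<lambda>t. indicator {-pi..pi} t *\<^sub>R iexp (t * of_int k)) (if k = 0 then 2 * pi else 0)"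
proof -
  have c: "continuous_on {-pi..pi} (\<lambda>t. iexp (t * of_int k))" by (intro continuous_intros)
  have i: "integrable lborel (\<lambda>t. indicator {-pi..pi} t *\<^sub>R iexp (t * of_int k))"
    using borel_integrable_atLeastAtMost'[OF c] by (simp add: set_integrable_def)
  have "(\<integral>t. indicator {-pi..pi} t *\<^sub>R iexp (t * of_int k) \<partial>lborel) = (if k = 0 then 2 * pi else 0)"
  proof (cases "k = 0")
    case True
    have "(\<integral>t. indicator {-pi..pi} t *\<^sub>R (1::complex) \<partial>lborel) = complex_of_real pi - complex_of_real (- pi)"
      by (rule integral_FTC_Icc) (auto intro!: derivative_eq_intros continuous_intros)
    with True show ?thesis by simp
  next
    case False
    have "(\<integral>t. indicator {-pi..pi} t *\<^sub>R iexp (t * of_int k) \<partial>lborel)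
      = iexp (pi * of_int k) / (\<i> * of_int k) - iexp (- pi * of_int k) / (\<i> * of_int k)"
    proof (rule integral_FTC_Icc[OF _ _ c])
      fix t :: real
      show "((\<lambda>t. iexp (t * of_int k) / (\<i> * of_int k)) has_vector_derivative iexp (t * of_int k)) (at t within {-pi..pi})"
      proof -
        have "((\<lambda>z. exp (\<i> * (z * of_int k)) / (\<i> * of_int k)) has_field_derivative
            exp (\<i> * (of_real t * of_int k))) (at (of_real t))"
          using False by (auto intro!: derivative_eq_intros simp: mult_ac)
        from has_vector_derivative_real_field[OF this] show ?thesis by simp
      qed
    qed auto
    moreover have "iexp (pi * of_int k) = iexp (- pi * of_int k)"
      by (simp only: cis_conv_exp[symmetric]) (simp add: complex_eq_iff)
    ultimately show ?thesis using False by simp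
  qed
  with i show ?thesis by (auto simp: has_bochner_integral_iff)
qed

lemma pmf_inversion:
  "2 * pi * complex_of_real (pmf p k) =
    (\<integral>t. indicator {-pi..pi} t *\<^sub>R (pgf p (iexp t) * iexp (- (t * real k))) \<partial>lborel)"
proof -
  define f where "f j t = pmf p j *\<^sub>R (indicator {-pi..pi} t *\<^sub>R iexp (t * of_int (int j - int k)))" for j t
  have f: "has_bochner_integral lborel (f j) (pmf p j *\<^sub>R complex_of_real (if j = k then 2 * pi else 0))" for j
    unfolding f_def[abs_def] using iexp_orthogonal[of "int j - int k"]
    by (intro has_bochner_integral_scaleR_right) simp
  have nf: "norm (f j t) = pmf p j * indicator {-pi..pi} t" for j t
    by (simp add: f_def)
  have sp: "summable (pmf p)" using sums_pmf_nat by (rule sums_summable)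
  have 1: "(\<lambda>j. \<integral>t. f j t \<partial>lborel) sums (\<integral>t. (\<Sum>j. f j t) \<partial>lborel)"
  proof (rule sums_integral)
    show "integrable lborel (f j)" for j using f by (auto simp: has_bochner_integral_iff)
    show "AE t in lborel. summable (\<lambda>j. norm (f j t))"
      unfolding nf using sp by (intro AE_I2 summable_mult2)
    show "summable (\<lambda>j. \<integral>t. norm (f j t) \<partial>lborel)"
      unfolding nf using summable_mult2[OF sp, of "2 * pi"] by (simp add: measure_lborel_Icc)
  qed
  have 2: "(\<lambda>j. \<integral>t. f j t \<partial>lborel) = (\<lambda>j. if j = k then 2 * pi * complex_of_real (pmf p k) else 0)"
    using f by (auto simp: has_bochner_integral_iff scaleR_conv_of_real)
  have 3: "(\<Sum>j. f j t) = indicator {-pi..pi} t *\<^sub>R (pgf p (iexp t) * iexp (- (t * real k)))" for t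
  proof -
    have s: "(\<lambda>j. of_real (pmf p j) * iexp t ^ j) sums pgf p (iexp t)"
      using sp by (intro pgf_sums) simp
    have "(\<lambda>j. f j t) = (\<lambda>j. indicator {-pi..pi} t *\<^sub>R (of_real (pmf p j) * iexp t ^ j * iexp (- (t * real k))))"
      by (auto simp: f_def scaleR_conv_of_real exp_of_nat_mult[symmetric] exp_add[symmetric] exp_diff algebra_simps exp_minus divide_inverse)
    also have "\<dots> sums (indicator {-pi..pi} t *\<^sub>R (pgf p (iexp t) * iexp (- (t * real k))))"
      by (intro sums_scaleR_right sums_mult2 s)
    finally show ?thesis by (simp add: sums_iff)
  qed
  have "(\<lambda>j. if j = k then 2 * pi * complex_of_real (pmf p k) else 0) sums (2 * pi * complex_of_real (pmf p k))"
    by (rule sums_single)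
  from sums_unique2[OF this 1[unfolded 2 3]] show ?thesis by simp
qed

lemma sin_half_iexp: "2 * \<i> * complex_of_real (sin (t / 2)) = iexp (t / 2) - iexp (- (t / 2))"
  by (simp only: cis_conv_exp[symmetric]) (simp add: complex_eq_iff)

text \<open>The Dirichlet kernel in closed form. The half-integer endpoints are the continuity points at which
  the integer-valued law is compared with a Gaussian one.\<close>

lemma dirichlet_block:
  assumes "m \<le> M"
  shows "(\<Sum>k\<in>{m<..M}. iexp (- (t * real k))) * (2 * \<i> * complex_of_real (sin (t / 2)))
    = iexp (- (t * (real m + 1/2))) - iexp (- (t * (real M + 1/2)))"
  using assms
proof (induction M rule: dec_induct)
  case base
  then show ?case by simp
next
  case (step M)
  have "{m<..Suc M} = insert (Suc M) {m<..M}" using step.hyps by auto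
  moreover have "iexp (- (t * real (Suc M))) * (2 * \<i> * complex_of_real (sin (t / 2)))
     = iexp (- (t * (real M + 1/2))) - iexp (- (t * (real (Suc M) + 1/2)))"
  proof -
    have "- (t * real (Suc M)) + t / 2 = - (t * (real M + 1/2))"
      "- (t * real (Suc M)) + - (t / 2) = - (t * (real (Suc M) + 1/2))"
      by (simp_all add: field_simps)
    then show ?thesis unfolding sin_half_iexp right_diff_distrib iexp_mult by (simp only:)
  qed
  ultimately show ?case using step.IH by (simp add: distrib_right)
qed

definition normal_law :: "real \<Rightarrow> real \<Rightarrow> real measure" where
  "normal_law a d = distr std_normal_distribution borel (\<lambda>x. a + d * x)"

lemma real_distribution_normal_law: "real_distribution (normal_law a d)"
proof -
  interpret real_distribution std_normal_distribution by (rule real_dist_normal_dist)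
  show ?thesis unfolding normal_law_def by (rule real_distribution_distr) simp
qed

lemma char_normal_law: "char (normal_law a d) t = iexp (a * t) * of_real (exp (- (d\<^sup>2 * t\<^sup>2 / 2)))"
proof -
  have "char (normal_law a d) t = (CLINT x|std_normal_distribution. iexp (t * (a + d * x)))"
    unfolding char_def normal_law_def by (subst integral_distr) auto
  also have "\<dots> = (CLINT x|std_normal_distribution. iexp (a * t) * iexp (t * d * x))"
    by (simp add: exp_add[symmetric] algebra_simps)
  also have "\<dots> = iexp (a * t) * char std_normal_distribution (t * d)"
    unfolding char_def by (rule integral_mult_right_zero)
  finally show ?thesis by (simp add: char_std_normal_distribution power_mult_distrib mult.commute)
qed

lemma measure_std_normal_tail: "measure std_normal_distribution {x..} = normal_tail x"
proof -
  have "measure std_normal_distribution {x..} = (\<integral>t. indicator {x..} t \<partial>std_normal_distribution)" by simp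
  also have "\<dots> = (\<integral>t. std_normal_density t * indicator {x..} t \<partial>lborel)"
    by (subst integral_density) (auto)
  also have "\<dots> = normal_tail x"
    unfolding normal_tail_def set_lebesgue_integral_def normal_density_def
    by (subst integral_mult_right_zero[symmetric]) (simp add: mult_ac)
  finally show ?thesis .
qed

lemma measure_std_normal_singleton: "measure std_normal_distribution {x} = 0"
proof -
  have "emeasure std_normal_distribution {x} = 0"
    by (subst emeasure_density) (auto simp: nn_integral_0_iff_AE intro!: AE_I'[of "{x}"])
  then show ?thesis by (simp add: measure_def)
qed

lemma measure_normal_law_greater:
  assumes "0 < d"
  shows "measure (normal_law a d) {y<..} = normal_tail ((y - a) / d)"
proof -
  interpret real_distribution std_normal_distribution by (rule real_dist_normal_dist)
  have e: "(\<lambda>x. a + d * x) -` {y<..} = {(y - a) / d<..}"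
    using assms by (auto simp: field_simps)
  have "{(y - a) / d..} = insert ((y - a) / d) {(y - a) / d<..}" by auto
  then have "measure std_normal_distribution {(y - a) / d..} \<le>
     measure std_normal_distribution {(y - a) / d} + measure std_normal_distribution {(y - a) / d<..}"
    using measure_Un_le[of "{(y - a) / d}" std_normal_distribution "{(y - a) / d<..}"] by simp
  moreover have "measure std_normal_distribution {(y - a) / d<..} \<le> measure std_normal_distribution {(y - a) / d..}"
    by (rule finite_measure_mono) auto
  ultimately have "measure std_normal_distribution {(y - a) / d<..} = normal_tail ((y - a) / d)"
    by (simp add: measure_std_normal_singleton measure_std_normal_tail)
  then show ?thesis
    unfolding normal_law_def by (subst measure_distr) (auto simp: e)
qed

lemma measure_normal_law_singleton:
  assumes "0 < d"
  shows "measure (normal_law a d) {y} = 0"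
proof -
  have e: "(\<lambda>x. a + d * x) -` {y} = {(y - a) / d}"
    using assms by (auto simp: field_simps)
  show ?thesis
    unfolding normal_law_def by (subst measure_distr) (auto simp: e measure_std_normal_singleton)
qed

lemma normal_tail_diff_le: "\<bar>normal_tail x - normal_tail y\<bar> \<le> \<bar>x - y\<bar>"
proof -
  have *: "\<bar>normal_tail x - normal_tail y\<bar> \<le> y - x" if "x \<le> y" for x y
  proof -
    interpret real_distribution std_normal_distribution by (rule real_dist_normal_dist)
    have "normal_tail x - normal_tail y = measure std_normal_distribution ({x..} - {y..})"
      unfolding measure_std_normal_tail[symmetric] using that
      by (intro finite_measure_Diff[symmetric]) auto
    also have "{x..} - {y..} = {x..<y}" by auto
    finally have eq: "normal_tail x - normal_tail y = measure std_normal_distribution {x..<y}" .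
    have "emeasure std_normal_distribution {x..<y} = (\<integral>\<^sup>+t. ennreal (std_normal_density t) * indicator {x..<y} t \<partial>lborel)"
      by (rule emeasure_density) auto
    also have "\<dots> \<le> (\<integral>\<^sup>+t. indicator {x..<y} t \<partial>lborel)"
    proof (rule nn_integral_mono)
      fix t :: real
      have "1 \<le> sqrt (2 * pi)" using pi_ge_two by (intro real_le_rsqrt) auto
      then have "std_normal_density t \<le> 1"
        by (auto simp: normal_density_def divide_le_eq intro: order_trans[of _ 1])
      then show "ennreal (std_normal_density t) * indicator {x..<y} t \<le> indicator {x..<y} t"
        by (auto simp: indicator_def)
    qed
    also have "\<dots> = ennreal (y - x)" using that by simp
    finally have "measure std_normal_distribution {x..<y} \<le> y - x"
      using that by (simp add: emeasure_eq_measure)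
    then show ?thesis using eq by simp
  qed
  show ?thesis using *[of x y] *[of y x] by (cases "x \<le> y") auto
qed

section \<open>The Berry--Esseen bound\<close>

lemma has_bochner_integral_gauss:
  assumes "0 < (a :: real)"
  shows "has_bochner_integral lborel (\<lambda>t. exp (- (a * t\<^sup>2))) (sqrt (pi / a))"
proof -
  define s where "s = 1 / sqrt (2 * a)"
  have s: "0 < s" "2 * s\<^sup>2 = 1 / a" using assms by (auto simp: s_def power_divide)
  have "has_bochner_integral lborel (\<lambda>t. sqrt (pi / a) * normal_density 0 s t) (sqrt (pi / a) * 1)"
    using integral_normal_density[OF s(1), of 0] integrable_normal_density[OF s(1), of 0]
    by (intro has_bochner_integral_mult_right) (auto simp: has_bochner_integral_iff)
  also have "(\<lambda>t. sqrt (pi / a) * normal_density 0 s t) = (\<lambda>t. exp (- (a * t\<^sup>2)))"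
  proof
    fix t
    have "2 * pi * s\<^sup>2 = pi / a" using s(2) by (simp add: field_simps)
    then show "sqrt (pi / a) * normal_density 0 s t = exp (- (a * t\<^sup>2))"
      using assms by (simp add: normal_density_def s(2) mult.commute)
  qed
  finally show ?thesis by simp
qed

lemma norm_power_diff_le:
  fixes a b :: complex
  assumes "norm a \<le> E" "norm b \<le> E" "0 < E" "0 < N"
  shows "norm (a ^ N - b ^ N) \<le> real N * norm (a - b) * E ^ (N - 1)"
proof -
  have E: "E ^ N = E * E ^ (N - 1)" using assms(4) by (simp add: power_eq_if)
  have "norm ((a / of_real E) ^ N - (b / of_real E) ^ N) \<le> real N * norm (a / of_real E - b / of_real E)"
    using assms by (intro norm_power_diff) (auto simp: norm_divide)
  also have "(a / of_real E) ^ N - (b / of_real E) ^ N = (a ^ N - b ^ N) / of_real (E ^ N)"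
    by (simp add: power_divide diff_divide_distrib)
  also have "a / of_real E - b / of_real E = (a - b) / of_real E" by (simp add: diff_divide_distrib)
  finally have "norm (a ^ N - b ^ N) / E ^ N \<le> real N * (norm (a - b) / E)"
    using assms by (simp add: norm_divide norm_power del: of_real_power)
  then show ?thesis using assms by (simp add: E field_simps)
qed

lemma sin_cubic: "\<bar>sin x - x\<bar> \<le> \<bar>x\<bar> ^ 3 / 6" for x :: real
proof -
  have "Im (iexp x - (\<Sum>k\<le>2. (\<i> * x) ^ k / fact k)) = sin x - x"
    by (simp only: cis_conv_exp[symmetric]) (simp add: numeral_2_eq_2)
  then have "\<bar>sin x - x\<bar> \<le> norm (iexp x - (\<Sum>k\<le>2. (\<i> * x) ^ k / fact k))"
    using abs_Im_le_cmod by metis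
  also have "\<dots> \<le> \<bar>x\<bar> ^ 3 / 6" using iexp_approx1[of x 2] by (simp add: fact_numeral)
  finally show ?thesis .
qed

lemma sin_half_bounds:
  fixes t :: real
  assumes "\<bar>t\<bar> \<le> pi" "t \<noteq> 0"
  shows "\<bar>t\<bar> / 3 \<le> \<bar>2 * sin (t / 2)\<bar>" "\<bar>1 / (2 * sin (t / 2)) - 1 / t\<bar> \<le> \<bar>t\<bar>"
proof -
  define s where "s = 2 * sin (t / 2)"
  have "\<bar>sin (t / 2) - t / 2\<bar> \<le> \<bar>t\<bar> ^ 3 / 48"
    using sin_cubic[of "t / 2"] by (simp add: abs_divide power_divide)
  then have st: "\<bar>s - t\<bar> \<le> \<bar>t\<bar> ^ 3 / 24" by (simp add: s_def abs_if split: if_splits)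
  have "\<bar>t\<bar> \<le> 4" using assms pi_less_4 by linarith
  then have "\<bar>t\<bar>\<^sup>2 \<le> 4\<^sup>2" by (intro power_mono) auto
  then have "\<bar>t\<bar> * \<bar>t\<bar>\<^sup>2 \<le> \<bar>t\<bar> * 16" by (intro mult_left_mono) auto
  then have "\<bar>t\<bar> ^ 3 \<le> 16 * \<bar>t\<bar>" by (simp add: power3_eq_cube power2_eq_square mult_ac)
  then have s: "\<bar>t\<bar> / 3 \<le> \<bar>s\<bar>" using st by linarith
  then show "\<bar>t\<bar> / 3 \<le> \<bar>2 * sin (t / 2)\<bar>" by (simp add: s_def)
  have s0: "s \<noteq> 0" using s assms by auto
  have "\<bar>1 / s - 1 / t\<bar> = \<bar>s - t\<bar> / (\<bar>s\<bar> * \<bar>t\<bar>)"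
  proof -
    have "1 / s - 1 / t = - (s - t) / (s * t)" using s0 assms by (simp add: diff_divide_distrib)
    then show ?thesis by (simp add: abs_mult abs_minus_commute)
  qed
  also have "\<dots> \<le> (\<bar>t\<bar> ^ 3 / 24) / (\<bar>t\<bar> / 3 * \<bar>t\<bar>)"
  proof -
    have "0 < \<bar>t\<bar> / 3 * \<bar>t\<bar>" using assms by (intro mult_pos_pos) auto
    then show ?thesis using st s by (intro frac_le mult_right_mono) auto
  qed
  also have "\<dots> = \<bar>t\<bar> / 8" using assms by (simp add: power3_eq_cube)
  also have "\<dots> \<le> \<bar>t\<bar>" by simp
  finally show "\<bar>1 / (2 * sin (t / 2)) - 1 / t\<bar> \<le> \<bar>t\<bar>" by (simp add: s_def)
qed

lemma exp_minus_quadratic: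
  fixes x :: real
  assumes "0 \<le> x"
  shows "\<bar>(1 - x) - exp (- x)\<bar> \<le> x\<^sup>2"
proof -
  have "exp (- x) \<le> 1 / (1 + x)"
    using exp_ge_add_one_self[of x] assms by (simp add: exp_minus inverse_eq_divide frac_le)
  also have "\<dots> \<le> 1 - x + x\<^sup>2"
    using assms by (simp add: field_simps power2_eq_square)
  finally show ?thesis using exp_ge_add_one_self[of "- x"] by simp
qed

text \<open>A telescoping sum bounds the difference of two \<open>N\<close>-th powers by \<open>N\<close> times the difference of the bases,
  which is of third order in \<open>t\<close>, times the \<open>(N - 1)\<close>-st power of the larger base.\<close>

lemma ccf_power_approx:
  assumes rad: "conv_radius (pmf X) > 1"
    and circ: "\<And>z :: complex. norm z = 1 \<Longrightarrow> z \<noteq> 1 \<Longrightarrow> norm (pgf X z) < 1"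
  obtains K c where "0 < K" "0 < c" "c \<le> pmf_variance X / 2"
    "\<And>N t. 0 < N \<Longrightarrow> \<bar>t\<bar> \<le> pi \<Longrightarrow>
      norm (ccf X t ^ N - of_real (exp (- (real N * pmf_variance X * t\<^sup>2 / 2))))
        \<le> K * real N * \<bar>t\<bar> ^ 3 * exp (- (c * real N * t\<^sup>2))"
proof -
  define v where "v = pmf_variance X"
  have v: "0 < v" unfolding v_def by (rule pmf_variance_pos[OF rad circ])
  obtain K where K: "0 \<le> K" "\<And>t. norm (ccf X t - of_real (1 - v * t\<^sup>2 / 2)) \<le> K * \<bar>t\<bar> ^ 3"
    using ccf_approx[OF rad] unfolding v_def by blast
  obtain c where c: "0 < c" "c \<le> v / 2" "\<And>t. \<bar>t\<bar> \<le> pi \<Longrightarrow> norm (ccf X t) \<le> exp (- (c * t\<^sup>2))"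
    using ccf_decay[OF rad circ] unfolding v_def by blast
  define L where "L = K + v\<^sup>2 / 4 * pi + 1"
  have L: "0 < L" using K v by (simp add: L_def add_nonneg_pos)
  show ?thesis
  proof (rule that[of "L * exp (c * pi\<^sup>2)" c])
    show "0 < L * exp (c * pi\<^sup>2)" using L by simp
    show "0 < c" "c \<le> pmf_variance X / 2" using c by (auto simp: v_def)
    fix N :: nat and t :: real assume N: "0 < N" and t: "\<bar>t\<bar> \<le> pi"
    let ?g = "complex_of_real (exp (- (v * t\<^sup>2 / 2)))"
    let ?E = "exp (- (c * t\<^sup>2))"
    have "c * t\<^sup>2 \<le> v / 2 * t\<^sup>2" using c by (intro mult_right_mono) auto
    then have gE: "norm ?g \<le> ?E" by simp
    have "norm (complex_of_real (1 - v * t\<^sup>2 / 2) - ?g) = \<bar>1 - v * t\<^sup>2 / 2 - exp (- (v * t\<^sup>2 / 2))\<bar>"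
      unfolding of_real_diff[symmetric] norm_of_real ..
    also have "\<dots> \<le> (v * t\<^sup>2 / 2)\<^sup>2" using v by (intro exp_minus_quadratic) auto
    also have "\<dots> = v\<^sup>2 / 4 * \<bar>t\<bar> * \<bar>t\<bar> ^ 3"
      by (simp add: power2_eq_square power3_eq_cube)
    also have "\<dots> \<le> v\<^sup>2 / 4 * pi * \<bar>t\<bar> ^ 3" using t by (intro mult_right_mono mult_left_mono) auto
    finally have "norm (ccf X t - ?g) \<le> K * \<bar>t\<bar> ^ 3 + v\<^sup>2 / 4 * pi * \<bar>t\<bar> ^ 3"
      using K(2)[of t] norm_triangle_ineq[of "ccf X t - of_real (1 - v * t\<^sup>2 / 2)" "of_real (1 - v * t\<^sup>2 / 2) - ?g"]
      by (simp del: of_real_diff)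
    also have "\<dots> \<le> L * \<bar>t\<bar> ^ 3" by (simp add: L_def distrib_right)
    finally have diff: "norm (ccf X t - ?g) \<le> L * \<bar>t\<bar> ^ 3" .
    have EN: "?E ^ (N - 1) = exp (c * t\<^sup>2) * exp (- (c * real N * t\<^sup>2))"
      using N by (simp add: exp_of_nat_mult[symmetric] exp_add[symmetric] of_nat_diff algebra_simps)
    have "c * t\<^sup>2 \<le> c * pi\<^sup>2" using c t power_mono[OF t, of 2] by simp
    then have EN': "?E ^ (N - 1) \<le> exp (c * pi\<^sup>2) * exp (- (c * real N * t\<^sup>2))"
      unfolding EN by (intro mult_right_mono) auto
    have "?g ^ N = of_real (exp (- (real N * v * t\<^sup>2 / 2)))"
      unfolding of_real_power[symmetric] exp_of_nat_mult[symmetric] by (simp add: mult_ac)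
    then have "norm (ccf X t ^ N - of_real (exp (- (real N * v * t\<^sup>2 / 2)))) = norm (ccf X t ^ N - ?g ^ N)"
      by simp
    also have "\<dots> \<le> real N * norm (ccf X t - ?g) * ?E ^ (N - 1)"
      by (rule norm_power_diff_le[OF c(3)[OF t] gE _ N]) simp
    also have "\<dots> \<le> real N * (L * \<bar>t\<bar> ^ 3) * (exp (c * pi\<^sup>2) * exp (- (c * real N * t\<^sup>2)))"
      using diff EN' L by (intro mult_mono) auto
    finally show "norm (ccf X t ^ N - of_real (exp (- (real N * pmf_variance X * t\<^sup>2 / 2))))
        \<le> L * exp (c * pi\<^sup>2) * real N * \<bar>t\<bar> ^ 3 * exp (- (c * real N * t\<^sup>2))"
      by (simp add: v_def mult_ac)
  qed
qed

text \<open>Half of the rate absorbs a linear factor.\<close>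

lemma one_plus_le_exp:
  fixes c x :: real
  assumes "0 < c" "0 \<le> x"
  shows "(1 + x) * exp (- (c * x)) \<le> (1 + 2 / c) * exp (- (c / 2 * x))"
proof -
  have "1 + x \<le> (1 + 2 / c) * (1 + c / 2 * x)"
    using assms by (simp add: field_simps)
  also have "\<dots> \<le> (1 + 2 / c) * exp (c / 2 * x)"
    using assms by (intro mult_left_mono exp_ge_add_one_self) auto
  finally have "(1 + x) * exp (- (c * x)) \<le> (1 + 2 / c) * exp (c / 2 * x) * exp (- (c * x))"
    by (intro mult_right_mono) auto
  also have "\<dots> = (1 + 2 / c) * exp (- (c / 2 * x))"
    by (simp add: exp_add[symmetric] mult.assoc) 
  finally show ?thesis .
qed

text \<open>The integrands of the two inversion formulas for a block have the same bounded numerator. They differ in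
  the kernels \<open>1 / (2 sin (t/2))\<close> and \<open>1 / t\<close>, whose difference is \<open>O(t)\<close>, in the characteristic functions,
  whose difference is \<open>O(N \<bar>t\<bar>\<^sup>3)\<close> times a Gaussian factor and thus cancels the pole at 0, and beyond \<open>\<pi>\<close>, where
  only the Gaussian one is integrated. The bound depends neither on the block nor on the cut-off \<open>T\<close> of
  the Gaussian integral.\<close>

lemma inversion_integrands_close:
  assumes rad: "conv_radius (pmf X) > 1"
    and circ: "\<And>z :: complex. norm z = 1 \<Longrightarrow> z \<noteq> 1 \<Longrightarrow> norm (pgf X z) < 1"
  obtains K c where "0 < K" "0 < c"
    "\<And>N m M T t. \<lbrakk>0 < N; m \<le> M; pi \<le> T; t \<noteq> 0\<rbrakk> \<Longrightarrow>
      norm (indicator {-pi..pi} t *\<^sub>R (pgf X (iexp t) ^ N * (\<Sum>k\<in>{m<..M}. iexp (- (t * real k))))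
        - indicator {-T..T} t *\<^sub>R ((iexp (- (t * (real m + 1/2))) - iexp (- (t * (real M + 1/2)))) / (\<i> * t)
          * (iexp (real N * pmf_mean X * t) * of_real (exp (- (real N * pmf_variance X * t\<^sup>2 / 2))))))
      \<le> K * exp (- (c * real N * t\<^sup>2))"
proof -
  obtain K c where K: "0 < K" "0 < c" "c \<le> pmf_variance X / 2"
    and approx: "\<And>N t. 0 < N \<Longrightarrow> \<bar>t\<bar> \<le> pi \<Longrightarrow>
      norm (ccf X t ^ N - of_real (exp (- (real N * pmf_variance X * t\<^sup>2 / 2))))
        \<le> K * real N * \<bar>t\<bar> ^ 3 * exp (- (c * real N * t\<^sup>2))"
    using ccf_power_approx[OF rad circ] by blast
  define K' where "K' = 6 * K + 2"
  have K': "0 < K'" using K by (simp add: K'_def)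
  show ?thesis
  proof (rule that[of "K' * (1 + 2 / c)" "c / 2"])
    show "0 < K' * (1 + 2 / c)" "0 < c / 2" using K K' by (auto intro!: mult_pos_pos add_pos_pos)
    fix N m M :: nat and T t :: real
    assume N: "0 < N" and mM: "m \<le> M" and T: "pi \<le> T" and t0: "t \<noteq> 0"
    define H where "H = iexp (- (t * (real m + 1/2))) - iexp (- (t * (real M + 1/2)))"
    define g where "g = exp (- (real N * pmf_variance X * t\<^sup>2 / 2))"
    define G where "G = exp (- (c * real N * t\<^sup>2))"
    define u where "u = iexp (real N * pmf_mean X * t)"
    define D where "D = (\<Sum>k\<in>{m<..M}. iexp (- (t * real k)))"
    have nu: "norm u = 1" by (simp add: u_def)
    have nH: "norm H \<le> 2"
      unfolding H_def by (rule order_trans[OF norm_triangle_ineq4]) simp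
    have "c * (real N * t\<^sup>2) \<le> pmf_variance X / 2 * (real N * t\<^sup>2)"
      using K by (intro mult_right_mono) auto
    then have gG: "0 \<le> g" "g \<le> G" by (auto simp: g_def G_def mult_ac)
    have t_le: "\<bar>t\<bar> \<le> 1 + real N * t\<^sup>2"
    proof -
      have "\<bar>t\<bar> \<le> 1 + t\<^sup>2"
      proof (cases "\<bar>t\<bar> \<le> 1")
        case False
        then have "\<bar>t\<bar> * 1 \<le> \<bar>t\<bar> * \<bar>t\<bar>" by (intro mult_left_mono) auto
        then show ?thesis by (simp add: power2_eq_square)
      qed (simp add: add_increasing2)
      moreover have "1 * t\<^sup>2 \<le> real N * t\<^sup>2" using N by (intro mult_right_mono) auto
      ultimately show ?thesis by simp
    qed
    have "norm (indicator {-pi..pi} t *\<^sub>R (pgf X (iexp t) ^ N * D)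
        - indicator {-T..T} t *\<^sub>R (H / (\<i> * t) * (u * of_real g))) \<le> K' * ((1 + real N * t\<^sup>2) * G)"
    proof (cases "\<bar>t\<bar> \<le> pi")
      case True
      then have ind: "t \<in> {-pi..pi}" "t \<in> {-T..T}" using T by auto
      define s where "s = 2 * sin (t / 2)"
      have s: "\<bar>t\<bar> / 3 \<le> \<bar>s\<bar>" "\<bar>1 / s - 1 / t\<bar> \<le> \<bar>t\<bar>"
        using sin_half_bounds[OF True t0] by (auto simp: s_def)
      have s0: "s \<noteq> 0" using s(1) t0 by auto
      have "D * (\<i> * of_real s) = H"
        using dirichlet_block[OF mM, of t] by (simp only: D_def H_def s_def of_real_mult of_real_numeral mult_ac)
      then have D: "D = H / (\<i> * of_real s)" using s0 by (simp add: field_simps)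
      have pg: "pgf X (iexp t) ^ N = u * ccf X t ^ N"
      proof -
        have "pgf X (iexp t) = iexp (pmf_mean X * t) * ccf X t"
          by (simp add: ccf_def mult.assoc[symmetric] exp_add[symmetric])
        moreover have "iexp (pmf_mean X * t) ^ N = u"
          by (simp add: u_def exp_of_nat_mult[symmetric] mult_ac)
        ultimately show ?thesis by (simp add: power_mult_distrib)
      qed
      have "pgf X (iexp t) ^ N * D - H / (\<i> * t) * (u * of_real g)
        = H / \<i> * u * ((ccf X t ^ N - of_real g) / of_real s + of_real (g * (1 / s - 1 / t)))"
        unfolding pg D of_real_mult of_real_diff of_real_divide of_real_1
          divide_inverse inverse_mult_distrib mult_1_left by (simp only: algebra_simps) simp
      also have "norm \<dots> = norm H * norm ((ccf X t ^ N - of_real g) / of_real s + of_real (g * (1 / s - 1 / t)))"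
        by (simp only: norm_mult norm_divide nu norm_ii mult_1_right div_by_1)
      also have "\<dots> \<le> 2 * (norm (ccf X t ^ N - of_real g) / \<bar>s\<bar> + g * \<bar>1 / s - 1 / t\<bar>)"
      proof (rule mult_mono[OF nH])
        show "norm ((ccf X t ^ N - of_real g) / of_real s + of_real (g * (1 / s - 1 / t)))
            \<le> norm (ccf X t ^ N - of_real g) / \<bar>s\<bar> + g * \<bar>1 / s - 1 / t\<bar>"
        proof -
          have 1: "norm ((ccf X t ^ N - of_real g) / of_real s) = norm (ccf X t ^ N - of_real g) / \<bar>s\<bar>"
            by (simp add: norm_divide)
          have 2: "norm (complex_of_real (g * (1 / s - 1 / t))) = g * \<bar>1 / s - 1 / t\<bar>"
            unfolding norm_of_real abs_mult using gG(1) by simp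
          show ?thesis
            using norm_triangle_ineq[of "(ccf X t ^ N - of_real g) / of_real s" "of_real (g * (1 / s - 1 / t))"]
            unfolding 1 2 .
        qed
      qed auto
      also have "\<dots> \<le> 2 * ((K * real N * \<bar>t\<bar> ^ 3 * G) / (\<bar>t\<bar> / 3) + G * \<bar>t\<bar>)"
      proof (intro mult_left_mono add_mono)
        show "norm (ccf X t ^ N - of_real g) / \<bar>s\<bar> \<le> (K * real N * \<bar>t\<bar> ^ 3 * G) / (\<bar>t\<bar> / 3)"
          using approx[OF N True] s t0 less_imp_le[OF K(1)] by (intro frac_le) (auto simp: g_def G_def)
        show "g * \<bar>1 / s - 1 / t\<bar> \<le> G * \<bar>t\<bar>" using gG s by (intro mult_mono) auto
      qed auto
      also have "\<dots> = 6 * K * (real N * t\<^sup>2 * G) + 2 * (\<bar>t\<bar> * G)"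
        using t0 by (simp add: power3_eq_cube power2_eq_square field_simps)
      also have "\<dots> \<le> 6 * K * ((1 + real N * t\<^sup>2) * G) + 2 * ((1 + real N * t\<^sup>2) * G)"
        using K t_le by (intro add_mono mult_left_mono mult_right_mono) (auto simp: G_def)
      also have "\<dots> = K' * ((1 + real N * t\<^sup>2) * G)" by (simp add: K'_def algebra_simps)
      finally show ?thesis using ind by simp
    next
      case False
      then have ind: "t \<notin> {-pi..pi}" by auto
      have "1 \<le> \<bar>t\<bar>" using False pi_ge_two by linarith
      have "norm (H / (\<i> * t) * (u * of_real g)) = norm H * g / \<bar>t\<bar>"
        using gG by (simp add: norm_mult norm_divide nu)
      also have "\<dots> \<le> 2 * G / 1" using \<open>1 \<le> \<bar>t\<bar>\<close> nH gG by (intro frac_le mult_mono) auto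
      finally have "norm (H / (\<i> * t) * (u * of_real g)) \<le> 2 * G" by simp
      also have "\<dots> \<le> K' * ((1 + real N * t\<^sup>2) * G)"
      proof -
        have "2 * (1 * G) \<le> K' * ((1 + real N * t\<^sup>2) * G)"
          using K by (intro mult_mono mult_right_mono) (auto simp: K'_def G_def)
        then show ?thesis by simp
      qed
      finally show ?thesis using ind by (auto simp: indicator_def G_def K' less_imp_le intro: order_trans[rotated])
    qed
    also have "\<dots> \<le> K' * ((1 + 2 / c) * exp (- (c / 2 * (real N * t\<^sup>2))))"
      using K' one_plus_le_exp[of c "real N * t\<^sup>2"] K by (intro mult_left_mono) (auto simp: G_def mult.assoc)
    finally show "norm (indicator {-pi..pi} t *\<^sub>R (pgf X (iexp t) ^ N * (\<Sum>k\<in>{m<..M}. iexp (- (t * real k))))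
        - indicator {-T..T} t *\<^sub>R ((iexp (- (t * (real m + 1/2))) - iexp (- (t * (real M + 1/2)))) / (\<i> * t)
          * (iexp (real N * pmf_mean X * t) * of_real (exp (- (real N * pmf_variance X * t\<^sup>2 / 2))))))
      \<le> K' * (1 + 2 / c) * exp (- (c / 2 * real N * t\<^sup>2))"
      unfolding H_def g_def u_def D_def by (simp add: mult.assoc)
  qed
qed

text \<open>The rate \<open>1 / \<surd>N\<close> is the integral of the Gaussian bound on the difference of the integrands. On the
  Gaussian side Levy's inversion formula supplies the limit \<open>T \<rightarrow> \<infinity>\<close>.\<close>

lemma normal_law_approx_block:
  assumes rad: "conv_radius (pmf X) > 1"
    and circ: "\<And>z :: complex. norm z = 1 \<Longrightarrow> z \<noteq> 1 \<Longrightarrow> norm (pgf X z) < 1"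
  obtains C where "0 \<le> C"
    "\<And>N m M. \<lbrakk>0 < N; m \<le> M\<rbrakk> \<Longrightarrow>
      \<bar>measure_pmf.prob (demand X N) {m<..M}
        - measure (normal_law (real N * pmf_mean X) (sqrt (real N * pmf_variance X))) {real m + 1/2<..real M + 1/2}\<bar>
      \<le> C / sqrt (real N)"
proof -
  obtain K c where K: "0 < K" "0 < c" and close:
    "\<And>N m M T t. \<lbrakk>0 < N; m \<le> M; pi \<le> T; t \<noteq> 0\<rbrakk> \<Longrightarrow>
      norm (indicator {-pi..pi} t *\<^sub>R (pgf X (iexp t) ^ N * (\<Sum>k\<in>{m<..M}. iexp (- (t * real k))))
        - indicator {-T..T} t *\<^sub>R ((iexp (- (t * (real m + 1/2))) - iexp (- (t * (real M + 1/2)))) / (\<i> * t)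
          * (iexp (real N * pmf_mean X * t) * of_real (exp (- (real N * pmf_variance X * t\<^sup>2 / 2))))))
      \<le> K * exp (- (c * real N * t\<^sup>2))"
    using inversion_integrands_close[OF rad circ] by blast
  have v: "0 < pmf_variance X" by (rule pmf_variance_pos[OF rad circ])
  define C where "C = K * sqrt (pi / c) / (2 * pi)"
  show ?thesis
  proof (rule that[of C])
    show "0 \<le> C" using K by (simp add: C_def)
    fix N m M :: nat assume N: "0 < N" and mM: "m \<le> M"
    define a where "a = real N * pmf_mean X"
    define d where "d = sqrt (real N * pmf_variance X)"
    have d: "0 < d" "d\<^sup>2 = real N * pmf_variance X" using N v by (auto simp: d_def)
    interpret real_distribution "normal_law a d" by (rule real_distribution_normal_law)
    let ?P = "measure_pmf.prob (demand X N) {m<..M}"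
    let ?G = "measure (normal_law a d) {real m + 1/2<..real M + 1/2}"
    define f where "f t = indicator {-pi..pi} t *\<^sub>R (pgf X (iexp t) ^ N * (\<Sum>k\<in>{m<..M}. iexp (- (t * real k))))" for t
    define h where "h t = (iexp (- (t * (real m + 1/2))) - iexp (- (t * (real M + 1/2)))) / (\<i> * t)
          * (iexp (a * t) * of_real (exp (- (real N * pmf_variance X * t\<^sup>2 / 2))))" for t :: real
    have cont: "continuous_on {-pi..pi} (\<lambda>t. pgf X (iexp t) ^ N * (\<Sum>k\<in>{m<..M}. iexp (- (t * real k))))"
      by (intro continuous_intros continuous_pgf_iexp rad)
    have f_int: "integrable lborel f"
      unfolding f_def[abs_def] using borel_integrable_atLeastAtMost'[OF cont] by (simp add: set_integrable_def)
    have f_eq: "(\<integral>t. f t \<partial>lborel) = 2 * pi * complex_of_real ?P"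
    proof -
      have pg: "pgf X (iexp t) ^ N = pgf (demand X N) (iexp t)" for t
        using pgf_demand[of X "iexp t" N] sums_summable[OF sums_pmf_nat[of X]] by simp
      have ck: "continuous_on {-pi..pi} (\<lambda>t. pgf (demand X N) (iexp t) * iexp (- (t * real k)))" for k
        unfolding pg[symmetric] by (intro continuous_intros continuous_pgf_iexp rad)
      have ik: "integrable lborel (\<lambda>t. indicator {-pi..pi} t *\<^sub>R (pgf (demand X N) (iexp t) * iexp (- (t * real k))))" for k
        using borel_integrable_atLeastAtMost'[OF ck[of k]] by (simp add: set_integrable_def)
      have "f t = (\<Sum>k\<in>{m<..M}. indicator {-pi..pi} t *\<^sub>R (pgf (demand X N) (iexp t) * iexp (- (t * real k))))" for t
        unfolding f_def pg sum_distrib_left scaleR_right.sum ..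
      then have "(\<integral>t. f t \<partial>lborel) = (\<Sum>k\<in>{m<..M}. 2 * pi * complex_of_real (pmf (demand X N) k))"
        unfolding pmf_inversion by (simp only:) (rule Bochner_Integration.integral_sum, rule ik)
      also have "\<dots> = 2 * pi * complex_of_real ?P"
        by (subst measure_measure_pmf_finite) (auto simp: sum_distrib_left)
      finally show ?thesis .
    qed
    have gauss: "has_bochner_integral lborel (\<lambda>t. K * exp (- (c * real N * t\<^sup>2))) (K * sqrt (pi / (c * real N)))"
      using N K by (intro has_bochner_integral_mult_right has_bochner_integral_gauss) auto
    have h_meas: "h \<in> borel_measurable borel" unfolding h_def[abs_def] by measurable
    have step: "norm (complex_of_real ?P - 1 / (2 * pi) * (\<integral>t. indicator {-T..T} t *\<^sub>R h t \<partial>lborel)) \<le> C / sqrt (real N)"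
      if T: "pi \<le> T" for T :: real
    proof -
      let ?g = "\<lambda>t. indicator {-T..T} t *\<^sub>R h t"
      have g_meas: "?g \<in> borel_measurable lborel" using h_meas by measurable
      have ae: "AE t in lborel. norm (f t - ?g t) \<le> K * exp (- (c * real N * t\<^sup>2))"
        using AE_lborel_singleton[of "0 :: real"]
        by eventually_elim (use close[OF N mM T] in \<open>simp add: f_def h_def a_def\<close>)
      have fg_int: "integrable lborel (\<lambda>t. f t - ?g t)"
      proof (rule Bochner_Integration.integrable_bound)
        show "integrable lborel (\<lambda>t. K * exp (- (c * real N * t\<^sup>2)))"
          using gauss by (auto simp: has_bochner_integral_iff)
        show "(\<lambda>t. f t - ?g t) \<in> borel_measurable lborel"
          using f_int g_meas by (intro borel_measurable_diff) auto
        show "AE t in lborel. norm (f t - ?g t) \<le> norm (K * exp (- (c * real N * t\<^sup>2)))"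
          using ae K by auto
      qed
      have g_int: "integrable lborel ?g"
        using Bochner_Integration.integrable_diff[OF f_int fg_int] by simp
      have "norm ((\<integral>t. f t \<partial>lborel) - (\<integral>t. ?g t \<partial>lborel)) = norm (\<integral>t. f t - ?g t \<partial>lborel)"
        using f_int g_int by simp
      also have "\<dots> \<le> (\<integral>t. norm (f t - ?g t) \<partial>lborel)" by (rule integral_norm_bound)
      also have "\<dots> \<le> (\<integral>t. K * exp (- (c * real N * t\<^sup>2)) \<partial>lborel)"
        using fg_int gauss ae by (intro integral_mono_AE) (auto simp: has_bochner_integral_iff)
      also have "\<dots> = K * sqrt (pi / (c * real N))" using gauss by (simp only: has_bochner_integral_iff)
      finally have bound: "norm (2 * pi * complex_of_real ?P - (\<integral>t. ?g t \<partial>lborel)) \<le> K * sqrt (pi / (c * real N))"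
        unfolding f_eq .
      have "complex_of_real ?P - 1 / (2 * pi) * (\<integral>t. ?g t \<partial>lborel)
          = (2 * pi * complex_of_real ?P - (\<integral>t. ?g t \<partial>lborel)) / complex_of_real (2 * pi)"
        by (simp add: field_simps)
      also have "norm \<dots> \<le> K * sqrt (pi / (c * real N)) / (2 * pi)"
        unfolding norm_divide using bound by (simp add: divide_right_mono)
      also have "\<dots> = C / sqrt (real N)"
        by (simp add: C_def real_sqrt_divide real_sqrt_mult)
      finally show ?thesis .
    qed
    have Levy: "(\<lambda>T. 1 / (2 * pi) * (CLBINT t=- real T..real T.
        (iexp (- (t * (real m + 1/2))) - iexp (- (t * (real M + 1/2)))) / (\<i> * t) * char (normal_law a d) t))
        \<longlonglongrightarrow> complex_of_real ?G"
      using Levy_Inversion[of "real m + 1/2" "real M + 1/2"] mM d by (simp add: measure_normal_law_singleton)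
    have "(CLBINT t=- real T..real T.
        (iexp (- (t * (real m + 1/2))) - iexp (- (t * (real M + 1/2)))) / (\<i> * t) * char (normal_law a d) t)
        = (\<integral>t. indicator {- real T..real T} t *\<^sub>R h t \<partial>lborel)" for T :: nat
      by (subst interval_integral_Icc)
        (simp_all add: char_normal_law h_def d(2) set_lebesgue_integral_def)
    then have "(\<lambda>T. complex_of_real ?P - 1 / (2 * pi) * (\<integral>t. indicator {- real T..real T} t *\<^sub>R h t \<partial>lborel))
        \<longlonglongrightarrow> complex_of_real ?P - complex_of_real ?G"
      using Levy by (intro tendsto_diff tendsto_const) simp
    from tendsto_norm[OF this]
    have "norm (complex_of_real ?P - complex_of_real ?G) \<le> C / sqrt (real N)"
    proof (rule tendsto_upperbound)
      show "\<forall>\<^sub>F T in sequentially. norm (complex_of_real ?P - 1 / (2 * pi) * (\<integral>t. indicator {- real T..real T} t *\<^sub>R h t \<partial>lborel)) \<le> C / sqrt (real N)"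
        using eventually_ge_at_top[of 4]
      proof eventually_elim
        case (elim T)
        then have "pi \<le> real T" using pi_less_4 by linarith
        then show ?case by (rule step)
      qed
    qed simp
    then show "\<bar>measure_pmf.prob (demand X N) {m<..M}
        - measure (normal_law (real N * pmf_mean X) (sqrt (real N * pmf_variance X))) {real m + 1/2<..real M + 1/2}\<bar>
        \<le> C / sqrt (real N)"
      unfolding a_def d_def of_real_diff[symmetric] norm_of_real .
  qed
qed

text \<open>The Berry--Esseen bound for integer-valued summands. The block bound is uniform, so the block may grow to
  infinity; moving its left end from \<open>m + 1/2\<close> to \<open>m\<close> costs another \<open>O(1 / \<surd>N)\<close>.\<close>

lemma berry_esseen:
  assumes rad: "conv_radius (pmf X) > 1"
    and circ: "\<And>z :: complex. norm z = 1 \<Longrightarrow> z \<noteq> 1 \<Longrightarrow> norm (pgf X z) < 1"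
  obtains C where "0 \<le> C"
    "\<And>N m. 0 < N \<Longrightarrow>
      \<bar>measure_pmf.prob (demand X N) {m<..}
        - normal_tail ((real m - real N * pmf_mean X) / sqrt (real N * pmf_variance X))\<bar> \<le> C / sqrt (real N)"
proof -
  obtain C where C: "0 \<le> C" and block: "\<And>N m M. \<lbrakk>0 < N; m \<le> M\<rbrakk> \<Longrightarrow>
      \<bar>measure_pmf.prob (demand X N) {m<..M}
        - measure (normal_law (real N * pmf_mean X) (sqrt (real N * pmf_variance X))) {real m + 1/2<..real M + 1/2}\<bar>
      \<le> C / sqrt (real N)"
    using normal_law_approx_block[OF rad circ] by blast
  define v where "v = pmf_variance X"
  have v: "0 < v" unfolding v_def by (rule pmf_variance_pos[OF rad circ])
  show ?thesis
  proof (rule that[of "C + 1 / sqrt v"])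
    show "0 \<le> C + 1 / sqrt v" using C v by simp
    fix N m :: nat assume N: "0 < N"
    define a where "a = real N * pmf_mean X"
    define d where "d = sqrt (real N * v)"
    have d: "0 < d" using N v by (simp add: d_def)
    interpret real_distribution "normal_law a d" by (rule real_distribution_normal_law)
    have "(\<lambda>i. measure_pmf.prob (demand X N) {m<..m + i}) \<longlonglongrightarrow> measure_pmf.prob (demand X N) (\<Union>i. {m<..m + i})"
      by (rule measure_pmf.finite_Lim_measure_incseq) (auto simp: incseq_def)
    moreover have "(\<Union>i. {m<..m + i}) = {m<..}"
    proof safe
      fix x assume "m < x"
      then have "x \<in> {m<..m + x}" by simp
      then show "x \<in> (\<Union>i. {m<..m + i})" by blast
    qed simp
    moreover have "(\<lambda>i. prob {real m + 1/2<..real (m + i) + 1/2}) \<longlonglongrightarrow> prob (\<Union>i. {real m + 1/2<..real (m + i) + 1/2})"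
      by (rule finite_Lim_measure_incseq) (auto simp: incseq_def)
    moreover have "(\<Union>i. {real m + 1/2<..real (m + i) + 1/2}) = {real m + 1/2<..}"
    proof safe
      fix x :: real assume x: "real m + 1/2 < x"
      obtain i :: nat where "x \<le> real i" using real_arch_simple by blast
      then have "x \<in> {real m + 1/2<..real (m + i) + 1/2}" using x by simp
      then show "x \<in> (\<Union>i. {real m + 1/2<..real (m + i) + 1/2})" by blast
    qed simp
    ultimately have "(\<lambda>i. \<bar>measure_pmf.prob (demand X N) {m<..m + i} - prob {real m + 1/2<..real (m + i) + 1/2}\<bar>)
        \<longlonglongrightarrow> \<bar>measure_pmf.prob (demand X N) {m<..} - prob {real m + 1/2<..}\<bar>"
      by (intro tendsto_intros) auto
    then have "\<bar>measure_pmf.prob (demand X N) {m<..} - prob {real m + 1/2<..}\<bar> \<le> C / sqrt (real N)"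
    proof (rule tendsto_upperbound)
      show "\<forall>\<^sub>F i in sequentially. \<bar>measure_pmf.prob (demand X N) {m<..m + i} - prob {real m + 1/2<..real (m + i) + 1/2}\<bar> \<le> C / sqrt (real N)"
        unfolding a_def d_def v_def by (intro always_eventually allI block[OF N]) simp
    qed simp
    then have 1: "\<bar>measure_pmf.prob (demand X N) {m<..} - normal_tail ((real m + 1/2 - a) / d)\<bar> \<le> C / sqrt (real N)"
      unfolding measure_normal_law_greater[OF d] .
    have "\<bar>normal_tail ((real m + 1/2 - a) / d) - normal_tail ((real m - a) / d)\<bar>
        \<le> \<bar>(real m + 1/2 - a) / d - (real m - a) / d\<bar>"
      by (rule normal_tail_diff_le)
    also have "(real m + 1/2 - a) / d - (real m - a) / d = 1 / 2 / d"
      by (simp add: diff_divide_distrib[symmetric])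
    also have "\<bar>1 / 2 / d\<bar> \<le> 1 / d" using d by (simp add: field_simps)
    also have "1 / d = 1 / sqrt v / sqrt (real N)" by (simp add: d_def real_sqrt_mult)
    finally have 2: "\<bar>normal_tail ((real m + 1/2 - a) / d) - normal_tail ((real m - a) / d)\<bar> \<le> 1 / sqrt v / sqrt (real N)" .
    have "\<bar>measure_pmf.prob (demand X N) {m<..} - normal_tail ((real m - a) / d)\<bar>
        \<le> C / sqrt (real N) + 1 / sqrt v / sqrt (real N)"
      using 1 2 by linarith
    then show "\<bar>measure_pmf.prob (demand X N) {m<..}
        - normal_tail ((real m - real N * pmf_mean X) / sqrt (real N * pmf_variance X))\<bar> \<le> (C + 1 / sqrt v) / sqrt (real N)"
      by (simp add: a_def d_def v_def add_divide_distrib)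
  qed
qed

section \<open>Bounds for the idle probability\<close>

lemma exp_le_quadratic:
  fixes y :: real
  shows "exp y \<le> 1 + y + y\<^sup>2 / 2 + \<bar>y\<bar> ^ 3 * exp \<bar>y\<bar>"
proof -
  obtain t where t: "\<bar>t\<bar> \<le> \<bar>y\<bar>" "exp y = (\<Sum>m<3. y ^ m / fact m) + exp t / fact 3 * y ^ 3"
    using Maclaurin_exp_le[of y 3] by auto
  have "exp t / fact 3 * y ^ 3 \<le> \<bar>exp t / fact 3 * y ^ 3\<bar>" by (rule abs_ge_self)
  also have "\<dots> = exp t / 6 * \<bar>y\<bar> ^ 3" by (simp add: abs_mult power_abs fact_numeral)
  also have "\<dots> \<le> exp \<bar>y\<bar> * \<bar>y\<bar> ^ 3"
  proof (rule mult_right_mono)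
    have "exp t \<le> exp \<bar>y\<bar>" using t(1) by simp
    then show "exp t / 6 \<le> exp \<bar>y\<bar>" using exp_gt_zero[of t] by linarith
  qed simp
  finally show ?thesis unfolding t(2) by (simp add: numeral_3_eq_3 power2_eq_square mult.commute)
qed

text \<open>Integrate the cubic Taylor bound of the exponential; \<open>K\<close> is an exponentially weighted third absolute
  moment.\<close>

lemma mgf_bound:
  assumes rad: "conv_radius (pmf X) > 1"
  obtains K a where "0 < a" "0 \<le> K"
    "\<And>\<theta>. 0 \<le> \<theta> \<Longrightarrow> \<theta> \<le> a \<Longrightarrow> integrable (measure_pmf X) (\<lambda>x. exp (\<theta> * (real x - pmf_mean X)))"
    "\<And>\<theta>. 0 \<le> \<theta> \<Longrightarrow> \<theta> \<le> a \<Longrightarrow> measure_pmf.expectation X (\<lambda>x. exp (\<theta> * (real x - pmf_mean X)))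
       \<le> exp (pmf_variance X * \<theta>\<^sup>2 / 2 + K * \<theta> ^ 3)"
proof -
  define \<mu> where "\<mu> = pmf_mean X"
  let ?E = "measure_pmf.expectation X"
  obtain a where a: "0 < a" "integrable (measure_pmf X) (\<lambda>x. \<bar>real x - \<mu>\<bar> ^ 3 * exp (a * \<bar>real x - \<mu>\<bar>))"
    using integrable_cube_exp[OF rad] by blast
  define K where "K = ?E (\<lambda>x. \<bar>real x - \<mu>\<bar> ^ 3 * exp (a * \<bar>real x - \<mu>\<bar>))"
  note m = centered_moments[OF rad, folded \<mu>_def]
  define B where "B \<theta> x = 1 + \<theta> * (real x - \<mu>) + \<theta>\<^sup>2 / 2 * (real x - \<mu>)\<^sup>2
      + \<theta> ^ 3 * (\<bar>real x - \<mu>\<bar> ^ 3 * exp (a * \<bar>real x - \<mu>\<bar>))" for \<theta> x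
  have le: "exp (\<theta> * (real x - \<mu>)) \<le> B \<theta> x" if "0 \<le> \<theta>" "\<theta> \<le> a" for \<theta> x
  proof -
    have "\<bar>\<theta> * (real x - \<mu>)\<bar> ^ 3 * exp \<bar>\<theta> * (real x - \<mu>)\<bar>
        \<le> (\<theta> ^ 3 * \<bar>real x - \<mu>\<bar> ^ 3) * exp (a * \<bar>real x - \<mu>\<bar>)"
      using that by (intro mult_mono) (auto simp: abs_mult power_mult_distrib mult_right_mono)
    then show ?thesis
      using exp_le_quadratic[of "\<theta> * (real x - \<mu>)"] by (simp add: B_def power_mult_distrib mult.assoc)
  qed
  have iB: "integrable (measure_pmf X) (B \<theta>)" for \<theta>
    unfolding B_def using a m by auto
  have EB: "?E (B \<theta>) = 1 + (pmf_variance X * \<theta>\<^sup>2 / 2 + K * \<theta> ^ 3)" for \<theta>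
    unfolding B_def using a m by (simp add: K_def)
  have int: "integrable (measure_pmf X) (\<lambda>x. exp (\<theta> * (real x - \<mu>)))" if "0 \<le> \<theta>" "\<theta> \<le> a" for \<theta>
    by (rule Bochner_Integration.integrable_bound[OF iB[of \<theta>]])
       (use le[OF that] in \<open>auto intro!: AE_pmfI order_trans[OF _ abs_ge_self]\<close>)
  show ?thesis
  proof (rule that[of a K])
    show "0 < a" by fact
    show "0 \<le> K" unfolding K_def by (intro integral_nonneg_AE) auto
    fix \<theta> :: real assume \<theta>: "0 \<le> \<theta>" "\<theta> \<le> a"
    show "integrable (measure_pmf X) (\<lambda>x. exp (\<theta> * (real x - pmf_mean X)))"
      using int[OF \<theta>] by (simp add: \<mu>_def)
    have "?E (\<lambda>x. exp (\<theta> * (real x - \<mu>))) \<le> ?E (B \<theta>)"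
      by (intro integral_mono int iB le \<theta>)
    also have "\<dots> \<le> exp (pmf_variance X * \<theta>\<^sup>2 / 2 + K * \<theta> ^ 3)"
      unfolding EB by (rule exp_ge_add_one_self)
    finally show "?E (\<lambda>x. exp (\<theta> * (real x - pmf_mean X))) \<le> exp (pmf_variance X * \<theta>\<^sup>2 / 2 + K * \<theta> ^ 3)"
      by (simp add: \<mu>_def)
  qed
qed

lemma chernoff_demand:
  assumes int: "integrable (measure_pmf X) (\<lambda>x. exp (\<theta> * (real x - \<mu>)))" and \<theta>: "0 \<le> \<theta>"
    and le: "measure_pmf.expectation X (\<lambda>x. exp (\<theta> * (real x - \<mu>))) \<le> exp \<kappa>"
  shows "measure_pmf.prob (demand X N) {m<..} \<le> exp (real N * \<kappa> - \<theta> * (real m - real N * \<mu>))"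
proof -
  define z where "z = exp \<theta>"
  have z: "1 \<le> z" using \<theta> by (simp add: z_def)
  have zp: "z ^ j = exp (\<theta> * \<mu>) * exp (\<theta> * (real j - \<mu>))" for j
    by (simp add: z_def exp_of_nat_mult[symmetric] exp_add[symmetric] algebra_simps)
  have "integrable (measure_pmf X) (\<lambda>x. z ^ x)"
    unfolding zp using int by simp
  then have sX: "summable (\<lambda>j. pmf X j * z ^ j)"
    using z by (simp add: integrable_pmf_nat_iff)
  have "pgf X z = measure_pmf.expectation X (\<lambda>x. z ^ x)"
    using expectation_pmf_nat_sums[of X "\<lambda>x. z ^ x"] sX z by (simp add: pgf_def sums_iff)
  also have "\<dots> \<le> exp (\<theta> * \<mu>) * exp \<kappa>"
    unfolding zp using le by simp
  finally have pX: "pgf X z \<le> exp (\<theta> * \<mu> + \<kappa>)" by (simp add: exp_add)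
  have sD: "summable (\<lambda>j. pmf (demand X N) j * z ^ j)" and pD: "pgf (demand X N) z = pgf X z ^ N"
    using pgf_demand[of X z N] sX z by auto
  have pX0: "0 \<le> pgf X z" unfolding pgf_def using sX z by (intro suminf_nonneg) auto
  have "(\<lambda>j. pmf (demand X N) j * indicator {m<..} j * z ^ m) sums (measure_pmf.prob (demand X N) {m<..} * z ^ m)"
    by (intro sums_mult2 prob_pmf_nat_sums)
  moreover have "(\<lambda>j. pmf (demand X N) j * z ^ j) sums pgf (demand X N) z"
    using sD by (simp add: pgf_def summable_sums)
  ultimately have "measure_pmf.prob (demand X N) {m<..} * z ^ m \<le> pgf (demand X N) z"
  proof (rule sums_le[rotated])
    fix j
    show "pmf (demand X N) j * indicator {m<..} j * z ^ m \<le> pmf (demand X N) j * z ^ j"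
      using z by (cases "m < j") (auto intro!: mult_left_mono power_increasing)
  qed
  also have "\<dots> \<le> exp (\<theta> * \<mu> + \<kappa>) ^ N"
    unfolding pD by (intro power_mono pX pX0)
  also have "\<dots> = exp (real N * (\<theta> * \<mu> + \<kappa>))" by (simp add: exp_of_nat_mult)
  finally have "measure_pmf.prob (demand X N) {m<..} \<le> exp (real N * (\<theta> * \<mu> + \<kappa>)) / exp (real m * \<theta>)"
    by (simp add: z_def exp_of_nat_mult[symmetric] field_simps)
  also have "\<dots> = exp (real N * \<kappa> - \<theta> * (real m - real N * \<mu>))"
    by (simp add: exp_diff[symmetric] algebra_simps)
  finally show ?thesis .
qed

text \<open>The \<open>l\<close>-th summand of Spitzer's series is at most the \<open>l\<close>-th power of the Chernoff bound for one
  period, so the series is dominated by a geometric one.\<close>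

lemma ln_pmf_0_le_chernoff:
  assumes rad: "conv_radius (pmf X) > 1"
    and load: "real n * pmf_mean X < real s" and st: "stationary_congestion X n s Q"
    and int: "integrable (measure_pmf X) (\<lambda>x. exp (\<theta> * (real x - pmf_mean X)))" and \<theta>: "0 \<le> \<theta>"
    and le: "measure_pmf.expectation X (\<lambda>x. exp (\<theta> * (real x - pmf_mean X))) \<le> exp \<kappa>"
    and small: "exp (real n * \<kappa> - \<theta> * (real s - real n * pmf_mean X)) \<le> E" "E \<le> 1 / 2"
  shows "\<bar>ln (pmf Q 0)\<bar> \<le> 2 * E"
proof -
  define t where "t l = measure_pmf.prob (demand X (n * l)) {s * l<..} / real l" for l
  have t: "summable (\<lambda>m. t (Suc m))" "pmf Q 0 = exp (- (\<Sum>m. t (Suc m)))"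
    using pmf_stationary_0_eq[OF rad load st] by (simp_all add: t_def)
  let ?e = "real n * \<kappa> - \<theta> * (real s - real n * pmf_mean X)"
  have E0: "0 < E" using small(1) by (rule less_le_trans[rotated]) simp
  have tE: "t (Suc m) \<le> E * (1 / 2) ^ m" for m
  proof -
    have "t (Suc m) \<le> measure_pmf.prob (demand X (n * Suc m)) {s * Suc m<..}"
      unfolding t_def by (simp add: divide_le_eq mult_le_cancel_left1 del: of_nat_Suc)
    also have "\<dots> \<le> exp (real (n * Suc m) * \<kappa> - \<theta> * (real (s * Suc m) - real (n * Suc m) * pmf_mean X))"
      by (rule chernoff_demand[OF int \<theta> le])
    also have "\<dots> = exp ?e ^ Suc m"
      unfolding exp_of_nat_mult[symmetric] by (simp add: algebra_simps)
    also have "\<dots> \<le> E ^ Suc m" by (intro power_mono small) simp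
    also have "\<dots> \<le> E * (1 / 2) ^ m" using E0 small(2) by (simp add: mult_left_mono power_mono)
    finally show ?thesis .
  qed
  have t0: "0 \<le> t (Suc m)" for m by (simp add: t_def)
  have "(\<Sum>m. t (Suc m)) \<le> (\<Sum>m. E * (1 / 2) ^ m)"
    by (intro suminf_le tE t(1) summable_mult summable_geometric) simp
  also have "\<dots> = 2 * E" by (subst suminf_mult) (simp_all add: suminf_geometric summable_geometric)
  finally show ?thesis using suminf_nonneg[OF t(1) t0] by (simp add: t(2))
qed

text \<open>Compare Spitzer's series with \<^const>\<open>F\<close> term by term. The Berry--Esseen error of the \<open>l\<close>-th term is
  \<open>C / (l \<surd>(n l))\<close>, and \<open>l powr (- 3/2)\<close> is summable.\<close>

lemma ln_pmf_0_approx: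
  assumes rad: "conv_radius (pmf X) > 1"
    and circ: "\<And>z :: complex. norm z = 1 \<Longrightarrow> z \<noteq> 1 \<Longrightarrow> norm (pgf X z) < 1"
  obtains C where "0 \<le> C"
    "\<And>n s Q. \<lbrakk>0 < n; real n * pmf_mean X < real s; stationary_congestion X n s Q\<rbrakk> \<Longrightarrow>
      \<bar>ln (pmf Q 0) + F ((real s - real n * pmf_mean X) / sqrt (real n * pmf_variance X))\<bar> \<le> C / sqrt (real n)"
proof -
  obtain C where C: "0 \<le> C" and be: "\<And>N m. 0 < N \<Longrightarrow>
      \<bar>measure_pmf.prob (demand X N) {m<..}
        - normal_tail ((real m - real N * pmf_mean X) / sqrt (real N * pmf_variance X))\<bar> \<le> C / sqrt (real N)"
    using berry_esseen[OF rad circ] by blast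
  have v: "0 < pmf_variance X" by (rule pmf_variance_pos[OF rad circ])
  have zeta: "summable (\<lambda>m. real (Suc m) powr (- 3/2))"
    by (subst summable_Suc_iff) (simp add: summable_real_powr_iff)
  define Z where "Z = (\<Sum>m. real (Suc m) powr (- 3/2))"
  have Z: "0 \<le> Z" unfolding Z_def using zeta by (intro suminf_nonneg) auto
  show ?thesis
  proof (rule that[of "C * Z"])
    show "0 \<le> C * Z" using C Z by simp
    fix n s :: nat and Q
    assume n: "0 < n" and load: "real n * pmf_mean X < real s" and st: "stationary_congestion X n s Q"
    define t where "t l = measure_pmf.prob (demand X (n * l)) {s * l<..} / real l" for l
    have t: "summable (\<lambda>m. t (Suc m))" "pmf Q 0 = exp (- (\<Sum>m. t (Suc m)))"
      using pmf_stationary_0_eq[OF rad load st] by (simp_all add: t_def)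
    define \<beta> where "\<beta> = (real s - real n * pmf_mean X) / sqrt (real n * pmf_variance X)"
    have \<beta>: "0 < \<beta>" using load n v by (simp add: \<beta>_def)
    define u where "u m = normal_tail (\<beta> * sqrt (real (Suc m))) / real (Suc m)" for m
    have u: "summable u" "F \<beta> = (\<Sum>m. u m)"
      using F_mixture(1)[OF \<beta>] by (simp_all add: u_def[abs_def] F_eq)
    have diff: "\<bar>u m - t (Suc m)\<bar> \<le> C / sqrt (real n) * real (Suc m) powr (- 3/2)" for m
    proof -
      let ?l = "real (Suc m)"
      have l: "0 < ?l" by simp
      have arg: "(real (s * Suc m) - real (n * Suc m) * pmf_mean X) / sqrt (real (n * Suc m) * pmf_variance X) = \<beta> * sqrt ?l"
      proof -
        have "(real (s * Suc m) - real (n * Suc m) * pmf_mean X) = (real s - real n * pmf_mean X) * (sqrt ?l * sqrt ?l)"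
          by (simp add: algebra_simps)
        moreover have "sqrt (real (n * Suc m) * pmf_variance X) = sqrt (real n * pmf_variance X) * sqrt ?l"
          unfolding real_sqrt_mult[symmetric] by (simp add: algebra_simps)
        ultimately show ?thesis using l by (simp add: \<beta>_def del: of_nat_Suc real_sqrt_mult_self)
      qed
      have "u m - t (Suc m) = (normal_tail (\<beta> * sqrt ?l) - measure_pmf.prob (demand X (n * Suc m)) {s * Suc m<..}) / ?l"
        by (simp only: u_def t_def diff_divide_distrib)
      also have "\<bar>\<dots>\<bar> = \<bar>measure_pmf.prob (demand X (n * Suc m)) {s * Suc m<..} - normal_tail (\<beta> * sqrt ?l)\<bar> / ?l"
        by (simp only: abs_divide abs_minus_commute abs_of_nat)
      also have "\<dots> \<le> C / sqrt (real (n * Suc m)) / ?l"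
        using be[of "n * Suc m" "s * Suc m"] n unfolding arg by (intro divide_right_mono) auto
      also have "\<dots> = C / sqrt (real n) * ?l powr (- 3/2)"
      proof -
        have "?l powr (- 3/2) = ?l powr (- (1/2)) * ?l powr (- 1)" by (subst powr_add[symmetric]) simp
        also have "\<dots> = 1 / sqrt ?l / ?l"
          by (simp only: powr_minus_divide[of _ "1/2"] powr_half_sqrt[OF less_imp_le[OF l]] powr_neg_one[OF l]) simp
        finally show ?thesis by (simp only: of_nat_mult real_sqrt_mult) simp
      qed
      finally show ?thesis .
    qed
    have "ln (pmf Q 0) + F \<beta> = (\<Sum>m. u m - t (Suc m))"
      using suminf_diff[OF u(1) t(1)] by (simp add: t(2) u(2))
    also have "\<bar>\<dots>\<bar> \<le> (\<Sum>m. C / sqrt (real n) * real (Suc m) powr (- 3/2))"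
      using norm_suminf_le[of "\<lambda>m. u m - t (Suc m)" "\<lambda>m. C / sqrt (real n) * real (Suc m) powr (- 3/2)"]
        diff summable_mult[OF zeta] by auto
    also have "\<dots> = C * Z / sqrt (real n)"
      unfolding Z_def using suminf_mult[OF zeta, of "C / sqrt (real n)"] by simp
    finally show "\<bar>ln (pmf Q 0) + F ((real s - real n * pmf_mean X) / sqrt (real n * pmf_variance X))\<bar> \<le> C * Z / sqrt (real n)"
      by (simp add: \<beta>_def)
  qed
qed

section \<open>The scaling\<close>

text \<open>Here \<open>g / S powr \<alpha>\<close> is one minus the load.\<close>

lemma scaling_algebra:
  fixes S \<mu> v g \<alpha> n :: real
  assumes S: "0 < S" and \<mu>: "0 < \<mu>" and v: "0 < v" and g: "0 < g"
    and scaling: "n * \<mu> / S = 1 - g / S powr \<alpha>" and x: "g / S powr \<alpha> < 1"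
  shows "S - n * \<mu> = g / S powr \<alpha> * S"
    and "n = S * (1 - g / S powr \<alpha>) / \<mu>"
    and "(sqrt (g\<^sup>2 * \<mu> / (2 * v)))\<^sup>2 * S powr (1 - 2 * \<alpha>) = (g / S powr \<alpha>)\<^sup>2 * S * \<mu> / (2 * v)"
    and "(S - n * \<mu>) / sqrt (n * v)
      = sqrt (g\<^sup>2 * \<mu> / (2 * v)) * sqrt 2 * S powr (1 / 2 - \<alpha>) / sqrt (1 - g / S powr \<alpha>)"
proof -
  define x where "x = g / S powr \<alpha>"
  have x01: "0 < x" "x < 1" using x g S by (auto simp: x_def)
  have nm: "n * \<mu> = S * (1 - x)" using scaling S by (simp add: x_def field_simps)
  show 1: "S - n * \<mu> = g / S powr \<alpha> * S"
    unfolding nm x_def[symmetric] by (simp add: algebra_simps)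
  show 2: "n = S * (1 - g / S powr \<alpha>) / \<mu>"
    using nm \<mu> unfolding x_def[symmetric] by (simp add: field_simps)
  have p: "S powr (1 - 2 * \<alpha>) = S / (S powr \<alpha>)\<^sup>2"
    using S by (simp add: powr_diff power2_eq_square powr_add[symmetric])
  show 3: "(sqrt (g\<^sup>2 * \<mu> / (2 * v)))\<^sup>2 * S powr (1 - 2 * \<alpha>) = (g / S powr \<alpha>)\<^sup>2 * S * \<mu> / (2 * v)"
    unfolding p using \<mu> v by (simp add: power_divide mult_ac)
  have h: "(S powr (1 / 2 - \<alpha>))\<^sup>2 = S powr (1 - 2 * \<alpha>)"
    by (simp add: power2_eq_square powr_add[symmetric])
  have n: "0 < n" unfolding 2 using S \<mu> x by simp
  show "(S - n * \<mu>) / sqrt (n * v)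
      = sqrt (g\<^sup>2 * \<mu> / (2 * v)) * sqrt 2 * S powr (1 / 2 - \<alpha>) / sqrt (1 - g / S powr \<alpha>)" (is "?l = ?r")
  proof (rule power2_eq_imp_eq)
    have "?r\<^sup>2 = 2 * ((sqrt (g\<^sup>2 * \<mu> / (2 * v)))\<^sup>2 * S powr (1 - 2 * \<alpha>)) / (1 - x)"
      using x01 unfolding x_def[symmetric] power_divide power_mult_distrib h by simp
    also have "\<dots> = x\<^sup>2 * S * \<mu> / v / (1 - x)"
      unfolding 3 x_def[symmetric] by simp
    also have "\<dots> = (x * S)\<^sup>2 / (S * (1 - x) / \<mu> * v)"
      using S \<mu> v x01 by (simp add: power2_eq_square mult_ac)
    also have "\<dots> = ?l\<^sup>2"
      using n v unfolding 1 x_def[symmetric] power_divide by (simp add: 2[folded x_def, symmetric])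
    finally show "?l\<^sup>2 = ?r\<^sup>2" ..
    show "0 \<le> ?l" using n v S x01 unfolding 1 x_def[symmetric] by simp
    show "0 \<le> ?r" using x01 \<mu> v unfolding x_def[symmetric] by simp
  qed
qed

text \<open>The exact argument of \<^const>\<open>F\<close> is the one given here divided by the square root of the load
  \<open>1 - x\<close>. As \<^const>\<open>F\<close> is 1-Lipschitz in the logarithm of its argument, this changes it by at most
  \<open>- ln (1 - x) / 2 \<le> x\<close>.\<close>

lemma ln_pmf_0_scaled:
  assumes rad: "conv_radius (pmf X) > 1" and mean: "0 < pmf_mean X"
    and circ: "\<And>z :: complex. norm z = 1 \<Longrightarrow> z \<noteq> 1 \<Longrightarrow> norm (pgf X z) < 1"
  obtains C where "0 \<le> C"
    "\<And>n s Q g \<alpha>. \<lbrakk>0 < n; 0 < s; 0 < g; real n * pmf_mean X / real s = 1 - g / real s powr \<alpha>;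
        g / real s powr \<alpha> \<le> 1 / 2; stationary_congestion X n s Q\<rbrakk> \<Longrightarrow>
      \<bar>ln (pmf Q 0) + F (b0 X g * sqrt 2 * real s powr (1 / 2 - \<alpha>))\<bar> \<le> C / sqrt (real s) + g / real s powr \<alpha>"
proof -
  define \<mu> where "\<mu> = pmf_mean X"
  define v where "v = pmf_variance X"
  have \<mu>: "0 < \<mu>" using mean by (simp add: \<mu>_def)
  have v: "0 < v" unfolding v_def by (rule pmf_variance_pos[OF rad circ])
  obtain C where C: "0 \<le> C" and approx: "\<And>n s Q. \<lbrakk>0 < n; real n * \<mu> < real s; stationary_congestion X n s Q\<rbrakk> \<Longrightarrow>
      \<bar>ln (pmf Q 0) + F ((real s - real n * \<mu>) / sqrt (real n * v))\<bar> \<le> C / sqrt (real n)"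
    using ln_pmf_0_approx[OF rad circ] unfolding \<mu>_def v_def by blast
  show ?thesis
  proof (rule that[of "C * sqrt (2 * \<mu>)"])
    show "0 \<le> C * sqrt (2 * \<mu>)" using C \<mu> by simp
    fix n s :: nat and Q and g \<alpha> :: real
    assume n: "0 < n" and s: "0 < s" and g: "0 < g"
      and scaling: "real n * pmf_mean X / real s = 1 - g / real s powr \<alpha>"
      and half: "g / real s powr \<alpha> \<le> 1 / 2" and st: "stationary_congestion X n s Q"
    define x where "x = g / real s powr \<alpha>"
    have x: "0 < x" "x \<le> 1 / 2" using g s half by (auto simp: x_def)
    have S: "0 < real s" using s by simp
    have x1: "g / real s powr \<alpha> < 1" using half by linarith
    note alg = scaling_algebra[OF S \<mu> v g scaling[folded \<mu>_def] x1, folded x_def]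
    define \<beta> where "\<beta> = b0 X g * sqrt 2 * real s powr (1 / 2 - \<alpha>)"
    have \<beta>: "0 < \<beta>" using g \<mu> v S by (simp add: \<beta>_def b0_def \<mu>_def v_def)
    have arg: "(real s - real n * \<mu>) / sqrt (real n * v) = \<beta> / sqrt (1 - x)"
      using alg(4) by (simp only: \<beta>_def b0_def \<mu>_def v_def)
    have "0 < x * real s" using x S by simp
    then have "real n * \<mu> < real s" using alg(1) by simp
    from approx[OF n this st] have 1: "\<bar>ln (pmf Q 0) + F (\<beta> / sqrt (1 - x))\<bar> \<le> C / sqrt (real n)"
      unfolding arg .
    have "\<bar>F (\<beta> / sqrt (1 - x)) - F \<beta>\<bar> \<le> \<bar>ln (\<beta> / sqrt (1 - x)) - ln \<beta>\<bar>"
      using \<beta> x by (intro F_lipschitz_ln) auto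
    also have "ln (\<beta> / sqrt (1 - x)) - ln \<beta> = - ln (1 - x) / 2"
      using \<beta> x by (simp add: ln_div ln_sqrt)
    also have "\<bar>- ln (1 - x) / 2\<bar> \<le> x"
    proof -
      have "- ln (1 - x) = ln (1 / (1 - x))" using x by (simp add: ln_div)
      also have "\<dots> \<le> 1 / (1 - x) - 1" using x by (intro ln_le_minus_one) auto
      also have "\<dots> = x / (1 - x)" using x by (simp add: field_simps)
      also have "\<dots> \<le> 2 * x"
      proof -
        have "x * (1 / 2) \<le> x * (1 - x)" using x by (intro mult_left_mono) auto
        then show ?thesis using x by (simp add: divide_le_eq)
      qed
      finally have "- ln (1 - x) \<le> 2 * x" .
      moreover have "ln (1 - x) \<le> 0" using x by simp
      ultimately show ?thesis by simp
    qed
    finally have 2: "\<bar>F (\<beta> / sqrt (1 - x)) - F \<beta>\<bar> \<le> x" .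
    have "real s / (2 * \<mu>) \<le> real n"
    proof -
      have "real s * (1 / 2) / \<mu> \<le> real s * (1 - x) / \<mu>"
        using x \<mu> by (intro divide_right_mono mult_left_mono) auto
      then show ?thesis unfolding alg(2)[symmetric] by simp
    qed
    then have "C / sqrt (real n) \<le> C / sqrt (real s / (2 * \<mu>))"
      using C S \<mu> n by (intro divide_left_mono real_sqrt_le_mono) auto
    also have "\<dots> = C * sqrt (2 * \<mu>) / sqrt (real s)"
      by (simp add: real_sqrt_divide)
    finally show "\<bar>ln (pmf Q 0) + F (b0 X g * sqrt 2 * real s powr (1 / 2 - \<alpha>))\<bar>
        \<le> C * sqrt (2 * \<mu>) / sqrt (real s) + g / real s powr \<alpha>"
      using 1 2 unfolding \<beta>_def[symmetric] x_def[symmetric] by linarith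
  qed
qed

text \<open>The optimal exponent of the Chernoff bound is \<open>(b0 X g)\<^sup>2 s powr (1 - 2 \<alpha>)\<close> up to the factor \<open>1 / load \<ge> 1\<close> and
  up to the cubic error of the cumulant bound, which is smaller by the factor \<open>g / s powr \<alpha>\<close>.\<close>

lemma ln_pmf_0_light:
  assumes rad: "conv_radius (pmf X) > 1" and mean: "0 < pmf_mean X" and var: "0 < pmf_variance X"
  obtains K x0 where "0 \<le> K" "0 < x0"
    "\<And>n s Q g \<alpha> E. \<lbrakk>0 < s; 0 < g; real n * pmf_mean X / real s = 1 - g / real s powr \<alpha>;
        g / real s powr \<alpha> \<le> x0; stationary_congestion X n s Q;
        exp (- ((b0 X g)\<^sup>2 - K * g\<^sup>2 * (g / real s powr \<alpha>)) * real s powr (1 - 2 * \<alpha>)) \<le> E; E \<le> 1 / 2\<rbrakk> \<Longrightarrow>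
      \<bar>ln (pmf Q 0)\<bar> \<le> 2 * E"
proof -
  define \<mu> where "\<mu> = pmf_mean X"
  define v where "v = pmf_variance X"
  have \<mu>: "0 < \<mu>" using mean by (simp add: \<mu>_def)
  have v: "0 < v" using var by (simp add: v_def)
  obtain K a where K: "0 < a" "0 \<le> K" and
    int: "\<And>\<theta>. 0 \<le> \<theta> \<Longrightarrow> \<theta> \<le> a \<Longrightarrow> integrable (measure_pmf X) (\<lambda>x. exp (\<theta> * (real x - pmf_mean X)))" and
    mgf: "\<And>\<theta>. 0 \<le> \<theta> \<Longrightarrow> \<theta> \<le> a \<Longrightarrow> measure_pmf.expectation X (\<lambda>x. exp (\<theta> * (real x - pmf_mean X)))
       \<le> exp (pmf_variance X * \<theta>\<^sup>2 / 2 + K * \<theta> ^ 3)"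
    by (rule mgf_bound[OF rad]) (rule that)
  define x0 where "x0 = min (1 / 2) (a * v / (2 * \<mu>))"
  define L where "L = 8 * K * \<mu>\<^sup>2 / v ^ 3"
  show ?thesis
  proof (rule that[of L x0])
    show "0 \<le> L" "0 < x0" using K \<mu> v by (auto simp: L_def x0_def)
    fix n s :: nat and Q and g \<alpha> E :: real
    assume s: "0 < s" and g: "0 < g"
      and scaling: "real n * pmf_mean X / real s = 1 - g / real s powr \<alpha>"
      and small: "g / real s powr \<alpha> \<le> x0" and st: "stationary_congestion X n s Q"
      and E: "exp (- ((b0 X g)\<^sup>2 - L * g\<^sup>2 * (g / real s powr \<alpha>)) * real s powr (1 - 2 * \<alpha>)) \<le> E" "E \<le> 1 / 2"
    define x where "x = g / real s powr \<alpha>"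
    have x: "0 < x" "x \<le> 1 / 2" "x \<le> a * v / (2 * \<mu>)" using g s small by (auto simp: x_def x0_def)
    have S: "0 < real s" using s by simp
    have x1: "g / real s powr \<alpha> < 1" using x(2) unfolding x_def by linarith
    note alg = scaling_algebra[OF S \<mu> v g scaling[folded \<mu>_def] x1, folded x_def]
    have load: "real n * \<mu> < real s"
    proof -
      have "0 < x * real s" using x S by simp
      then show ?thesis using alg(1) by simp
    qed
    have nv: "0 < real n" unfolding alg(2) using x S \<mu> by simp
    \<comment> \<open>The minimiser of the quadratic part of the exponent.\<close>
    define \<theta> where "\<theta> = (real s - real n * \<mu>) / (real n * v)"
    have \<theta>_eq: "\<theta> = x * \<mu> / ((1 - x) * v)"
      unfolding \<theta>_def alg(1) using S \<mu> v x by (subst alg(2)) (simp add: field_simps)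
    have \<theta>0: "0 \<le> \<theta>" unfolding \<theta>_eq using x \<mu> v by simp
    have \<theta>_le: "\<theta> \<le> 2 * x * \<mu> / v"
    proof -
      have "\<theta> \<le> x * \<mu> / (1 / 2 * v)"
        unfolding \<theta>_eq using x \<mu> v by (intro divide_left_mono mult_right_mono) auto
      then show ?thesis by (simp add: mult_ac)
    qed
    also have "2 * x * \<mu> / v \<le> a" using x(3) \<mu> v by (simp add: field_simps)
    finally have \<theta>a: "\<theta> \<le> a" .
    have cube: "real n * (K * \<theta> ^ 3) \<le> L * g\<^sup>2 * x * real s powr (1 - 2 * \<alpha>)"
    proof -
      have "real n \<le> real s / \<mu>"
        by (subst alg(2)) (use x S \<mu> in \<open>auto intro!: divide_right_mono mult_left_le\<close>)
      then have "real n * (K * \<theta> ^ 3) \<le> real s / \<mu> * (K * (2 * x * \<mu> / v) ^ 3)"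
        using K \<theta>0 \<theta>_le S \<mu> by (intro mult_mono mult_left_mono power_mono) auto
      also have "\<dots> = L * (x\<^sup>2 * real s) * x"
        using \<mu> v by (simp add: L_def power3_eq_cube power2_eq_square field_simps)
      also have "x\<^sup>2 * real s = g\<^sup>2 * real s powr (1 - 2 * \<alpha>)"
        using alg(3) \<mu> v by (simp add: field_simps)
      finally show ?thesis by (simp add: mult_ac)
    qed
    have quad: "(b0 X g)\<^sup>2 * real s powr (1 - 2 * \<alpha>) \<le> \<theta> * (real s - real n * \<mu>) / 2"
    proof -
      have "(b0 X g)\<^sup>2 * real s powr (1 - 2 * \<alpha>) = x\<^sup>2 * real s * \<mu> / (2 * v)"
        using alg(3) by (simp only: b0_def \<mu>_def v_def)
      also have "\<dots> \<le> x\<^sup>2 * real s * \<mu> / (2 * v) / (1 - x)"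
        using x S \<mu> v by (simp add: le_divide_eq mult_left_le)
      also have "\<dots> = \<theta> * (real s - real n * \<mu>) / 2"
        unfolding \<theta>_eq alg(1) using x v by (simp add: power2_eq_square mult_ac)
      finally show ?thesis .
    qed
    have "real n * (v * \<theta>\<^sup>2 / 2 + K * \<theta> ^ 3) - \<theta> * (real s - real n * \<mu>)
        = real n * (K * \<theta> ^ 3) - \<theta> * (real s - real n * \<mu>) / 2"
    proof -
      have "real n * (v * \<theta>\<^sup>2 / 2) = \<theta> * (real n * v * \<theta>) / 2" by (simp add: power2_eq_square)
      also have "real n * v * \<theta> = real s - real n * \<mu>" using nv v by (simp add: \<theta>_def)
      finally have "real n * (v * \<theta>\<^sup>2 / 2) = \<theta> * (real s - real n * \<mu>) / 2" .
      then show ?thesis by (simp add: distrib_left)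
    qed
    also have "\<dots> \<le> - ((b0 X g)\<^sup>2 - L * g\<^sup>2 * x) * real s powr (1 - 2 * \<alpha>)"
      using cube quad by (simp add: left_diff_distrib)
    finally have "exp (real n * (v * \<theta>\<^sup>2 / 2 + K * \<theta> ^ 3) - \<theta> * (real s - real n * \<mu>))
        \<le> exp (- ((b0 X g)\<^sup>2 - L * g\<^sup>2 * x) * real s powr (1 - 2 * \<alpha>))" by simp
    also have "\<dots> \<le> E" using E(1) by (simp add: x_def)
    finally show "\<bar>ln (pmf Q 0)\<bar> \<le> 2 * E"
      using load int[OF \<theta>0 \<theta>a] mgf[OF \<theta>0 \<theta>a] \<theta>0 E(2) st rad unfolding \<mu>_def v_def
      by (intro ln_pmf_0_le_chernoff[where \<theta> = \<theta>]) auto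
  qed
qed

lemma powr_at_top_at_top: "0 < e \<Longrightarrow> filterlim (\<lambda>x :: real. x powr e) at_top at_top"
  by real_asymp

section \<open>The three regimes\<close>

theorem proposition8:
  fixes X :: "nat pmf" and \<alpha> :: real
    and s :: "nat \<Rightarrow> nat" and n :: "nat \<Rightarrow> nat" and \<gamma> :: "nat \<Rightarrow> real"
    and Q :: "nat \<Rightarrow> nat pmf"
  assumes mean_pos: "pmf_mean X > 0"
    and radius: "conv_radius (pmf X) > 1"
    and max_on_circle: "\<And>(r1 :: real) (z :: complex).
      \<lbrakk>0 < r1; ereal r1 < conv_radius (pmf X); cmod z = r1; z \<noteq> of_real r1\<rbrakk>
        \<Longrightarrow> cmod (pgf X z) < pgf X r1"
    and alpha: "\<alpha> > 0"
    and s_to_infinity: "filterlim s at_top sequentially"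
    and positive: "\<And>k. s k > 0" "\<And>k. n (s k) > 0"
    and load: "\<And>k. 0 < real (n (s k)) * pmf_mean X"
      "\<And>k. real (n (s k)) * pmf_mean X < real (s k)"
    and exceed: "\<And>k. \<exists>j > s k. pmf (demand X (n (s k))) j > 0"
    and scaling: "\<And>k. real (n (s k)) * pmf_mean X / real (s k)
      = 1 - \<gamma> (s k) / real (s k) powr \<alpha>"
    and gamma_pos: "\<And>k. \<gamma> (s k) > 0"
    and gamma_bounded: "\<exists>c C. 0 < c \<and> (\<forall>\<^sub>F k in sequentially. c \<le> \<gamma> (s k) \<and> \<gamma> (s k) \<le> C)"
    and stationary: "\<And>k. stationary_congestion X (n (s k)) (s k) (Q (s k))"
  shows
    "(\<alpha> < 1/2 \<longrightarrow>
        (\<forall>b :: real. 0 < b \<and> ereal b < liminf (\<lambda>k. ereal (b0 X (\<gamma> (s k)))) \<longrightarrow>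
          (\<lambda>k. ln (pmf (Q (s k)) 0)) \<in> O(\<lambda>k. exp (- b\<^sup>2 * real (s k) powr (1 - 2 * \<alpha>)))))
   \<and> (\<alpha> = 1/2 \<longrightarrow>
        (\<exists>\<epsilon> :: nat \<Rightarrow> real. \<epsilon> \<in> O(\<lambda>k. 1 / sqrt (real (s k))) \<and>
          (\<forall>k. ln (pmf (Q (s k)) 0) = - F (b0 X (\<gamma> (s k)) * sqrt 2) * (1 + \<epsilon> k))))
   \<and> (1/2 < \<alpha> \<and> \<alpha> < 1 \<and> (\<forall>k. 0 < b0 X (\<gamma> (s k)) \<and> b0 X (\<gamma> (s k)) < sqrt (2 * pi)) \<longrightarrow>
        (\<exists>\<delta> \<epsilon> :: nat \<Rightarrow> real.
          \<delta> \<in> O(\<lambda>k. real (s k) powr (1/2 - \<alpha>)) \<and>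
          \<epsilon> \<in> O(\<lambda>k. real (s k) powr (\<alpha> - 1)) \<and>
          (\<forall>k. ln (pmf (Q (s k)) 0) =
            (- (\<alpha> - 1/2) * ln (real (s k)) + ln (2 * b0 X (\<gamma> (s k))) + \<delta> k) * (1 + \<epsilon> k))))"
proof (intro conjI impI allI)
  define S where "S k = real (s k)" for k
  define g where "g k = \<gamma> (s k)" for k
  define P where "P k = ln (pmf (Q (s k)) 0)" for k
  define B where "B k = b0 X (g k)" for k
  define \<beta> where "\<beta> k = B k * sqrt 2 * S k powr (1 / 2 - \<alpha>)" for k
  have circ: "norm (pgf X z) < 1" if "norm z = 1" "z \<noteq> 1" for z :: complex
    using max_on_circle[of 1 z] radius that by (simp add: pgf_1 one_ereal_def)
  have v: "0 < pmf_variance X" by (rule pmf_variance_pos[OF radius circ])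
  have S0: "0 < S k" for k using positive(1) by (simp add: S_def)
  have S1: "1 \<le> S k" for k using positive(1)[of k] by (simp add: S_def)
  have g0: "0 < g k" for k using gamma_pos by (simp add: g_def)
  have S_lim: "filterlim S at_top sequentially"
    unfolding S_def by (rule filterlim_compose[OF filterlim_real_sequentially s_to_infinity])
  obtain c0 G where c0: "0 < c0" and G: "\<forall>\<^sub>F k in sequentially. c0 \<le> g k \<and> g k \<le> G"
    using gamma_bounded unfolding g_def by blast
  have G_le: "\<forall>\<^sub>F k in sequentially. g k \<le> G" using G by eventually_elim auto
  have "0 \<le> G"
  proof -
    obtain k where "g k \<le> G" using eventually_happens[OF G_le] by auto
    with g0[of k] show ?thesis by linarith
  qed
  have x_lim: "((\<lambda>k. g k / S k powr \<alpha>) \<longlongrightarrow> 0) sequentially"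
  proof (rule tendsto_sandwich[where f = "\<lambda>_. 0" and h = "\<lambda>k. G * S k powr (- \<alpha>)"])
    have "((\<lambda>k. S k powr (- \<alpha>)) \<longlongrightarrow> 0) sequentially"
      using alpha by (intro tendsto_neg_powr S_lim) auto
    then have "((\<lambda>k. G * S k powr (- \<alpha>)) \<longlongrightarrow> G * 0) sequentially" by (intro tendsto_intros)
    then show "((\<lambda>k. G * S k powr (- \<alpha>)) \<longlongrightarrow> 0) sequentially" by simp
    show "\<forall>\<^sub>F k in sequentially. g k / S k powr \<alpha> \<le> G * S k powr (- \<alpha>)"
      using G_le by eventually_elim (simp add: powr_minus_divide divide_right_mono)
    show "\<forall>\<^sub>F k in sequentially. 0 \<le> g k / S k powr \<alpha>"
      using g0 by (intro always_eventually allI) (simp add: less_imp_le)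
  qed simp
  have x_small: "\<forall>\<^sub>F k in sequentially. g k / S k powr \<alpha> \<le> d" if "0 < d" for d
    using order_tendstoD(2)[OF x_lim that] by eventually_elim simp
  have B_eq: "B k = g k * sqrt (pmf_mean X / (2 * pmf_variance X))" for k
    using g0[of k] mean_pos v by (simp add: B_def b0_def real_sqrt_mult real_sqrt_divide)
  define \<tau> where "\<tau> = sqrt (pmf_mean X / (2 * pmf_variance X))"
  have \<tau>: "0 < \<tau>" using mean_pos v by (simp add: \<tau>_def)
  have B0: "0 < B k" for k using g0[of k] \<tau> by (simp add: B_eq \<tau>_def)
  have B_le: "\<forall>\<^sub>F k in sequentially. B k \<le> G * \<tau>"
    using G_le by eventually_elim (use \<tau> in \<open>simp add: B_eq \<tau>_def mult_right_mono\<close>)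
  have \<beta>0: "0 < \<beta> k" for k using B0[of k] S0[of k] by (simp add: \<beta>_def)
  obtain C where C: "0 \<le> C" and approx: "\<And>n s Q g \<alpha>. \<lbrakk>0 < n; 0 < s; 0 < g;
        real n * pmf_mean X / real s = 1 - g / real s powr \<alpha>;
        g / real s powr \<alpha> \<le> 1 / 2; stationary_congestion X n s Q\<rbrakk> \<Longrightarrow>
      \<bar>ln (pmf Q 0) + F (b0 X g * sqrt 2 * real s powr (1 / 2 - \<alpha>))\<bar> \<le> C / sqrt (real s) + g / real s powr \<alpha>"
    by (rule ln_pmf_0_scaled[OF radius mean_pos circ]) (assumption | rule that)+
  have main: "\<forall>\<^sub>F k in sequentially. \<bar>P k + F (\<beta> k)\<bar> \<le> C * S k powr (- (1 / 2)) + G * S k powr (- \<alpha>)"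
    using x_small[of "1 / 2", simplified] G_le
  proof eventually_elim
    case (elim k)
    have "\<bar>P k + F (\<beta> k)\<bar> \<le> C / sqrt (S k) + g k / S k powr \<alpha>"
      unfolding P_def \<beta>_def B_def S_def g_def
      by (rule approx[OF positive(2) positive(1) gamma_pos scaling _ stationary])
         (use elim in \<open>simp add: g_def S_def\<close>)
    also have "\<dots> \<le> C * S k powr (- (1 / 2)) + G * S k powr (- \<alpha>)"
      using elim S0[of k] by (simp add: powr_minus_divide powr_half_sqrt divide_right_mono)
    finally show ?case .
  qed

  {
    fix b :: real
    assume \<alpha>: "\<alpha> < 1 / 2" and b: "0 < b \<and> ereal b < liminf (\<lambda>k. ereal (b0 X (\<gamma> (s k))))"
    obtain b' where b': "ereal b < ereal b'" "ereal b' < liminf (\<lambda>k. ereal (b0 X (\<gamma> (s k))))"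
      using ereal_dense2 b by blast
    have bB: "\<forall>\<^sub>F k in sequentially. b' < B k"
      using less_LiminfD[OF b'(2)] by (simp add: B_def g_def)
    have bb: "0 < b" "b < b'" using b b' by auto
    obtain K x0 where K: "0 \<le> K" "0 < x0" and light: "\<And>n s Q g \<alpha> E. \<lbrakk>0 < s; 0 < g;
        real n * pmf_mean X / real s = 1 - g / real s powr \<alpha>;
        g / real s powr \<alpha> \<le> x0; stationary_congestion X n s Q;
        exp (- ((b0 X g)\<^sup>2 - K * g\<^sup>2 * (g / real s powr \<alpha>)) * real s powr (1 - 2 * \<alpha>)) \<le> E; E \<le> 1 / 2\<rbrakk> \<Longrightarrow>
      \<bar>ln (pmf Q 0)\<bar> \<le> 2 * E"
      by (rule ln_pmf_0_light[OF radius mean_pos v]) (assumption | rule that)+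
    \<comment> \<open>For \<open>g / S powr \<alpha> \<le> d\<close> the gap between \<open>b\<close> and \<open>b'\<close> absorbs the cubic error.\<close>
    define d where "d = (b'\<^sup>2 - b\<^sup>2) / (K * G\<^sup>2 + 1)"
    have "b\<^sup>2 < b'\<^sup>2" using bb by (intro power_strict_mono) auto
    then have d: "0 < d" using K by (simp add: d_def add_nonneg_pos)
    have "filterlim (\<lambda>k. S k powr (1 - 2 * \<alpha>)) at_top sequentially"
      using \<alpha> by (intro filterlim_compose[OF powr_at_top_at_top S_lim]) simp
    then have big: "\<forall>\<^sub>F k in sequentially. 1 / b\<^sup>2 \<le> S k powr (1 - 2 * \<alpha>)"
      by (simp add: filterlim_at_top)
    have "\<forall>\<^sub>F k in sequentially. \<bar>P k\<bar> \<le> 2 * exp (- b\<^sup>2 * S k powr (1 - 2 * \<alpha>))"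
      using bB x_small[OF K(2)] x_small[OF d] big G_le
    proof eventually_elim
      case (elim k)
      have "K * (g k)\<^sup>2 \<le> K * G\<^sup>2"
        using elim(5) K g0[of k] by (intro mult_left_mono power_mono) auto
      then have "K * (g k)\<^sup>2 * (g k / S k powr \<alpha>) \<le> (K * G\<^sup>2 + 1) * d"
        using elim(3) K g0[of k] by (intro mult_mono) (auto intro: less_imp_le)
      also have "\<dots> = b'\<^sup>2 - b\<^sup>2"
        using K by (simp add: d_def add_nonneg_pos less_imp_neq[symmetric])
      finally have "b\<^sup>2 \<le> b'\<^sup>2 - K * (g k)\<^sup>2 * (g k / S k powr \<alpha>)" by simp
      moreover have "b'\<^sup>2 \<le> (B k)\<^sup>2" using elim(1) bb by (intro power_mono) auto
      ultimately have "b\<^sup>2 \<le> (B k)\<^sup>2 - K * (g k)\<^sup>2 * (g k / S k powr \<alpha>)" by linarith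
      then have "b\<^sup>2 * S k powr (1 - 2 * \<alpha>) \<le> ((B k)\<^sup>2 - K * (g k)\<^sup>2 * (g k / S k powr \<alpha>)) * S k powr (1 - 2 * \<alpha>)"
        by (rule mult_right_mono) simp
      then have 1: "exp (- ((B k)\<^sup>2 - K * (g k)\<^sup>2 * (g k / S k powr \<alpha>)) * S k powr (1 - 2 * \<alpha>))
          \<le> exp (- b\<^sup>2 * S k powr (1 - 2 * \<alpha>))"
        unfolding exp_le_cancel_iff mult_minus_left by (rule le_imp_neg_le)
      have "1 \<le> b\<^sup>2 * S k powr (1 - 2 * \<alpha>)" using elim(4) bb by (simp add: field_simps)
      then have "exp (- b\<^sup>2 * S k powr (1 - 2 * \<alpha>)) \<le> exp (- 1)" by simp
      also have "exp (- 1 :: real) \<le> 1 / 2"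
        using exp_ge_add_one_self[of "1 :: real"] by (simp add: exp_minus inverse_le_iff_le divide_simps)
      finally have 2: "exp (- b\<^sup>2 * S k powr (1 - 2 * \<alpha>)) \<le> 1 / 2" .
      show ?case
        using 1 2 elim(2) unfolding P_def B_def S_def g_def
        by (intro light[OF positive(1) gamma_pos scaling _ stationary])
    qed
    then show "(\<lambda>k. ln (pmf (Q (s k)) 0)) \<in> O(\<lambda>k. exp (- b\<^sup>2 * real (s k) powr (1 - 2 * \<alpha>)))"
      by (intro bigoI[where c = 2]) (simp add: P_def S_def)
  }

  {
    assume \<alpha>: "\<alpha> = 1 / 2"
    have \<beta>_eq: "\<beta> k = b0 X (\<gamma> (s k)) * sqrt 2" for k
      using S0[of k] by (simp add: \<beta>_def B_def g_def \<alpha>)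
    define \<epsilon> where "\<epsilon> k = - P k / F (\<beta> k) - 1" for k
    \<comment> \<open>An upper bound of \<open>\<beta>\<close>: it keeps \<open>F (\<beta> k)\<close> away from 0, so that an absolute error is a relative one.\<close>
    define M where "M = G * \<tau> * sqrt 2 + 1"
    have M: "0 < M" using \<open>0 \<le> G\<close> \<tau> by (simp add: M_def add_nonneg_pos)
    have FM: "0 < F M" by (rule F_pos[OF M])
    have "\<forall>\<^sub>F k in sequentially. norm (\<epsilon> k) \<le> (C + G) / F M * norm (1 / sqrt (real (s k)))"
      using main B_le
    proof eventually_elim
      case (elim k)
      have "B k * sqrt 2 \<le> G * \<tau> * sqrt 2" using elim(2) by (intro mult_right_mono) auto
      then have "B k * sqrt 2 \<le> M" unfolding M_def by linarith
      then have "\<beta> k \<le> M" by (simp add: \<beta>_eq B_def g_def)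
      then have F: "F M \<le> F (\<beta> k)" by (intro F_scale \<beta>0)
      have "\<epsilon> k = - (P k + F (\<beta> k)) / F (\<beta> k)"
        using F FM by (simp add: \<epsilon>_def diff_divide_distrib)
      then have "norm (\<epsilon> k) = \<bar>P k + F (\<beta> k)\<bar> / F (\<beta> k)"
        using F FM by (simp only: real_norm_def abs_divide abs_minus_cancel abs_of_pos)
      also have "\<dots> \<le> ((C + G) * S k powr (- (1 / 2))) / F M"
        using elim(1) F FM C \<open>0 \<le> G\<close> by (intro frac_le) (auto simp: \<alpha> distrib_right)
      also have "\<dots> = (C + G) / F M * norm (1 / sqrt (real (s k)))"
        using S0[of k] by (simp add: powr_minus_divide powr_half_sqrt S_def)
      finally show ?case .
    qed
    then have "\<epsilon> \<in> O(\<lambda>k. 1 / sqrt (real (s k)))" by (rule bigoI)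
    moreover have "ln (pmf (Q (s k)) 0) = - F (b0 X (\<gamma> (s k)) * sqrt 2) * (1 + \<epsilon> k)" for k
      using F_pos[OF \<beta>0, of k] unfolding \<beta>_eq[symmetric] P_def[symmetric] \<epsilon>_def by simp
    ultimately show "\<exists>\<epsilon> :: nat \<Rightarrow> real. \<epsilon> \<in> O(\<lambda>k. 1 / sqrt (real (s k))) \<and>
          (\<forall>k. ln (pmf (Q (s k)) 0) = - F (b0 X (\<gamma> (s k)) * sqrt 2) * (1 + \<epsilon> k))"
      by blast
  }

  {
    assume \<alpha>: "1/2 < \<alpha> \<and> \<alpha> < 1 \<and> (\<forall>k. 0 < b0 X (\<gamma> (s k)) \<and> b0 X (\<gamma> (s k)) < sqrt (2 * pi))"
    \<comment> \<open>The whole error is \<open>O(S powr (1/2 - \<alpha>))\<close>, so it is put into \<open>\<delta>\<close> and \<open>\<epsilon>\<close> is 0.\<close>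
    define \<delta> where "\<delta> k = P k - (- (\<alpha> - 1/2) * ln (S k) + ln (2 * B k))" for k
    have ln_\<beta>: "ln (\<beta> k) + ln 2 / 2 = - (\<alpha> - 1/2) * ln (S k) + ln (2 * B k)" for k
      using B0[of k] S0[of k] by (simp add: \<beta>_def ln_mult ln_sqrt ln_powr algebra_simps)
    have "((\<lambda>k. S k powr (1 / 2 - \<alpha>)) \<longlongrightarrow> 0) sequentially"
      using \<alpha> by (intro tendsto_neg_powr S_lim) auto
    then have "((\<lambda>k. G * \<tau> * sqrt 2 * S k powr (1 / 2 - \<alpha>)) \<longlongrightarrow> G * \<tau> * sqrt 2 * 0) sequentially"
      by (intro tendsto_intros)
    then have "\<forall>\<^sub>F k in sequentially. G * \<tau> * sqrt 2 * S k powr (1 / 2 - \<alpha>) < 1"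
      by (intro order_tendstoD) auto
    then have "\<forall>\<^sub>F k in sequentially. norm (\<delta> k) \<le> (C + G + G * \<tau> * sqrt 2) * norm (real (s k) powr (1/2 - \<alpha>))"
      using main B_le
    proof eventually_elim
      case (elim k)
      have \<beta>_le: "\<beta> k \<le> G * \<tau> * sqrt 2 * S k powr (1 / 2 - \<alpha>)"
        using elim(3) unfolding \<beta>_def by (intro mult_right_mono) auto
      then have "\<bar>F (\<beta> k) + ln (\<beta> k) + ln 2 / 2\<bar> \<le> \<beta> k"
        using elim(1) by (intro F_near_0 \<beta>0) auto
      moreover have "\<delta> k = (P k + F (\<beta> k)) - (F (\<beta> k) + ln (\<beta> k) + ln 2 / 2)"
        unfolding \<delta>_def ln_\<beta>[symmetric] by simp
      ultimately have "\<bar>\<delta> k\<bar> \<le> (C * S k powr (- (1 / 2)) + G * S k powr (- \<alpha>))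
          + G * \<tau> * sqrt 2 * S k powr (1 / 2 - \<alpha>)"
        using elim(2) \<beta>_le by linarith
      also have "\<dots> \<le> (C * S k powr (1 / 2 - \<alpha>) + G * S k powr (1 / 2 - \<alpha>))
          + G * \<tau> * sqrt 2 * S k powr (1 / 2 - \<alpha>)"
        using S1[of k] \<alpha> C \<open>0 \<le> G\<close> by (intro add_right_mono add_mono mult_left_mono powr_mono) auto
      finally show ?case by (simp add: S_def distrib_right)
    qed
    then have "\<delta> \<in> O(\<lambda>k. real (s k) powr (1/2 - \<alpha>))" by (rule bigoI)
    moreover have "(\<lambda>_. 0 :: real) \<in> O(\<lambda>k. real (s k) powr (\<alpha> - 1))" by simp
    moreover have "ln (pmf (Q (s k)) 0) =
        (- (\<alpha> - 1/2) * ln (real (s k)) + ln (2 * b0 X (\<gamma> (s k))) + \<delta> k) * (1 + 0)" for k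
      by (simp add: \<delta>_def P_def S_def B_def g_def)
    ultimately show "\<exists>\<delta> \<epsilon> :: nat \<Rightarrow> real.
          \<delta> \<in> O(\<lambda>k. real (s k) powr (1/2 - \<alpha>)) \<and>
          \<epsilon> \<in> O(\<lambda>k. real (s k) powr (\<alpha> - 1)) \<and>
          (\<forall>k. ln (pmf (Q (s k)) 0) =
            (- (\<alpha> - 1/2) * ln (real (s k)) + ln (2 * b0 X (\<gamma> (s k))) + \<delta> k) * (1 + \<epsilon> k))"
      by (intro exI[of _ \<delta>] exI[of _ "\<lambda>_. 0"] conjI allI)
  }
qed

end
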